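(* Let $\mathfrak H$ be a Hilbert space, let $\phi$ be a $\mathcal B(\mathfrak H)$-valued ordered measure, and assume $\int\|\phi\|_2<\pi$. Then: (a) the norm of the sum of the Magnus expansion $\mu_{\mathrm R}(\phi)=\sum_{k=1}^\infty\mu_{k,\mathrm R}(\phi)$ satisfies $$\|\mu_{\mathrm R}(\phi)\|_2\le J\Big(\int\|\phi\|_2\Big);$$ (b) for every $k\ge 1$, the $k$th term of the Magnus expansion satisfies $$\|\mu_{k,\mathrm R}(\phi)\|_2\le \pi^{-k+1}\,2\sqrt{\mathrm e\,k}\;\Big(\int\|\phi\|_2\Big)^k .$$
   Context: $\mathfrak H$ is real or complex; $\|\cdot\|_2$ is the operator norm on $\mathcal B(\mathfrak H)$. A $\mathcal B(\mathfrak H)$-valued ordered measure $\phi$ is a nonatomic countably additive $\mathcal B(\mathfrak H)$-valued Borel measure on an interval $I\subset\mathbb R$ with finite total variation $\int\|\phi\|_2$. Its right time-ordered exponential is $\exp_{\mathrm R}(\phi)=\mathrm{Id}+\sum_{k\ge1}\int_{t_1\le\dots\le t_k\in I}\phi(t_1)\cdots\phi(t_k)$, equivalently the limit, along refining partitions of $I$ into consecutive intervals $I_1<\dots<I_n$, of $\exp(\phi(I_1))\cdots\exp(\phi(I_n))$. For $A$ with spectrum disjoint from $(-\infty,0]$, $\log A=\int_0^1 (A-\mathrm{Id})(\lambda\,\mathrm{Id}+(1-\lambda)A)^{-1}d\lambda$. The Magnus terms $\mu_{k,\mathrm R}(\phi)$ are defined by $\log\exp_{\mathrm R}(t\phi)=\sum_{k\ge1}\mu_{k,\mathrm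 R}(\phi)t^k$ for small $|t|$; when $\int\|\phi\|_2<\pi$ the series $\sum_k\mu_{k,\mathrm R}(\phi)$ converges absolutely. The function $J$: for $p>0$ let $\ell(p)\in(0,\pi/2)$ be the unique solution of $\ell(p)+p\sin\ell(p)=\frac\pi2$. For $0<p<\pi$, $$J(p)=\int_{\ell(p)}^{\pi-\ell(p)}\frac{p+\sin(p\sin t)-p\sin t\,\cos(p\sin t)}{2\sin(p\sin t)}\,dt ,$$ and $J(0)=0$. *)

theory Defs
  imports "HOL-Analysis.Analysis"
begin

(* Hilbert spaces are types of sort {real_inner, banach}, and B(H) is the type 'a =>L 'a of bounded
   real-linear operators with the operator norm. A complex Hilbert space is covered as well, through
   its underlying real Hilbert space with inner product Re <x, y>: the norm of H is unchanged, the
   bounded complex-linear operators form a closed subalgebra of 'a =>L 'a with the same identity,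
   inverses and norm, and every notion below involves real scalars only. *)

(* M only supplies the underlying space and sigma-algebra of the vector measure. *)
definition vector_measure :: "'b measure \<Rightarrow> ('b set \<Rightarrow> 'e::real_normed_vector) \<Rightarrow> bool" where
  "vector_measure M \<nu> \<longleftrightarrow>
     (\<forall>A::nat \<Rightarrow> 'b set. range A \<subseteq> sets M \<and> disjoint_family A \<longrightarrow>
        (\<lambda>n. \<nu> (A n)) sums \<nu> (\<Union>n. A n))"

definition variation_sums :: "'b measure \<Rightarrow> ('b set \<Rightarrow> 'e::real_normed_vector) \<Rightarrow> real set" where
  "variation_sums M \<nu> =
     {\<Sum>E\<in>P. norm (\<nu> E) | P. finite P \<and> P \<subseteq> sets M \<and> partition_on (space M) P}"

definition total_variation :: "'b measure \<Rightarrow> ('b set \<Rightarrow> 'e::real_normed_vector) \<Rightarrow> real" where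
  "total_variation M \<nu> = Sup (variation_sums M \<nu>)"

definition vm_atom :: "'b measure \<Rightarrow> ('b set \<Rightarrow> 'e::real_normed_vector) \<Rightarrow> 'b set \<Rightarrow> bool" where
  "vm_atom M \<nu> E \<longleftrightarrow> E \<in> sets M \<and> \<nu> E \<noteq> 0 \<and>
     (\<forall>F\<in>sets M. F \<subseteq> E \<longrightarrow> \<nu> F = 0 \<or> \<nu> F = \<nu> E)"

abbreviation borel_on :: "real set \<Rightarrow> real measure" where
  "borel_on I \<equiv> restrict_space borel I"

definition ordered_measure :: "real set \<Rightarrow> (real set \<Rightarrow> 'e::real_normed_vector) \<Rightarrow> bool" where
  "ordered_measure I \<phi> \<longleftrightarrow> is_interval I \<and> vector_measure (borel_on I) \<phi> \<and>
     (\<nexists>E. vm_atom (borel_on I) \<phi> E) \<and> bdd_above (variation_sums (borel_on I) \<phi>)"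

(* nu is the k-fold product of phi with itself, i.e. the vector measure "phi(t_1) ... phi(t_k)" on
   I^k; it is determined by its values on measurable boxes. The operators are multiplied in the
   order of the coordinates, which are numbered from 0 to k - 1. *)
definition is_product_vm ::
  "real set \<Rightarrow> (real set \<Rightarrow> ('a::real_normed_vector \<Rightarrow>\<^sub>L 'a)) \<Rightarrow> nat \<Rightarrow>
     ((nat \<Rightarrow> real) set \<Rightarrow> ('a \<Rightarrow>\<^sub>L 'a)) \<Rightarrow> bool" where
  "is_product_vm I \<phi> k \<nu> \<longleftrightarrow>
     vector_measure (PiM {..<k} (\<lambda>_. borel_on I)) \<nu> \<and>
     (\<forall>E. (\<forall>i<k. E i \<in> sets (borel_on I)) \<longrightarrow>
        \<nu> (Pi\<^sub>E {..<k} E) = foldr (o\<^sub>L) (map (\<lambda>i. \<phi> (E i)) [0..<k]) id_blinfun)"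

definition time_simplex :: "real set \<Rightarrow> nat \<Rightarrow> (nat \<Rightarrow> real) set" where
  "time_simplex I k = {t \<in> Pi\<^sub>E {..<k} (\<lambda>_. I). \<forall>i j. i \<le> j \<and> j < k \<longrightarrow> t i \<le> t j}"

(* The integral of phi(t_1) ... phi(t_k) over t_1 <= ... <= t_k in I. *)
definition simplex_integral ::
  "real set \<Rightarrow> (real set \<Rightarrow> ('a::real_normed_vector \<Rightarrow>\<^sub>L 'a)) \<Rightarrow> nat \<Rightarrow> ('a \<Rightarrow>\<^sub>L 'a)" where
  "simplex_integral I \<phi> k = (THE L. \<exists>\<nu>. is_product_vm I \<phi> k \<nu> \<and> L = \<nu> (time_simplex I k))"

definition exp_R ::
  "real set \<Rightarrow> (real set \<Rightarrow> ('a::{real_inner,banach} \<Rightarrow>\<^sub>L 'a)) \<Rightarrow> ('a \<Rightarrow>\<^sub>L 'a)" where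
  "exp_R I \<phi> = id_blinfun + (\<Sum>k. simplex_integral I \<phi> (Suc k))"

definition op_inv :: "('a::real_normed_vector \<Rightarrow>\<^sub>L 'a) \<Rightarrow> ('a \<Rightarrow>\<^sub>L 'a)" where
  "op_inv A = (THE B. A o\<^sub>L B = id_blinfun \<and> B o\<^sub>L A = id_blinfun)"

(* Meaningful only if the spectrum of A is disjoint from the half-line of nonpositive reals. *)
definition op_log :: "('a::{real_inner,banach} \<Rightarrow>\<^sub>L 'a) \<Rightarrow> ('a \<Rightarrow>\<^sub>L 'a)" where
  "op_log A = integral {0..1}
     (\<lambda>s::real. (A - id_blinfun) o\<^sub>L op_inv (s *\<^sub>R id_blinfun + (1 - s) *\<^sub>R A))"

(* The sequence of Taylor coefficients at t = 0 of log exp_R(t phi); index 0 is a dummy. *)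
definition magnus_R ::
  "real set \<Rightarrow> (real set \<Rightarrow> ('a::{real_inner,banach} \<Rightarrow>\<^sub>L 'a)) \<Rightarrow> nat \<Rightarrow> ('a \<Rightarrow>\<^sub>L 'a)" where
  "magnus_R I \<phi> = (THE c. c 0 = 0 \<and>
     (\<forall>\<^sub>F t::real in nhds 0.
        (\<lambda>k. t ^ Suc k *\<^sub>R c (Suc k)) sums op_log (exp_R I (\<lambda>E. t *\<^sub>R \<phi> E))))"

definition magnus_sum_R ::
  "real set \<Rightarrow> (real set \<Rightarrow> ('a::{real_inner,banach} \<Rightarrow>\<^sub>L 'a)) \<Rightarrow> ('a \<Rightarrow>\<^sub>L 'a)" where
  "magnus_sum_R I \<phi> = (\<Sum>k. magnus_R I \<phi> (Suc k))"

definition ell :: "real \<Rightarrow> real" where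
  "ell p = (THE l. 0 < l \<and> l < pi / 2 \<and> l + p * sin l = pi / 2)"

(* Used for 0 <= p < pi only. *)
definition J :: "real \<Rightarrow> real" where
  "J p = (if p = 0 then 0 else
     integral {ell p..pi - ell p}
       (\<lambda>t. (p + sin (p * sin t) - p * sin t * cos (p * sin t)) / (2 * sin (p * sin t))))"

end

(* Write A for the ordered exponential. A is a limit of ordered products of operators 1 + B with total
   norm at most p. Following a vector x through such a product, the logarithm of the norm and the angle
   to x change with speed at most the norm of B, so ln(|A x| / |x|) + i angle(x, A x) stays in the disc
   of radius p. The region exp(disc) lies on one side of every circle that touches it and is centred on
   the real axis, and membership of the conformal range in the corresponding side is an inequality
   between norms of A x and x. Hence f(A) lies within disc_radius of disc_center * 1 for
   f(z) = (z - 1) / (1 + s (z - 1)). Integrating over s gives log A; the centres cancel by symmetry and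
   the radii integrate to J(p). On the complexified space the same holds for exp_R(z phi) with
   |z| p < pi, so Cauchy's estimate applied to f(exp_R(z phi)) bounds the k-th Magnus term by
   J(r p) / r^k, and r p = pi (1 - 1 / (2 k)) is nearly optimal.

   The product vector measures exist although B(H) lacks the Radon-Nikodym property: they are limits of
   their discretisations on finite grids, which are dominated by the product of the variation measures. *)
theory Submission
  imports
    Defs
    "HOL-Complex_Analysis.Complex_Analysis"
    "HOL-Probability.Distribution_Functions"
begin

text \<open>Cauchy's estimate is applied to f for each fixed s and not to the logarithm. The centre
  of the disc does not depend on z, so it disturbs only the coefficient of degree 0, and every other
  Taylor coefficient is bounded by the radius alone. This is why J, an integral of radii, controls
  the single Magnus terms. The crude bound on the recursion for these coefficients reaches only 2 p
  |z| < 1; convergence up to |z| p < pi is a consequence of the same estimate.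

  The constant 2 sqrt (e k) arises as follows. For q = pi (1 - \<epsilon>) and small \<epsilon>, J q
  is close to pi sqrt (2 / \<epsilon>). Minimising the product of 1 / sqrt \<epsilon> and (1 -
  \<epsilon>)^(- k) gives \<epsilon> = 1 / (2 k + 1); at the simpler 1 / (2 k) the second factor is
  close to sqrt e. It is slightly larger than sqrt e, so J has to be estimated well enough to win
  back a relative \<epsilon> / 4 + \<epsilon>^2 / 4.

  In infinite dimension a lower bound for 1 + s (A - 1) does not make it surjective. The inverse is
  therefore continued from s = 0.\<close>

subsection \<open>Circles tangent to the exponential image of a disc\<close>

text \<open>Since d^2 - 1 = (d + 1)(d - 1), two integrating factors reduce f'' \<ge> f to two
  monotonicity statements: \<open>g\<close> increases through 0 at z, hence \<open>h\<close>, whose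
  derivative has the sign of \<open>g\<close>, has its minimum 0 at z.\<close>

lemma nonneg_of_second_derivative_ge:
  fixes f f' f'' :: "real \<Rightarrow> real"
  assumes f: "\<And>x. l < x \<Longrightarrow> x < u \<Longrightarrow> (f has_real_derivative f' x) (at x)"
    and f': "\<And>x. l < x \<Longrightarrow> x < u \<Longrightarrow> (f' has_real_derivative f'' x) (at x)"
    and ge: "\<And>x. l < x \<Longrightarrow> x < u \<Longrightarrow> f x \<le> f'' x"
    and z: "l < z" "z < u" "f z = 0" "f' z = 0" and x: "l < x" "x < u"
  shows "0 \<le> f x"
proof -
  define g where "g = (\<lambda>x. exp x * (f' x - f x))"
  define h where "h = (\<lambda>x. exp (- x) * f x)"
  have dg: "(g has_real_derivative exp x * (f'' x - f x)) (at x)" if "l < x" "x < u" for x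
    unfolding g_def using f[OF that] f'[OF that]
    by (auto intro!: derivative_eq_intros simp: algebra_simps)
  have dh: "(h has_real_derivative exp (- x) * (f' x - f x)) (at x)" if "l < x" "x < u" for x
    unfolding h_def using f[OF that]
    by (auto intro!: derivative_eq_intros simp: algebra_simps)
  have g_mono: "g a \<le> g b" if "l < a" "a \<le> b" "b < u" for a b
    by (rule DERIV_nonneg_imp_nondecreasing[of a b g]) (use that dg ge in \<open>force intro!: exI\<close>)+
  have gz: "g z = 0" by (simp add: g_def z)
  have "h z = 0" by (simp add: h_def z)
  moreover have "h z \<le> h x"
  proof (cases "z \<le> x")
    case True
    show ?thesis
    proof (rule DERIV_nonneg_imp_nondecreasing[of z x h, OF True])
      fix y assume y: "z \<le> y" "y \<le> x"
      have "0 \<le> g y" using g_mono[of z y] gz y z x by auto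
      hence "0 \<le> f' y - f y" by (simp add: g_def zero_le_mult_iff)
      thus "\<exists>d. (h has_real_derivative d) (at y) \<and> 0 \<le> d"
        using dh[of y] y z x by (intro exI[of _ "exp (- y) * (f' y - f y)"]) auto
    qed
  next
    case False
    show ?thesis
    proof (rule DERIV_nonpos_imp_nonincreasing[of x z h])
      show "x \<le> z" using False by simp
      fix y assume y: "x \<le> y" "y \<le> z"
      have "g y \<le> 0" using g_mono[of y z] gz y z x by auto
      hence "f' y - f y \<le> 0" by (simp add: g_def mult_le_0_iff)
      thus "\<exists>d. (h has_real_derivative d) (at y) \<and> d \<le> 0"
        using dh[of y] y z x by (intro exI[of _ "exp (- y) * (f' y - f y)"]) (auto simp: mult_le_0_iff)
    qed
  qed
  ultimately show ?thesis by (simp add: h_def zero_le_mult_iff)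
qed

lemma sin_ge_mult_cos:
  fixes w :: real
  assumes "0 \<le> w" "w \<le> pi"
  shows "w * cos w \<le> sin w"
proof -
  have "0 * cos 0 - sin 0 \<ge> w * cos w - sin w"
  proof (rule DERIV_nonpos_imp_nonincreasing[of 0 w "\<lambda>w. w * cos w - sin w", OF assms(1)])
    fix x assume x: "0 \<le> x" "x \<le> w"
    have "((\<lambda>w. w * cos w - sin w) has_real_derivative - (x * sin x)) (at x)"
      by (auto intro!: derivative_eq_intros)
    moreover have "- (x * sin x) \<le> 0" using x assms sin_ge_zero[of x] by auto
    ultimately show "\<exists>y. ((\<lambda>w. w * cos w - sin w) has_real_derivative y) (at x) \<and> y \<le> 0" by blast
  qed
  thus ?thesis by simp
qed

text \<open>As functions of a the two exponential terms solve u'' = u, while u = cos (sqrt (p^2 -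
  a^2)) satisfies u'' \<ge> u because sin w \<ge> w cos w on [0, pi]; this is where p \<le> pi
  enters. The difference has a double zero at the contact point a = p cos t, so the comparison
  principle applies.\<close>

lemma exp_disc_tangent_aux:
  fixes p t a :: real
  assumes p: "0 < p" "p \<le> pi" and t: "0 < t" "t < pi" and a: "- p < a" "a < p"
  shows "exp (a - p * cos t) * sin (t + p * sin t) + exp (p * cos t - a) * sin (t - p * sin t)
           \<le> 2 * sin t * cos (sqrt (p\<^sup>2 - a\<^sup>2))"
proof -
  define x y where "x = p * cos t" and "y = p * sin t"
  define w where "w = (\<lambda>a. sqrt (p\<^sup>2 - a\<^sup>2))"
  define f where "f = (\<lambda>a. 2 * sin t * cos (w a) - exp (a - x) * sin (t + y) - exp (x - a) * sin (t - y))"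
  define f' where "f' = (\<lambda>a. 2 * sin t * (a * sin (w a) / w a) - exp (a - x) * sin (t + y) + exp (x - a) * sin (t - y))"
  define f'' where "f'' = (\<lambda>a. 2 * sin t * (sin (w a) / w a + a\<^sup>2 * (sin (w a) - w a * cos (w a)) / (w a) ^ 3)
        - exp (a - x) * sin (t + y) - exp (x - a) * sin (t - y))"
  have st: "sin t > 0" using t by (simp add: sin_gt_zero)
  have pos: "p\<^sup>2 - a\<^sup>2 > 0" if "- p < a" "a < p" for a
    using abs_square_less_1[of "a / p"] that p by (simp add: power_divide abs_less_iff divide_simps)
  have w: "0 < w a" "w a \<le> pi" "(w a)\<^sup>2 = p\<^sup>2 - a\<^sup>2" if "- p < a" "a < p" for a
  proof -
    show "0 < w a" "(w a)\<^sup>2 = p\<^sup>2 - a\<^sup>2" using pos[OF that] by (auto simp: w_def)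
    have "w a \<le> sqrt (p\<^sup>2)" unfolding w_def by (intro real_sqrt_le_mono) simp
    thus "w a \<le> pi" using p by simp
  qed
  have dw: "(w has_real_derivative - a / w a) (at a)" if "- p < a" "a < p" for a
    unfolding w_def using pos[OF that]
    by (auto intro!: derivative_eq_intros simp: field_simps)
  have d1: "(f has_real_derivative f' a) (at a)" if "- p < a" "a < p" for a
    unfolding f_def f'_def
    by (rule derivative_eq_intros dw[OF that] refl | simp)+
  have d2: "(f' has_real_derivative f'' a) (at a)" if "- p < a" "a < p" for a
  proof -
    have "((\<lambda>a. a * sin (w a) / w a) has_real_derivative
       ((1 * sin (w a) + a * (cos (w a) * (- a / w a))) * w a - a * sin (w a) * (- a / w a)) / (w a * w a)) (at a)"
      by (rule derivative_eq_intros dw[OF that] refl | use w(1)[OF that] in simp)+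
    also have "((1 * sin (w a) + a * (cos (w a) * (- a / w a))) * w a - a * sin (w a) * (- a / w a)) / (w a * w a)
        = sin (w a) / w a + a\<^sup>2 * (sin (w a) - w a * cos (w a)) / (w a) ^ 3"
      using w(1)[OF that] by (simp add: field_simps power2_eq_square power3_eq_cube)
    finally have d: "((\<lambda>a. a * sin (w a) / w a) has_real_derivative
        sin (w a) / w a + a\<^sup>2 * (sin (w a) - w a * cos (w a)) / (w a) ^ 3) (at a)" .
    show ?thesis unfolding f'_def f''_def
      by (rule derivative_eq_intros d refl | simp)+
  qed
  have dd: "f a \<le> f'' a" if "- p < a" "a < p" for a
  proof -
    have 1: "w a * cos (w a) \<le> sin (w a)" using w[OF that] by (intro sin_ge_mult_cos) auto
    have "cos (w a) \<le> sin (w a) / w a" using 1 w[OF that] by (simp add: field_simps)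
    moreover have "0 \<le> a\<^sup>2 * (sin (w a) - w a * cos (w a)) / (w a) ^ 3" using 1 w[OF that] by simp
    ultimately have "cos (w a) \<le> sin (w a) / w a + a\<^sup>2 * (sin (w a) - w a * cos (w a)) / (w a) ^ 3" by linarith
    thus ?thesis unfolding f_def f''_def using st by simp
  qed
  have cos1: "- 1 < cos t" "cos t < 1"
    using t cos_monotone_0_pi[of 0 t] cos_monotone_0_pi[of t pi] by auto
  have x: "- p < x" "x < p" using p cos1 mult_strict_left_mono[of "-1" "cos t" p]
      mult_strict_left_mono[of "cos t" 1 p] by (auto simp: x_def)
  have "p\<^sup>2 - x\<^sup>2 = y\<^sup>2" unfolding x_def y_def
    by (simp add: power_mult_distrib sin_squared_eq algebra_simps)
  moreover have y0: "y > 0" using p st by (simp add: y_def)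
  ultimately have wx: "w x = y" by (simp add: w_def)
  have "f x = 0" unfolding f_def wx by (simp add: sin_add sin_diff)
  moreover have "f' x = 0" unfolding f'_def wx using y0 p st
    by (simp add: sin_add sin_diff x_def y_def field_simps)
  ultimately have "0 \<le> f a"
    using nonneg_of_second_derivative_ge[of "-p" p f f' f'' x a] d1 d2 dd x a by blast
  thus ?thesis by (simp add: f_def w_def x_def y_def)
qed

text \<open>For \<open>a + i b\<close> in the disc of radius \<open>p\<close> around 0, this places \<open>exp (a + i b)\<close> on one side of the
  circle centred on the real axis that touches \<open>exp\<close> of the disc at \<open>exp (p exp (i t))\<close>.\<close>

lemma exp_disc_tangent:
  fixes p t a :: real
  assumes p: "0 < p" "p \<le> pi" and t: "0 < t" "t < pi" and a: "\<bar>a\<bar> \<le> p"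
  shows "exp (a - p * cos t) * sin (t + p * sin t) + exp (p * cos t - a) * sin (t - p * sin t)
           \<le> 2 * sin t * cos (sqrt (p\<^sup>2 - a\<^sup>2))"
proof -
  let ?f = "\<lambda>a. 2 * sin t * cos (sqrt (p\<^sup>2 - a\<^sup>2))
      - (exp (a - p * cos t) * sin (t + p * sin t) + exp (p * cos t - a) * sin (t - p * sin t))"
  \<comment> \<open>The square root is not differentiable at |a| = p, so the endpoints are reached
    by continuity.\<close>
  have "continuous_on (closure {-p<..<p}) ?f" by (intro continuous_intros)
  moreover have "a \<in> closure {-p<..<p}" using a p by auto
  moreover have "?f a \<ge> 0" if "a \<in> {-p<..<p}" for a
    using exp_disc_tangent_aux[OF p t, of a] that by auto
  ultimately have "?f a \<ge> 0" by (rule continuous_ge_on_closure)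
  thus ?thesis by simp
qed

subsection \<open>The integral J\<close>

lemma ell_properties:
  assumes "0 < p"
  shows "0 < ell p" "ell p < pi / 2" "ell p + p * sin (ell p) = pi / 2"
proof -
  let ?f = "\<lambda>l. l + p * sin l"
  have mono: "?f a < ?f b" if "0 \<le> a" "a < b" "b \<le> pi / 2" for a b
    using sin_monotone_2pi[of a b] that assms by (intro add_strict_mono mult_strict_left_mono) auto
  have "\<exists>l\<ge>0. l \<le> pi / 2 \<and> ?f l = pi / 2"
    using assms by (intro IVT') (auto intro!: continuous_intros)
  then obtain l where l: "0 \<le> l" "l \<le> pi / 2" "?f l = pi / 2" by blast
  have "l \<noteq> 0" using l by auto
  moreover have "l \<noteq> pi / 2"
  proof
    assume "l = pi / 2"
    hence "sin l = 1" by (simp only: sin_pi_half)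
    thus False using l assms \<open>l = pi / 2\<close> by simp
  qed
  ultimately
  have l': "0 < l" "l < pi / 2" using l by auto
  have "0 < ell p \<and> ell p < pi / 2 \<and> ?f (ell p) = pi / 2"
    unfolding ell_def
  proof (rule theI)
    show "0 < l \<and> l < pi / 2 \<and> ?f l = pi / 2" using l l' by simp
    fix l' assume "0 < l' \<and> l' < pi / 2 \<and> ?f l' = pi / 2"
    thus "l' = l" using l l' mono[of l l'] mono[of l' l] by (cases l l' rule: linorder_cases) auto
  qed
  thus "0 < ell p" "ell p < pi / 2" "ell p + p * sin (ell p) = pi / 2" by auto
qed

text \<open>The Moebius map \<open>f z = (z - 1) / (1 + s (z - 1))\<close> with \<open>s = mob_par p t\<close> sends the circle centred on
  the real axis and touching \<open>exp\<close> of the disc of radius \<open>p\<close> at \<open>exp (p exp (i t))\<close> to the circle with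
  centre \<open>disc_center p t\<close> and radius \<open>disc_radius p t\<close>. The parameter \<open>s\<close> is chosen so that the image of
  the point of contact is the topmost point, which makes this radius minimal; it runs from 0 to 1 as
  \<open>t\<close> runs from \<open>ell p\<close> to \<open>pi - ell p\<close>. The auxiliary angle \<open>ang_lo p t\<close> is the argument of
  \<open>1 + s (z - 1)\<close> at the point of contact.\<close>

definition ang_lo :: "real \<Rightarrow> real \<Rightarrow> real" where
  "ang_lo p t = (t + p * sin t) / 2 - pi / 4"

definition ang_hi :: "real \<Rightarrow> real \<Rightarrow> real" where
  "ang_hi p t = pi / 4 - (t - p * sin t) / 2"

definition mob_den :: "real \<Rightarrow> real \<Rightarrow> real" where
  "mob_den p t = sin (ang_lo p t) + exp (p * cos t) * sin (ang_hi p t)"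

definition mob_par :: "real \<Rightarrow> real \<Rightarrow> real" where
  "mob_par p t = sin (ang_lo p t) / mob_den p t"

definition disc_center :: "real \<Rightarrow> real \<Rightarrow> real" where
  "disc_center p t = mob_den p t * (exp (p * cos t) * cos (ang_hi p t) - cos (ang_lo p t))
     / (exp (p * cos t) * sin (p * sin t))"

definition disc_radius :: "real \<Rightarrow> real \<Rightarrow> real" where
  "disc_radius p t = (mob_den p t)\<^sup>2 / (exp (p * cos t) * sin (p * sin t))"

definition mob_par_deriv :: "real \<Rightarrow> real \<Rightarrow> real" where
  "mob_par_deriv p t = exp (p * cos t) * (p + sin (p * sin t) - p * sin t * cos (p * sin t))
     / (2 * (mob_den p t)\<^sup>2)"

lemma ang_add: "ang_lo p t + ang_hi p t = p * sin t"
  by (simp add: ang_lo_def ang_hi_def field_simps)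

lemma ang_diff: "ang_lo p t - ang_hi p t = t - pi / 2"
  by (simp add: ang_lo_def ang_hi_def field_simps)

lemma ang_reflect: "ang_lo p (pi - t) = ang_hi p t" "ang_hi p (pi - t) = ang_lo p t"
  by (simp_all add: ang_lo_def ang_hi_def field_simps)

context
  fixes p :: real
  assumes p: "0 < p" "p < pi"
begin

lemma ell_interval: "ell p \<le> pi - ell p"
  using ell_properties[OF p(1)] by simp

lemma sin_ge_on_ell_interval:
  assumes "t \<in> {ell p..pi - ell p}"
  shows "sin (ell p) \<le> sin t"
proof (cases "t \<le> pi / 2")
  case True
  thus ?thesis using assms ell_properties[OF p(1)] sin_monotone_2pi_le[of "ell p" t] by auto
next
  case False
  hence "sin (ell p) \<le> sin (pi - t)"
    using assms ell_properties[OF p(1)] sin_monotone_2pi_le[of "ell p" "pi - t"] by auto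
  thus ?thesis by simp
qed

text \<open>The limits of the integral J are the zeros of the two angles: the equation of
  \<open>ell p\<close> says that \<open>ang_lo p\<close> vanishes there, and by reflection
  \<open>ang_hi p\<close> vanishes at pi - ell p. In between both angles are non-negative with sum p
  sin t in (0, pi), so their sines are non-negative and not both zero.\<close>

lemma ang_bounds:
  assumes t: "t \<in> {ell p..pi - ell p}"
  shows "0 < p * sin t" "p * sin t < pi" "0 \<le> ang_lo p t" "0 \<le> ang_hi p t" "0 < mob_den p t"
    "0 < sin (p * sin t)" "0 < t" "t < pi"
proof -
  note l = ell_properties[OF p(1)]
  show tpi: "0 < t" "t < pi" using t l by auto
  have st: "sin t > 0" using tpi by (simp add: sin_gt_zero)
  show y: "0 < p * sin t" using st p by simp
  have "p * sin t \<le> p * 1" using p by (intro mult_left_mono) auto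
  thus y': "p * sin t < pi" using p by linarith
  show "0 < sin (p * sin t)" using y y' by (rule sin_gt_zero)
  have ps: "p * sin (ell p) \<le> p * sin t" using sin_ge_on_ell_interval[OF t] p by simp
  show a: "0 \<le> ang_lo p t" using ps l t by (simp add: ang_lo_def)
  show b: "0 \<le> ang_hi p t" using ps l t by (simp add: ang_hi_def)
  have ab: "ang_lo p t + ang_hi p t = p * sin t" by (rule ang_add)
  have sa: "0 \<le> sin (ang_lo p t)" "0 \<le> sin (ang_hi p t)"
    using a b ab y' by (auto intro!: sin_ge_zero)
  show "0 < mob_den p t"
  proof (cases "ang_lo p t = 0")
    case True
    hence "0 < sin (ang_hi p t)" using ab y y' by (auto intro!: sin_gt_zero)
    thus ?thesis using sa by (simp add: mob_den_def add_nonneg_pos)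
  next
    case False
    hence "0 < sin (ang_lo p t)" using a b ab y' by (auto intro!: sin_gt_zero)
    thus ?thesis using sa by (simp add: mob_den_def add_pos_nonneg)
  qed
qed

lemma disc_radius_pos:
  assumes t: "t \<in> {ell p..pi - ell p}"
  shows "0 < disc_radius p t"
  using ang_bounds[OF t] by (simp add: disc_radius_def)

lemma mob_par_has_derivative:
  assumes t: "t \<in> {ell p..pi - ell p}"
  shows "(mob_par p has_real_derivative mob_par_deriv p t) (at t)"
proof -
  define A B E where "A = ang_lo p t" and "B = ang_hi p t" and "E = exp (p * cos t)"
  define m where "m = mob_den p t"
  have m: "m > 0" "m = sin A + E * sin B" using ang_bounds[OF t]
    by (simp_all add: m_def mob_den_def A_def B_def E_def)
  have E: "E > 0" by (simp add: E_def)
  have AB: "A + B = p * sin t" "A - B = t - pi / 2" using ang_add ang_diff by (auto simp: A_def B_def)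
  have dA: "(ang_lo p has_real_derivative (1 + p * cos t) / 2) (at t)"
    unfolding ang_lo_def by (auto intro!: derivative_eq_intros)
  have dB: "(ang_hi p has_real_derivative (p * cos t - 1) / 2) (at t)"
    unfolding ang_hi_def by (auto intro!: derivative_eq_intros simp: field_simps)
  have dE: "((\<lambda>t. exp (p * cos t)) has_real_derivative (- (p * sin t) * E)) (at t)"
    unfolding E_def by (auto intro!: derivative_eq_intros)
  let ?dm = "cos A * ((1 + p * cos t) / 2) + ((- (p * sin t) * E) * sin B + (cos B * ((p * cos t - 1) / 2)) * E)"
  have dm: "(mob_den p has_real_derivative ?dm) (at t)"
    unfolding mob_den_def
    by (rule derivative_eq_intros dA dB dE refl | simp add: A_def B_def E_def algebra_simps)+
  have "(mob_par p has_real_derivative ((cos A * ((1 + p * cos t) / 2)) * m - sin A * ?dm) / (m * m)) (at t)"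
    unfolding mob_par_def
    by (rule derivative_eq_intros dA dm refl | use m in \<open>simp add: A_def m_def\<close>)+
  also have "((cos A * ((1 + p * cos t) / 2)) * m - sin A * ?dm) / (m * m) = mob_par_deriv p t"
  proof -
    define N where "N = (cos A * ((1 + p * cos t) / 2)) * m - sin A * ?dm"
    \<comment> \<open>Through A - B = t - pi / 2 and A + B = p sin t, all trigonometric functions in
      the numerator become polynomials in the sines and cosines of A and B.\<close>
    have c: "cos t = cos A * sin B - sin A * cos B"
    proof -
      have "cos t = cos (pi / 2 - (B - A))" using AB(2) by (simp add: algebra_simps)
      also have "\<dots> = sin (B - A)" by (simp add: cos_diff)
      finally show ?thesis by (simp add: sin_diff algebra_simps)
    qed
    have s: "sin t = cos A * cos B + sin A * sin B"
    proof -
      have "sin t = sin (pi / 2 - (B - A))" using AB(2) by (simp add: algebra_simps)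
      also have "\<dots> = cos (B - A)" by (simp add: sin_diff)
      finally show ?thesis by (simp add: cos_diff algebra_simps)
    qed
    have sy: "sin (p * sin t) = sin A * cos B + cos A * sin B" 
      by (simp add: sin_add flip: AB(1))
    have cy: "cos (p * sin t) = cos A * cos B - sin A * sin B" 
      by (simp add: cos_add flip: AB(1))
    \<comment> \<open>The isolated p in the integrand of J is p (sin^2 t + cos^2 t): one summand
      comes from differentiating exp (p cos t), the other from differentiating the angles.\<close>
    have "p * sin t * sin t + p * cos t * cos t = p * ((sin t)\<^sup>2 + (cos t)\<^sup>2)"
      unfolding power2_eq_square by (simp only: distrib_left mult.assoc)
    hence pe: "p = p * sin t * sin t + p * cos t * cos t" by simp
    have "2 * ((cos A * ((1 + p * cos t) / 2)) * m - sin A * ?dm)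
        = E * (cos A * sin B + sin A * cos B + p * cos t * (cos A * sin B - sin A * cos B)
            + p * sin t * (2 * sin A * sin B))"
      by (simp add: m(2) field_simps)
    also have "\<dots> = E * (sin (p * sin t) + p * cos t * cos t + p * sin t * (sin t - cos (p * sin t)))"
    proof -
      have "cos A * sin B + sin A * cos B = sin (p * sin t)" by (simp add: sy)
      moreover have "2 * sin A * sin B = sin t - cos (p * sin t)" using s cy by linarith
      ultimately show ?thesis by (simp only: c[symmetric])
    qed
    also have "\<dots> = E * (p + sin (p * sin t) - p * sin t * cos (p * sin t))"
    proof -
      have "sin (p * sin t) + p * cos t * cos t + p * sin t * (sin t - cos (p * sin t))
          = p + sin (p * sin t) - p * sin t * cos (p * sin t)"
        unfolding right_diff_distrib using pe by linarith
      thus ?thesis by simp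
    qed
    finally have "2 * N = E * (p + sin (p * sin t) - p * sin t * cos (p * sin t))" unfolding N_def .
    moreover define X where "X = p + sin (p * sin t) - p * sin t * cos (p * sin t)"
    ultimately have "N = E * X / 2" by simp
    thus ?thesis
      unfolding N_def[symmetric] mob_par_deriv_def m_def[symmetric] E_def[symmetric] X_def[symmetric]
      by (simp only:) (simp add: power2_eq_square)
  qed
  finally show ?thesis .
qed

lemma mob_par_at_ends: "mob_par p (ell p) = 0" "mob_par p (pi - ell p) = 1"
proof -
  note l = ell_properties[OF p(1)]
  have 1: "ang_lo p (ell p) = 0" using l by (simp add: ang_lo_def)
  thus "mob_par p (ell p) = 0" by (simp add: mob_par_def)
  have "ang_hi p (pi - ell p) = 0" using 1 by (simp add: ang_reflect)
  hence "mob_den p (pi - ell p) = sin (ang_lo p (pi - ell p))" by (simp add: mob_den_def)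
  moreover have "0 < mob_den p (pi - ell p)" using ang_bounds(5)[of "pi - ell p"] l by simp
  ultimately show "mob_par p (pi - ell p) = 1" by (simp add: mob_par_def)
qed

lemma mob_par_range:
  assumes t: "t \<in> {ell p..pi - ell p}"
  shows "mob_par p t \<in> {0..1}"
proof -
  note b = ang_bounds[OF t]
  have ab: "ang_lo p t + ang_hi p t = p * sin t" by (rule ang_add)
  have "0 \<le> sin (ang_lo p t)" "0 \<le> sin (ang_hi p t)"
    using b ab by (auto intro!: sin_ge_zero)
  thus ?thesis using b by (simp add: mob_par_def mob_den_def divide_simps)
qed

lemma mob_par_surj:
  assumes "s \<in> {0..1}"
  obtains t where "t \<in> {ell p..pi - ell p}" "mob_par p t = s"
proof -
  have "continuous_on {ell p..pi - ell p} (mob_par p)"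
    using mob_par_has_derivative DERIV_isCont continuous_at_imp_continuous_on by blast
  hence "\<exists>t\<ge>ell p. t \<le> pi - ell p \<and> mob_par p t = s"
    using assms ell_interval by (intro IVT') (auto simp: mob_par_at_ends)
  thus ?thesis using that by auto
qed

lemma mob_den_reflect: "mob_den p (pi - t) = exp (- p * cos t) * mob_den p t"
  by (simp add: mob_den_def ang_reflect algebra_simps flip: exp_add)

text \<open>Reflecting t about pi / 2 amounts to replacing z by 1 / z and s by 1 - s. With f indexed
  by s, f_s (1 / z) = - f_(1 - s) (z), so the image disc is reflected through 0.\<close>

lemma disc_center_reflect: "disc_center p (pi - t) = - disc_center p t"
proof -
  define E where "E = exp (p * cos t)"
  have E: "E > 0" by (simp add: E_def)
  have e: "exp (- (p * cos t)) = 1 / E" by (simp add: E_def exp_minus field_simps)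
  have "disc_center p (pi - t) = (1 / E) * mob_den p t * ((1 / E) * cos (ang_lo p t) - cos (ang_hi p t))
      / ((1 / E) * sin (p * sin t))"
    by (simp add: disc_center_def mob_den_reflect ang_reflect e)
  also have "\<dots> = - disc_center p t"
    unfolding disc_center_def E_def[symmetric] using E by (simp add: divide_simps) (simp add: algebra_simps)
  finally show ?thesis .
qed

lemma mob_par_deriv_reflect: "mob_par_deriv p (pi - t) = mob_par_deriv p t"
proof -
  define E where "E = exp (p * cos t)"
  have E: "E > 0" by (simp add: E_def)
  have e: "exp (- (p * cos t)) = 1 / E" by (simp add: E_def exp_minus field_simps)
  have "mob_par_deriv p (pi - t) = (1 / E) * (p + sin (p * sin t) - p * sin t * cos (p * sin t))
     / (2 * ((1 / E) * mob_den p t)\<^sup>2)"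
    by (simp add: mob_par_deriv_def mob_den_reflect e)
  also have "\<dots> = mob_par_deriv p t"
    unfolding mob_par_deriv_def E_def[symmetric] using E by (simp add: power2_eq_square)
  finally show ?thesis .
qed

lemma continuous_on_ang:
  "continuous_on S (ang_lo p)" "continuous_on S (ang_hi p)" "continuous_on S (mob_den p)"
  unfolding ang_lo_def ang_hi_def mob_den_def by (intro continuous_intros; simp)+

lemma continuous_on_disc:
  "continuous_on {ell p..pi - ell p} (disc_center p)"
  "continuous_on {ell p..pi - ell p} (disc_radius p)"
  "continuous_on {ell p..pi - ell p} (mob_par_deriv p)"
  unfolding disc_center_def disc_radius_def mob_par_deriv_def
  using ang_bounds(5,6)
  by (intro continuous_intros continuous_on_ang; force)+

lemma has_integral_mob_par_substitution:
  fixes G :: "real \<Rightarrow> 'b::banach"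
  assumes G: "continuous_on {0..1} G"
  shows "((\<lambda>t. mob_par_deriv p t *\<^sub>R G (mob_par p t)) has_integral integral {0..1} G) {ell p..pi - ell p}"
proof -
  let ?F = "\<lambda>u. integral {0..u} G"
  have "((\<lambda>t. mob_par_deriv p t *\<^sub>R G (mob_par p t)) has_integral
     ((?F \<circ> mob_par p) (pi - ell p) - (?F \<circ> mob_par p) (ell p))) {ell p..pi - ell p}"
  proof (rule fundamental_theorem_of_calculus[OF ell_interval])
    fix t assume t: "t \<in> {ell p..pi - ell p}"
    have "(mob_par p has_vector_derivative mob_par_deriv p t) (at t within {ell p..pi - ell p})"
      using mob_par_has_derivative[OF t]
      by (simp add: has_real_derivative_iff_has_vector_derivative has_vector_derivative_at_within)
    moreover have "(?F has_vector_derivative G (mob_par p t))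
        (at (mob_par p t) within mob_par p ` {ell p..pi - ell p})"
      using integral_has_vector_derivative[OF G mob_par_range[OF t]]
      by (rule has_vector_derivative_within_subset) (use mob_par_range in auto)
    ultimately show "(?F \<circ> mob_par p has_vector_derivative mob_par_deriv p t *\<^sub>R G (mob_par p t))
        (at t within {ell p..pi - ell p})"
      by (rule vector_diff_chain_within)
  qed
  thus ?thesis by (simp add: mob_par_at_ends)
qed

text \<open>The origin of the integrand of J: \<open>mob_den\<close> and exp (p cos t) cancel
  between the derivative of the Moebius parameter and the radius.\<close>

lemma J_eq: "((\<lambda>t. mob_par_deriv p t * disc_radius p t) has_integral J p) {ell p..pi - ell p}"
proof -
  have eq: "mob_par_deriv p t * disc_radius p t =
    (p + sin (p * sin t) - p * sin t * cos (p * sin t)) / (2 * sin (p * sin t))"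
    if "t \<in> {ell p..pi - ell p}" for t
    using ang_bounds[OF that] by (simp add: mob_par_deriv_def disc_radius_def field_simps)
  have "J p = integral {ell p..pi - ell p} (\<lambda>t. mob_par_deriv p t * disc_radius p t)"
    unfolding J_def using p eq by (auto intro!: integral_cong)
  moreover have "(\<lambda>t. mob_par_deriv p t * disc_radius p t) integrable_on {ell p..pi - ell p}"
    by (intro integrable_continuous_real continuous_intros continuous_on_disc)
  ultimately show ?thesis by (simp add: has_integral_iff)
qed

lemma has_integral_disc_center:
  "((\<lambda>t. mob_par_deriv p t * disc_center p t) has_integral 0) {ell p..pi - ell p}"
proof -
  let ?f = "\<lambda>t. mob_par_deriv p t * disc_center p t"
  let ?i = "integral {ell p..pi - ell p} ?f"
  have i: "(?f has_integral ?i) {ell p..pi - ell p}"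
    by (intro integrable_integral integrable_continuous_real continuous_intros continuous_on_disc)
  have "((\<lambda>t. ?f (- t)) has_integral ?i) {- (pi - ell p)..- ell p}"
    using i has_integral_reflect_real[of ?f ?i "pi - ell p" "ell p"] by blast
  hence "((\<lambda>t. ?f (- (t + - pi))) has_integral ?i) {- (pi - ell p) - (- pi)..- ell p - (- pi)}"
    by (rule has_integral_shift_real_ivl)
  hence "((\<lambda>t. - ?f t) has_integral ?i) {ell p..pi - ell p}"
    by (simp add: disc_center_reflect mob_par_deriv_reflect)
  moreover have "((\<lambda>t. - ?f t) has_integral - ?i) {ell p..pi - ell p}"
    using i by (rule has_integral_neg)
  ultimately have "?i = - ?i" by (rule has_integral_unique)
  thus ?thesis using i by simp
qed

lemma mob_par_deriv_nonneg:
  assumes t: "t \<in> {ell p..pi - ell p}"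
  shows "0 \<le> mob_par_deriv p t"
proof -
  note b = ang_bounds[OF t]
  have "p * sin t * cos (p * sin t) \<le> sin (p * sin t)" using b by (intro sin_ge_mult_cos) auto
  thus ?thesis using p b by (simp add: mob_par_deriv_def)
qed

text \<open>The centres drop out because \<open>disc_center p\<close> is odd about \<open>pi / 2\<close>.\<close>

lemma norm_integral_le_J:
  fixes G :: "real \<Rightarrow> 'b::banach"
  assumes G: "continuous_on {0..1} G"
    and le: "\<And>t. t \<in> {ell p..pi - ell p} \<Longrightarrow>
      norm (G (mob_par p t) - disc_center p t *\<^sub>R e) \<le> c * disc_radius p t"
  shows "norm (integral {0..1} G) \<le> c * J p"
proof -
  have "((\<lambda>t. mob_par_deriv p t *\<^sub>R G (mob_par p t) - (mob_par_deriv p t * disc_center p t) *\<^sub>R e)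
      has_integral integral {0..1} G - 0 *\<^sub>R e) {ell p..pi - ell p}"
    by (intro has_integral_diff has_integral_mob_par_substitution[OF G] has_integral_scaleR_left
        has_integral_disc_center)
  hence 1: "((\<lambda>t. mob_par_deriv p t *\<^sub>R (G (mob_par p t) - disc_center p t *\<^sub>R e))
      has_integral integral {0..1} G) {ell p..pi - ell p}"
    by (simp add: scaleR_diff_right)
  have 2: "((\<lambda>t. c * (mob_par_deriv p t * disc_radius p t)) has_integral c * J p) {ell p..pi - ell p}"
    by (intro has_integral_mult_right J_eq)
  have "norm (integral {ell p..pi - ell p} (\<lambda>t. mob_par_deriv p t *\<^sub>R (G (mob_par p t) - disc_center p t *\<^sub>R e)))
     \<le> integral {ell p..pi - ell p} (\<lambda>t. c * (mob_par_deriv p t * disc_radius p t))"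
  proof (rule integral_norm_bound_integral)
    fix t assume t: "t \<in> {ell p..pi - ell p}"
    show "norm (mob_par_deriv p t *\<^sub>R (G (mob_par p t) - disc_center p t *\<^sub>R e))
      \<le> c * (mob_par_deriv p t * disc_radius p t)"
      using mult_left_mono[OF le[OF t] mob_par_deriv_nonneg[OF t]] mob_par_deriv_nonneg[OF t]
      by (simp add: mult_ac)
  qed (use 1 2 in \<open>auto simp: has_integral_iff\<close>)
  thus ?thesis unfolding integral_unique[OF 1] integral_unique[OF 2] .
qed

text \<open>One bound for all Moebius parameters. It later bounds the resolvents uniformly in s, on
  which the continuation in s and the limits in z rely.\<close>

lemma disc_bounded:
  obtains C where "0 < C" "\<And>t. t \<in> {ell p..pi - ell p} \<Longrightarrow> \<bar>disc_center p t\<bar> + disc_radius p t \<le> C"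
proof -
  have "compact ((\<lambda>t. \<bar>disc_center p t\<bar> + disc_radius p t) ` {ell p..pi - ell p})"
    by (intro compact_continuous_image continuous_intros continuous_on_disc) auto
  hence "bounded ((\<lambda>t. \<bar>disc_center p t\<bar> + disc_radius p t) ` {ell p..pi - ell p})"
    by (rule compact_imp_bounded)
  then obtain C where "0 < C" "\<forall>x\<in>(\<lambda>t. \<bar>disc_center p t\<bar> + disc_radius p t) ` {ell p..pi - ell p}. norm x \<le> C"
    unfolding bounded_pos by blast
  thus ?thesis using that[of C] by force
qed

end

subsection \<open>An upper bound for J\<close>

lemma arctan_ge_taylor:
  fixes x :: real
  assumes "0 \<le> x"
  shows "x - x ^ 3 / 3 \<le> arctan x"
proof -
  let ?f = "\<lambda>x. arctan x - x + x ^ 3 / 3"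
  have "?f 0 \<le> ?f x"
  proof (rule DERIV_nonneg_imp_nondecreasing[of 0 x ?f, OF assms])
    fix y :: real
    have n: "1 + y\<^sup>2 > 0" by (simp add: add_pos_nonneg)
    have "(?f has_real_derivative inverse (1 + y\<^sup>2) - 1 + y\<^sup>2) (at y)"
      by (auto intro!: derivative_eq_intros)
    moreover have "inverse (1 + y\<^sup>2) - 1 + y\<^sup>2 = y ^ 4 / (1 + y\<^sup>2)" using n
      by (simp add: field_simps power2_eq_square power4_eq_xxxx)
    ultimately have "(?f has_real_derivative y ^ 4 / (1 + y\<^sup>2)) (at y)" by simp
    moreover have "0 \<le> y ^ 4 / (1 + y\<^sup>2)" using n by simp
    ultimately show "\<exists>d. (?f has_real_derivative d) (at y) \<and> 0 \<le> d" by blast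
  qed
  thus ?thesis by simp
qed

lemma arctan_le_taylor:
  fixes x :: real
  assumes "0 \<le> x"
  shows "arctan x \<le> x - x ^ 3 / 3 + x ^ 5 / 5"
proof -
  let ?f = "\<lambda>x. x - x ^ 3 / 3 + x ^ 5 / 5 - arctan x"
  have "?f 0 \<le> ?f x"
  proof (rule DERIV_nonneg_imp_nondecreasing[of 0 x ?f, OF assms])
    fix y :: real
    have n: "1 + y\<^sup>2 > 0" by (simp add: add_pos_nonneg)
    have "(?f has_real_derivative 1 - y\<^sup>2 + y ^ 4 - inverse (1 + y\<^sup>2)) (at y)"
      by (auto intro!: derivative_eq_intros)
    moreover have "1 - y\<^sup>2 + y ^ 4 - inverse (1 + y\<^sup>2) = y ^ 6 / (1 + y\<^sup>2)" using n
      by (simp add: field_simps power2_eq_square eval_nat_numeral)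
    ultimately have "(?f has_real_derivative y ^ 6 / (1 + y\<^sup>2)) (at y)" by simp
    moreover have "0 \<le> y ^ 6 / (1 + y\<^sup>2)" using n by simp
    ultimately show "\<exists>d. (?f has_real_derivative d) (at y) \<and> 0 \<le> d" by blast
  qed
  thus ?thesis by simp
qed

lemma pi_bounds: "157 / 50 < pi" "pi < 63 / 20"
  using machin arctan_ge_taylor[of "1 / 5"] arctan_le_taylor[of "1 / 5"]
    arctan_ge_taylor[of "1 / 239"] arctan_le_taylor[of "1 / 239"]
  by (simp_all add: field_simps)

lemma cot_le: 
  fixes v :: real
  assumes "0 < v" "v \<le> pi / 3"
  shows "cos v / sin v \<le> 1 / v - v / 3"
proof -
  have s: "0 < sin v" using assms by (intro sin_gt_zero) auto
  let ?f = "\<lambda>v. sin v * (3 - v\<^sup>2) - 3 * v * cos v"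
  have "?f 0 \<le> ?f v"
  proof (rule DERIV_nonneg_imp_nondecreasing[of 0 v ?f])
    show "0 \<le> v" using assms by simp
    fix y assume y: "0 \<le> y" "y \<le> v"
    have "(?f has_real_derivative y * (sin y - y * cos y)) (at y)"
      by (auto intro!: derivative_eq_intros simp: algebra_simps power2_eq_square)
    moreover have "0 \<le> y * (sin y - y * cos y)" using y assms sin_ge_mult_cos[of y] by simp
    ultimately show "\<exists>d. (?f has_real_derivative d) (at y) \<and> 0 \<le> d" by blast
  qed
  hence "3 * v * cos v \<le> sin v * (3 - v\<^sup>2)" by simp
  thus ?thesis using s assms by (simp add: field_simps power2_eq_square)
qed

text \<open>The integrand of J has a simple pole at y = pi with polar part (q + pi) / (2 (pi - y)).
  The remainder is affine in q with slope (1 / sin y - 1 / (pi - y)) / 2 \<ge> 0, so q = pi is the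
  worst case; there the half angle v = (pi - y) / 2 leaves a bounded function of v.\<close>

lemma J_integrand_le:
  fixes q y :: real
  assumes q: "0 < q" "q \<le> pi" and y: "pi / 3 \<le> y" "y < pi"
  shows "(q + sin y - y * cos y) / (2 * sin y) \<le> (q + pi) / (2 * (pi - y)) + 109 / 200"
proof -
  define v where "v = (pi - y) / 2"
  have v: "0 < v" "v \<le> pi / 3" using y by (auto simp: v_def)
  have v': "v < pi / 2" using v pi_gt_zero by linarith
  have yv: "y = pi - 2 * v" by (simp add: v_def field_simps)
  define s c where "s = sin v" and "c = cos v"
  have s: "s > 0" unfolding s_def using v pi_gt_zero by (intro sin_gt_zero) auto
  have c: "c > 0" unfolding c_def using v v' by (intro cos_gt_zero) auto
  have sc: "s\<^sup>2 + c\<^sup>2 = 1" by (simp add: s_def c_def)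
  have siny: "sin y = 2 * s * c" by (simp add: yv sin_diff sin_double s_def c_def)
  have cosy: "cos y = s\<^sup>2 - c\<^sup>2" by (simp add: yv cos_diff cos_double s_def c_def)
  have sy: "sin y > 0" using s c siny by simp
  have "sin (2 * v) \<le> 2 * v" using v by (intro sin_x_le_x) auto
  hence "1 / (2 * v) \<le> 1 / sin y" using sy v unfolding siny s_def c_def sin_double
    by (intro divide_left_mono) auto
  hence "0 \<le> (pi - q) / 2 * (1 / sin y - 1 / (2 * v))" using q by (intro mult_nonneg_nonneg) auto
  moreover have "(pi + sin y - y * cos y) / (2 * sin y) - (pi + pi) / (2 * (2 * v))
      - ((q + sin y - y * cos y) / (2 * sin y) - (q + pi) / (2 * (2 * v)))
      = (pi - q) / 2 * (1 / sin y - 1 / (2 * v))"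
  proof -
    have "(pi + S) / 2 * a - (pi + pi) / 2 * b - ((q + S) / 2 * a - (q + pi) / 2 * b) = (pi - q) / 2 * (a - b)"
      for a b S by (simp add: field_simps)
    from this[of "sin y - y * cos y" "1 / sin y" "1 / (2 * v)"] show ?thesis
      by (simp add: mult.commute add_diff_eq)
  qed
  ultimately have "(q + sin y - y * cos y) / (2 * sin y) - (q + pi) / (2 * (2 * v))
      \<le> (pi + sin y - y * cos y) / (2 * sin y) - (pi + pi) / (2 * (2 * v))"
    by linarith
  also have "\<dots> = (pi / 2 - v / 2) * (c / s) + 1 / 2 + v / 2 * (s / c) - pi / (2 * v)"
  proof -
    have "pi - y * cos y = pi * (s\<^sup>2 + c\<^sup>2) - (pi - 2 * v) * (s\<^sup>2 - c\<^sup>2)"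
      unfolding sc cosy by (simp add: yv)
    also have "\<dots> = 2 * (pi - v) * c\<^sup>2 + 2 * v * s\<^sup>2" by (simp add: algebra_simps)
    finally have e: "pi + sin y - y * cos y = 2 * (pi - v) * c\<^sup>2 + 2 * v * s\<^sup>2 + 2 * s * c" by (simp add: siny)
    show ?thesis unfolding e unfolding siny using s c v by (simp add: field_simps power2_eq_square)
  qed
  also have "\<dots> \<le> (pi / 2 - v / 2) * (1 / v - v / 3) + 1 / 2 + v / 2 * sqrt 3 - pi / (2 * v)"
  proof -
    have "c / s \<le> 1 / v - v / 3" unfolding c_def s_def by (rule cot_le[OF v])
    moreover have "s / c \<le> sqrt 3"
    proof -
      have "tan v \<le> tan (pi / 3)" 
      proof (cases "v = pi / 3")
        case False
        hence "tan v < tan (pi / 3)" using v pi_gt_zero by (intro tan_monotone) auto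
        thus ?thesis by simp
      next
        case True
        show ?thesis unfolding True ..
      qed
      hence "tan v \<le> sqrt 3" by (simp only: tan_60)
      thus ?thesis by (simp add: tan_def s_def c_def)
    qed
    ultimately show ?thesis using v pi_gt_zero by (intro add_mono diff_mono mult_left_mono order_refl) auto
  qed
  \<comment> \<open>The pole pi / (2 v) and the constant 1 / 2 cancel. What remains is largest at v
    = pi / 3, with value pi sqrt 3 / 6 - pi^2 / 27, about 0.5414.\<close>
  also have "\<dots> = v * (sqrt 3 / 2 + v / 6 - pi / 6)" using v by (simp add: field_simps power2_eq_square)
  also have "\<dots> \<le> 109 / 200"
  proof -
    have "sqrt 3 \<le> sqrt ((1.7321)\<^sup>2)" by (intro real_sqrt_le_mono) (simp add: power2_eq_square)
    hence s3: "sqrt 3 \<le> 1.7321" by simp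
    have s3': "sqrt ((1.7)\<^sup>2) \<le> sqrt 3" by (intro real_sqrt_le_mono) (simp add: power2_eq_square)
    hence s3': "1.7 \<le> sqrt 3" by simp
    have "v * (sqrt 3 / 2 + v / 6 - pi / 6) \<le> pi / 3 * (sqrt 3 / 2 + (pi / 3) / 6 - pi / 6)"
    proof (rule mult_mono)
      show "0 \<le> sqrt 3 / 2 + v / 6 - pi / 6" using s3' pi_bounds v by linarith
    qed (use v in auto)
    also have "\<dots> = pi * sqrt 3 / 6 - pi * pi / 27" by (simp add: field_simps)
    finally have "v * (sqrt 3 / 2 + v / 6 - pi / 6) \<le> pi * sqrt 3 / 6 - pi * pi / 27" .
    moreover have "pi * sqrt 3 \<le> 3.15 * 1.7321" using s3 pi_bounds by (intro mult_mono) auto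
    moreover have "3.14 * 3.14 \<le> pi * pi" using pi_bounds by (intro mult_mono) auto
    ultimately show ?thesis by simp
  qed
  finally have "(q + sin y - y * cos y) / (2 * sin y) \<le> (q + pi) / (2 * (2 * v)) + 109 / 200" by linarith
  moreover have "2 * (2 * v) = 2 * (pi - y)" by (simp add: v_def)
  ultimately show ?thesis by (simp only:)
qed

text \<open>Half-angle substitution shifted to \<theta> = t / 2 - pi / 4, so that sin t = cos (2
  \<theta>) and the tangent stays finite on all of [0, pi]; the primitive is then odd about t = pi /
  2.\<close>

lemma has_integral_inverse_pi_minus_sin:
  assumes q: "0 < q" "q < pi"
  shows "((\<lambda>t. 1 / (pi - q * sin t)) has_integral
    4 / sqrt (pi\<^sup>2 - q\<^sup>2) * arctan (sqrt ((pi + q) / (pi - q)))) {0..pi}"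
proof -
  define W \<kappa> where "W = sqrt (pi\<^sup>2 - q\<^sup>2)" and "\<kappa> = sqrt ((pi + q) / (pi - q))"
  have pq: "pi\<^sup>2 - q\<^sup>2 = (pi - q) * (pi + q)" by (simp add: power2_eq_square algebra_simps)
  have pq0: "0 < pi\<^sup>2 - q\<^sup>2" unfolding pq using q by simp
  hence W: "W > 0" by (simp add: W_def)
  have k2: "\<kappa>\<^sup>2 = (pi + q) / (pi - q)" using q by (simp add: \<kappa>_def)
  have "W\<^sup>2 = (pi - q) * (pi + q)" unfolding W_def using pq0 pq by (simp only: real_sqrt_pow2 less_imp_le)
  hence "(W / (pi - q))\<^sup>2 = \<kappa>\<^sup>2" unfolding k2 power_divide using q by (simp add: power2_eq_square)
  hence kW: "\<kappa> = W / (pi - q)" 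
    by (rule power2_eq_imp_eq[symmetric]) (use W q in \<open>auto simp: \<kappa>_def\<close>)
  let ?H = "\<lambda>t. 2 / W * arctan (\<kappa> * tan (t / 2 - pi / 4))"
  have "((\<lambda>t. 1 / (pi - q * sin t)) has_integral ?H pi - ?H 0) {0..pi}"
  proof (rule fundamental_theorem_of_calculus)
    fix t assume t: "t \<in> {0..pi}"
    define \<theta> where "\<theta> = t / 2 - pi / 4"
    have "- (pi / 2) < \<theta>" "\<theta> < pi / 2"
      using t pi_gt_zero unfolding \<theta>_def atLeastAtMost_iff by linarith+
    hence c: "cos \<theta> > 0" by (rule cos_gt_zero_pi)
    have "2 * \<theta> = t - pi / 2" by (simp add: \<theta>_def)
    hence "cos (2 * \<theta>) = sin t" by (simp add: cos_diff)
    hence "(cos \<theta>)\<^sup>2 - (sin \<theta>)\<^sup>2 = sin t" by (simp only: cos_double)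
    moreover have "(sin \<theta>)\<^sup>2 + (cos \<theta>)\<^sup>2 = 1" by simp
    ultimately have "(cos \<theta>)\<^sup>2 = (1 + sin t) / 2 \<and> (sin \<theta>)\<^sup>2 = (1 - sin t) / 2" by argo
    hence cs: "(cos \<theta>)\<^sup>2 = (1 + sin t) / 2" "(sin \<theta>)\<^sup>2 = (1 - sin t) / 2" by auto
    have pos: "1 + (\<kappa> * tan \<theta>)\<^sup>2 > 0" by (simp add: add_pos_nonneg)
    have den: "pi - q * sin t > 0"
    proof -
      have "q * sin t \<le> q * 1" using q by (intro mult_left_mono) auto
      thus ?thesis using q by linarith
    qed
    have "(?H has_real_derivative 2 / W * ((\<kappa> * (inverse ((cos \<theta>)\<^sup>2) * (1 / 2))) * inverse (1 + (\<kappa> * tan \<theta>)\<^sup>2))) (at t)"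
      using c W by (auto intro!: derivative_eq_intros simp: \<theta>_def)
    also have "2 / W * ((\<kappa> * (inverse ((cos \<theta>)\<^sup>2) * (1 / 2))) * inverse (1 + (\<kappa> * tan \<theta>)\<^sup>2))
        = \<kappa> / W / ((cos \<theta>)\<^sup>2 + \<kappa>\<^sup>2 * (sin \<theta>)\<^sup>2)"
    proof -
      have "1 + (\<kappa> * tan \<theta>)\<^sup>2 = ((cos \<theta>)\<^sup>2 + \<kappa>\<^sup>2 * (sin \<theta>)\<^sup>2) / (cos \<theta>)\<^sup>2"
        using c by (simp add: tan_def power_mult_distrib power_divide add_divide_distrib)
      moreover have "2 / W * ((\<kappa> * (inverse X * (1 / 2))) * inverse (Y / X)) = \<kappa> / W / Y" if "X > 0" for X Y
        using that by (simp add: inverse_eq_divide)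
      moreover have "(cos \<theta>)\<^sup>2 > 0" using c by simp
      ultimately show ?thesis by (simp only:)
    qed
    also have "(cos \<theta>)\<^sup>2 + \<kappa>\<^sup>2 * (sin \<theta>)\<^sup>2 = (pi - q * sin t) / (pi - q)"
      unfolding cs k2 using q by (simp add: field_simps)
    also have "\<kappa> / W / ((pi - q * sin t) / (pi - q)) = 1 / (pi - q * sin t)"
      unfolding kW using q W den by (simp add: field_simps)
    finally show "(?H has_vector_derivative 1 / (pi - q * sin t)) (at t within {0..pi})"
      by (simp add: has_real_derivative_iff_has_vector_derivative has_vector_derivative_at_within)
  qed simp
  moreover have "?H pi - ?H 0 = 4 / W * arctan \<kappa>"
  proof -
    have "tan (- (pi / 4)) = - 1" by (simp only: tan_minus tan_45)
    thus ?thesis by (simp add: tan_45 arctan_minus)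
  qed
  ultimately show ?thesis by (simp add: W_def \<kappa>_def)
qed

text \<open>For q \<ge> 2 pi / 3 the left side of the equation for \<open>ell q\<close> is at least
  pi / 2 at pi / 6, so ell q \<le> pi / 6 and q sin t \<ge> pi / 2 - ell q \<ge> pi / 3, the range
  of \<open>J_integrand_le\<close>. The majorant is non-negative and may be integrated over all of
  [0, pi], where it has a closed form.\<close>

lemma J_le:
  assumes q: "2 * pi / 3 \<le> q" "q < pi"
  shows "J q \<le> (q + pi) / 2 * (4 / sqrt (pi\<^sup>2 - q\<^sup>2) * arctan (sqrt ((pi + q) / (pi - q)))) + 109 / 200 * pi"
proof -
  have q0: "0 < q" using q pi_gt_zero by linarith
  note l = ell_properties[OF q0]
  have l6: "ell q \<le> pi / 6"
  proof (rule ccontr)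
    assume *: "\<not> ell q \<le> pi / 6"
    hence "sin (pi / 6) \<le> sin (ell q)" using l by (intro sin_monotone_2pi_le) auto
    hence "q * (1 / 2) \<le> q * sin (ell q)" using q0 by (intro mult_left_mono) (auto simp: sin_30)
    thus False using * l q by linarith
  qed
  let ?g = "\<lambda>t. (q + sin (q * sin t) - q * sin t * cos (q * sin t)) / (2 * sin (q * sin t))"
  let ?b = "\<lambda>t. (q + pi) / 2 * (1 / (pi - q * sin t)) + 109 / 200"
  have b: "(?b has_integral (q + pi) / 2 * (4 / sqrt (pi\<^sup>2 - q\<^sup>2) * arctan (sqrt ((pi + q) / (pi - q))))
     + 109 / 200 * pi) {0..pi}"
  proof (intro has_integral_add has_integral_mult_right has_integral_inverse_pi_minus_sin)
    show "((\<lambda>_. 109 / 200) has_integral 109 / 200 * pi) {0..pi}"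
      using has_integral_const_real[of "109 / 200 :: real" 0 pi] by (simp add: mult.commute)
  qed (use q0 q in auto)
  have b0: "0 \<le> ?b t" for t
  proof -
    have "q * sin t \<le> q * 1" using q0 by (intro mult_left_mono) auto
    hence "q * sin t \<le> pi" using q by linarith
    thus ?thesis using q0 by (intro add_nonneg_nonneg mult_nonneg_nonneg) auto
  qed
  have g: "?g integrable_on {ell q..pi - ell q}"
    using ang_bounds(6)[OF q0 q(2)]
    by (intro integrable_continuous_real continuous_intros) force
  have "continuous_on {ell q..pi - ell q} ?b"
    using ang_bounds(2)[OF q0 q(2)] by (intro continuous_intros) force
  hence b': "?b integrable_on {ell q..pi - ell q}" by (rule integrable_continuous_real)
  have "J q = integral {ell q..pi - ell q} ?g" using q0 by (simp add: J_def)
  also have "\<dots> \<le> integral {ell q..pi - ell q} ?b"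
  proof (rule integral_le[OF g b'])
    fix t assume t: "t \<in> {ell q..pi - ell q}"
    have "q * sin (ell q) \<le> q * sin t" using sin_ge_on_ell_interval[OF q0 q(2) t] q0 by simp
    hence "pi / 3 \<le> q * sin t" using l l6 by linarith
    from J_integrand_le[OF q0 _ this] ang_bounds(2)[OF q0 q(2) t] q
    show "?g t \<le> ?b t" by simp
  qed
  also have "\<dots> \<le> integral {0..pi} ?b"
    using b b' b0 l by (intro integral_subset_le) auto
  also have "\<dots> = (q + pi) / 2 * (4 / sqrt (pi\<^sup>2 - q\<^sup>2) * arctan (sqrt ((pi + q) / (pi - q)))) + 109 / 200 * pi"
    using b by (rule integral_unique)
  finally show ?thesis .
qed

text \<open>The cubic coefficient 1 / 2, in place of 1 / 3, absorbs the tail of the logarithm series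
  on this range.\<close>

lemma ln_one_minus_ge:
  fixes x :: real
  assumes "0 \<le> x" "x \<le> 1 / 4"
  shows "- x - x\<^sup>2 / 2 - x ^ 3 / 2 \<le> ln (1 - x)"
proof -
  let ?f = "\<lambda>x. ln (1 - x) + x + x\<^sup>2 / 2 + x ^ 3 / 2"
  have "?f 0 \<le> ?f x"
  proof (rule DERIV_nonneg_imp_nondecreasing[of 0 x ?f, OF assms(1)])
    fix y assume y: "0 \<le> y" "y \<le> x"
    have "(?f has_real_derivative - (1 / (1 - y)) + 1 + y + 3 * y\<^sup>2 / 2) (at y)"
      using y assms by (auto intro!: derivative_eq_intros)
    have "- (1 / (1 - y)) + 1 + y + 3 * y\<^sup>2 / 2 = y\<^sup>2 * (1 - 3 * y) / (2 * (1 - y))"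
      using y assms by (simp add: field_simps power2_eq_square)
    moreover have "0 \<le> y\<^sup>2 * (1 - 3 * y) / (2 * (1 - y))" using y assms by (intro divide_nonneg_nonneg mult_nonneg_nonneg) auto
    ultimately have "0 \<le> - (1 / (1 - y)) + 1 + y + 3 * y\<^sup>2 / 2" by simp
    with \<open>(?f has_real_derivative _) _\<close>
    show "\<exists>d. (?f has_real_derivative d) (at y) \<and> 0 \<le> d" by blast
  qed
  thus ?thesis by simp
qed

text \<open>The radius \<open>pi (1 - 1 / (2 k))\<close> nearly minimises \<open>J q / q ^ k\<close>.\<close>

lemma J_le_at_optimal_radius:
  fixes k :: nat
  assumes k: "2 \<le> k"
  defines "\<epsilon> \<equiv> 1 / (2 * real k)"
  shows "J (pi * (1 - \<epsilon>)) \<le> 2 * pi * sqrt (exp 1 * real k) * (1 - \<epsilon>) ^ k"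
proof -
  define q where "q = pi * (1 - \<epsilon>)"
  define \<delta> where "\<delta> = sqrt \<epsilon>"
  have e: "0 < \<epsilon>" "\<epsilon> \<le> 1 / 4" using k by (auto simp: \<epsilon>_def field_simps)
  have d: "0 < \<delta>" "\<delta>\<^sup>2 = \<epsilon>" using e by (auto simp: \<delta>_def)
  have d2: "\<delta> \<le> 1 / 2"
    by (rule power2_le_imp_le) (use e d in \<open>auto simp: power2_eq_square\<close>)
  have q: "2 * pi / 3 \<le> q" "q < pi" using e by (auto simp: q_def)
  define \<kappa> where "\<kappa> = sqrt ((2 - \<epsilon>) / \<epsilon>)"
  have k0: "\<kappa> > 0" using e by (simp add: \<kappa>_def)
  have "(pi + q) / (pi - q) = (2 - \<epsilon>) / \<epsilon>" using e by (simp add: q_def field_simps)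
  hence k1: "sqrt ((pi + q) / (pi - q)) = \<kappa>" by (simp add: \<kappa>_def)
  have k2: "(q + pi) / sqrt (pi\<^sup>2 - q\<^sup>2) = \<kappa>"
  proof (rule power2_eq_imp_eq)
    have pq: "pi\<^sup>2 - q\<^sup>2 = (pi - q) * (pi + q)" by (simp add: power2_eq_square algebra_simps)
    have "0 < pi - q" "0 < pi + q" using q pi_gt_zero by linarith+
    hence "((q + pi) / sqrt (pi\<^sup>2 - q\<^sup>2))\<^sup>2 = (pi + q) / (pi - q)"
      unfolding pq by (simp add: power_divide power2_eq_square add.commute)
    also have "\<dots> = \<kappa>\<^sup>2" using \<open>0 < pi - q\<close> \<open>0 < pi + q\<close> unfolding k1[symmetric] by simp
    finally show "((q + pi) / sqrt (pi\<^sup>2 - q\<^sup>2))\<^sup>2 = \<kappa>\<^sup>2" .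
    show "0 \<le> (q + pi) / sqrt (pi\<^sup>2 - q\<^sup>2)"
      unfolding pq using \<open>0 < pi - q\<close> \<open>0 < pi + q\<close> by simp
  qed (use k0 in simp)
  \<comment> \<open>An upper bound for arctan \<kappa> from a lower bound for the complementary
    angle arctan (1 / \<kappa>), which is at least its sine sqrt (\<epsilon> / 2).\<close>
  have at: "arctan \<kappa> \<le> pi / 2 - sqrt (\<epsilon> / 2)"
  proof -
    have "sqrt (\<epsilon> / 2) = sin (arctan (1 / \<kappa>))"
    proof -
      have "(1 / \<kappa>)\<^sup>2 = \<epsilon> / (2 - \<epsilon>)" using e by (simp add: \<kappa>_def power_divide)
      hence 1: "1 + (1 / \<kappa>)\<^sup>2 = 2 / (2 - \<epsilon>)" using e by (simp add: field_simps)
      have "1 / \<kappa> = sqrt (\<epsilon> / (2 - \<epsilon>))" unfolding \<kappa>_def real_sqrt_divide by simp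
      hence "sin (arctan (1 / \<kappa>)) = sqrt ((\<epsilon> / (2 - \<epsilon>)) / (2 / (2 - \<epsilon>)))"
        unfolding sin_arctan 1 by (simp only: real_sqrt_divide)
      also have "(\<epsilon> / (2 - \<epsilon>)) / (2 / (2 - \<epsilon>)) = \<epsilon> / 2" using e by simp
      finally show ?thesis by simp
    qed
    also have "\<dots> \<le> arctan (1 / \<kappa>)" using k0 by (intro sin_x_le_x) auto
    also have "\<dots> = pi / 2 - arctan \<kappa>" using k0 arctan_inverse[of \<kappa>] by (simp add: sgn_if inverse_eq_divide)
    finally show ?thesis by simp
  qed
  have "J q \<le> (q + pi) / 2 * (4 / sqrt (pi\<^sup>2 - q\<^sup>2) * arctan \<kappa>) + 109 / 200 * pi"
    using J_le[OF q] by (simp add: k1)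
  also have "\<dots> = 2 * \<kappa> * arctan \<kappa> + 109 / 200 * pi" unfolding k2[symmetric] by simp
  also have "\<dots> \<le> 2 * \<kappa> * (pi / 2 - sqrt (\<epsilon> / 2)) + 109 / 200 * pi"
    using at k0 by simp
  also have "\<dots> = \<kappa> * pi - sqrt (4 - 2 * \<epsilon>) + 109 / 200 * pi"
  proof -
    have "2 * \<kappa> * sqrt (\<epsilon> / 2) = sqrt 4 * sqrt ((2 - \<epsilon>) / \<epsilon>) * sqrt (\<epsilon> / 2)" by (simp add: \<kappa>_def)
    also have "\<dots> = sqrt (4 * ((2 - \<epsilon>) / \<epsilon>) * (\<epsilon> / 2))" by (simp only: real_sqrt_mult)
    also have "4 * ((2 - \<epsilon>) / \<epsilon>) * (\<epsilon> / 2) = 4 - 2 * \<epsilon>" using e by (simp add: field_simps)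
    finally show ?thesis by (simp add: algebra_simps)
  qed
  \<comment> \<open>(1 - \<epsilon>)^k is slightly below exp (- 1 / 2), and this factor pays for the
    deficit: \<epsilon> / 4 comes from sqrt (2 - \<epsilon>) in \<kappa>, and \<epsilon>^2 / 4 from
    109 / 200 pi - sqrt (4 - 2 \<epsilon>), which is negative.\<close>
  also have "\<dots> \<le> sqrt 2 * pi / \<delta> * (1 - \<epsilon> / 4 - \<epsilon>\<^sup>2 / 4)"
  proof -
    have "\<kappa> = sqrt (2 - \<epsilon>) / \<delta>" by (simp add: \<kappa>_def \<delta>_def real_sqrt_divide)
    moreover have "sqrt (2 - \<epsilon>) \<le> sqrt 2 * (1 - \<epsilon> / 4)"
    proof (rule power2_le_imp_le)
      have "(sqrt 2 * (1 - \<epsilon> / 4))\<^sup>2 = 2 * (1 - \<epsilon> / 4)\<^sup>2" by (simp add: power_mult_distrib)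
      also have "\<dots> = 2 - \<epsilon> + \<epsilon>\<^sup>2 / 8" by (simp add: power2_eq_square algebra_simps)
      finally show "(sqrt (2 - \<epsilon>))\<^sup>2 \<le> (sqrt 2 * (1 - \<epsilon> / 4))\<^sup>2" using e by simp
    qed (use e in auto)
    ultimately have "\<kappa> * pi \<le> sqrt 2 * (1 - \<epsilon> / 4) / \<delta> * pi"
      using d by (simp add: divide_right_mono)
    moreover have "109 / 200 * pi + sqrt 2 * pi / 4 * \<delta> ^ 3 \<le> sqrt (4 - 2 * \<epsilon>)"
    proof -
      have s2: "sqrt 2 \<le> 1.4143" by (rule real_le_lsqrt) (simp_all add: power2_eq_square)
      have "\<delta> ^ 3 \<le> (1 / 2) ^ 3" using d d2 by (intro power_mono) auto
      hence "(sqrt 2 * pi / 4) * \<delta> ^ 3 \<le> (1.4143 * 3.15 / 4) * (1 / 8)"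
        using s2 pi_bounds d by (intro mult_mono divide_right_mono) (auto simp: power3_eq_cube)
      also have "\<dots> \<le> 14 / 100" by simp
      finally have "sqrt 2 * pi / 4 * \<delta> ^ 3 \<le> 14 / 100" .
      moreover have "187 / 100 \<le> sqrt (4 - 2 * \<epsilon>)" by (rule real_le_rsqrt) (use e in \<open>simp add: power2_eq_square\<close>)
      ultimately show ?thesis using pi_bounds by linarith
    qed
    moreover have "sqrt 2 * pi / \<delta> * (1 - \<epsilon> / 4 - \<epsilon>\<^sup>2 / 4) = sqrt 2 * (1 - \<epsilon> / 4) / \<delta> * pi - sqrt 2 * pi / 4 * \<delta> ^ 3"
      using d(1) unfolding d(2)[symmetric] by (simp add: field_simps eval_nat_numeral)
    ultimately show ?thesis by linarith
  qed
  also have "\<dots> \<le> sqrt 2 * pi / \<delta> * (exp (1 / 2) * (1 - \<epsilon>) ^ k)"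
  proof (rule mult_left_mono)
    have ek: "\<epsilon> * real k = 1 / 2" using k by (simp add: \<epsilon>_def)
    \<comment> \<open>As \<epsilon> k = 1 / 2, the factor is exactly 1 + 1 / 2 plus k times the
      cubic lower bound for ln (1 - \<epsilon>).\<close>
    have "1 - \<epsilon> / 4 - \<epsilon>\<^sup>2 / 4 = 1 + (1 / 2 + real k * (- \<epsilon> - \<epsilon>\<^sup>2 / 2 - \<epsilon> ^ 3 / 2))"
    proof -
      have "real k * (- \<epsilon> - \<epsilon>\<^sup>2 / 2 - \<epsilon> ^ 3 / 2) = (\<epsilon> * real k) * (- 1 - \<epsilon> / 2 - \<epsilon>\<^sup>2 / 2)"
        by (simp add: algebra_simps eval_nat_numeral)
      thus ?thesis unfolding ek by (simp add: algebra_simps)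
    qed
    also have "\<dots> \<le> 1 + (1 / 2 + real k * ln (1 - \<epsilon>))"
      using ln_one_minus_ge[of \<epsilon>] e by (intro add_left_mono mult_left_mono) auto
    also have "\<dots> \<le> exp (1 / 2 + real k * ln (1 - \<epsilon>))" by (rule exp_ge_add_one_self)
    also have "\<dots> = exp (1 / 2) * (1 - \<epsilon>) ^ k"
      using e by (simp add: exp_add exp_of_nat_mult)
    finally show "1 - \<epsilon> / 4 - \<epsilon>\<^sup>2 / 4 \<le> exp (1 / 2) * (1 - \<epsilon>) ^ k" .
  qed (use d in auto)
  also have "\<dots> = 2 * pi * sqrt (exp 1 * real k) * (1 - \<epsilon>) ^ k"
  proof -
    have "sqrt 2 / \<delta> = sqrt (2 / \<epsilon>)" unfolding \<delta>_def by (rule real_sqrt_divide[symmetric])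
    also have "2 / \<epsilon> = 4 * real k" by (simp add: \<epsilon>_def)
    also have "sqrt (4 * real k) = 2 * sqrt (real k)" by (simp add: real_sqrt_mult)
    finally have "sqrt 2 / \<delta> = 2 * sqrt (real k)" .
    moreover have "exp (1 / 2) = sqrt (exp (1::real))"
    proof (rule real_sqrt_unique[symmetric])
      show "(exp (1 / 2))\<^sup>2 = exp (1::real)" by (simp add: power2_eq_square flip: exp_add)
    qed simp
    ultimately have "sqrt 2 / \<delta> * exp (1 / 2) = 2 * sqrt (exp 1 * real k)" by (simp add: real_sqrt_mult)
    hence "(sqrt 2 / \<delta> * exp (1 / 2)) * (pi * (1 - \<epsilon>) ^ k) = (2 * sqrt (exp 1 * real k)) * (pi * (1 - \<epsilon>) ^ k)"
      by (rule arg_cong)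
    thus ?thesis by (simp add: mult_ac)
  qed
  finally show ?thesis by (simp add: q_def)
qed

subsection \<open>The conformal range of ordered products\<close>

definition vec_angle :: "'a::real_inner \<Rightarrow> 'a \<Rightarrow> real" where
  "vec_angle x y = arccos (inner x y / (norm x * norm y))"

lemma inner_quotient_bounds:
  fixes x y :: "'a::real_inner"
  shows "- 1 \<le> inner x y / (norm x * norm y)" "inner x y / (norm x * norm y) \<le> 1"
proof -
  have "\<bar>inner x y / (norm x * norm y)\<bar> \<le> 1"
    using Cauchy_Schwarz_ineq2[of x y] by (cases "x = 0 \<or> y = 0") (auto simp: divide_le_eq_1)
  thus "- 1 \<le> inner x y / (norm x * norm y)" "inner x y / (norm x * norm y) \<le> 1"
    by linarith+
qed

lemma vec_angle_bounds:
  fixes x y :: "'a::real_inner"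
  shows "0 \<le> vec_angle x y" "vec_angle x y \<le> pi"
    "cos (vec_angle x y) = inner x y / (norm x * norm y)"
  unfolding vec_angle_def
  using inner_quotient_bounds[of x y] by (auto intro: arccos_lbound arccos_ubound)

text \<open>The spherical triangle inequality. The components of u and w orthogonal to v have the
  two sines as lengths, and Cauchy-Schwarz for these components bounds the cosine of the sum of the
  angles by the cosine of the third. If the sum exceeds pi there is nothing to prove.\<close>

lemma vec_angle_triangle:
  fixes x y z :: "'a::real_inner"
  assumes "x \<noteq> 0" "y \<noteq> 0" "z \<noteq> 0"
  shows "vec_angle x z \<le> vec_angle x y + vec_angle y z"
proof (cases "vec_angle x y + vec_angle y z \<le> pi")
  case True
  define u v w where "u = x /\<^sub>R norm x" and "v = y /\<^sub>R norm y" and "w = z /\<^sub>R norm z"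
  have n: "inner u u = 1" "inner v v = 1" "inner w w = 1"
    using assms by (simp_all add: u_def v_def w_def dot_square_norm power2_eq_square)
  have c: "cos (vec_angle x y) = inner u v" "cos (vec_angle y z) = inner v w" "cos (vec_angle x z) = inner u w"
    by (simp_all add: vec_angle_bounds u_def v_def w_def field_simps)
  have s: "sin (vec_angle x y) = norm (u - inner u v *\<^sub>R v)" "sin (vec_angle y z) = norm (w - inner v w *\<^sub>R v)"
  proof -
    have "(norm (u - inner u v *\<^sub>R v))\<^sup>2 = 1 - (inner u v)\<^sup>2"
      unfolding power2_norm_eq_inner
      by (simp add: inner_diff n inner_commute[of v u] power2_eq_square)
    hence "(sin (vec_angle x y))\<^sup>2 = (norm (u - inner u v *\<^sub>R v))\<^sup>2" by (simp add: sin_squared_eq c)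
    thus "sin (vec_angle x y) = norm (u - inner u v *\<^sub>R v)"
      by (rule power2_eq_imp_eq) (use vec_angle_bounds[of x y] in \<open>auto intro: sin_ge_zero\<close>)
    have "(norm (w - inner v w *\<^sub>R v))\<^sup>2 = 1 - (inner v w)\<^sup>2"
      unfolding power2_norm_eq_inner
      by (simp add: inner_diff n inner_commute[of w v] power2_eq_square)
    hence "(sin (vec_angle y z))\<^sup>2 = (norm (w - inner v w *\<^sub>R v))\<^sup>2" by (simp add: sin_squared_eq c)
    thus "sin (vec_angle y z) = norm (w - inner v w *\<^sub>R v)"
      by (rule power2_eq_imp_eq) (use vec_angle_bounds[of y z] in \<open>auto intro: sin_ge_zero\<close>)
  qed
  have "inner (u - inner u v *\<^sub>R v) (w - inner v w *\<^sub>R v) = inner u w - inner u v * inner v w"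
    by (simp add: inner_diff n)
  hence "cos (vec_angle x y) * cos (vec_angle y z) - sin (vec_angle x y) * sin (vec_angle y z)
      \<le> cos (vec_angle x z)"
    unfolding s c using Cauchy_Schwarz_ineq2[of "u - inner u v *\<^sub>R v" "w - inner v w *\<^sub>R v"] by linarith
  hence "cos (vec_angle x y + vec_angle y z) \<le> cos (vec_angle x z)" by (simp add: cos_add)
  thus ?thesis using True vec_angle_bounds[of x y] vec_angle_bounds[of y z] vec_angle_bounds[of x z]
    cos_mono_le_eq[of "vec_angle x y + vec_angle y z" "vec_angle x z"] by auto
next
  case False
  thus ?thesis using vec_angle_bounds(2)[of x z] by linarith
qed

lemma norm_Ln_le_quotient:
  assumes "cmod (w - 1) \<le> \<epsilon>" "\<epsilon> < 1"
  shows "cmod (Ln w) \<le> \<epsilon> / (1 - \<epsilon>)"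
proof -
  have e: "0 \<le> \<epsilon>" by (rule order_trans[OF norm_ge_zero assms(1)])
  have re: "1 - \<epsilon> \<le> Re z" if "z \<in> cball 1 \<epsilon>" for z
    using complex_Re_le_cmod[of "1 - z"] that by (simp add: dist_norm)
  have "norm (Ln w - Ln 1) \<le> 1 / (1 - \<epsilon>) * norm (w - 1)"
  proof (rule field_differentiable_bound[of "cball 1 \<epsilon>" Ln inverse])
    fix z assume z: "z \<in> cball (1::complex) \<epsilon>"
    have "z \<notin> \<real>\<^sub>\<le>\<^sub>0" using re[OF z] assms(2) by (auto simp: complex_nonpos_Reals_iff)
    thus "(Ln has_field_derivative inverse z) (at z within cball 1 \<epsilon>)"
      by (rule has_field_derivative_at_within[OF has_field_derivative_Ln])
    have "1 - \<epsilon> \<le> cmod z" using re[OF z] complex_Re_le_cmod[of z] by linarith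
    hence "inverse (cmod z) \<le> inverse (1 - \<epsilon>)" using assms(2) by (intro le_imp_inverse_le) auto
    thus "norm (inverse z) \<le> 1 / (1 - \<epsilon>)" by (simp add: norm_inverse divide_inverse)
  next
    show "w \<in> cball 1 \<epsilon>" using assms(1) by (simp add: dist_norm norm_minus_commute)
    show "(1::complex) \<in> cball 1 \<epsilon>" using e by simp
  qed (rule convex_cball)
  also have "\<dots> \<le> 1 / (1 - \<epsilon>) * \<epsilon>" using assms by (intro mult_left_mono) auto
  finally show ?thesis by simp
qed

text \<open>Its exponential is the point of the conformal range that \<open>x\<close> contributes if \<open>y\<close> is the image of \<open>x\<close>.\<close>

definition log_displacement :: "'a::real_inner \<Rightarrow> 'a \<Rightarrow> complex" where
  "log_displacement x y = Complex (ln (norm y / norm x)) (vec_angle x y)"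

text \<open>In the plane of x and y, sending x to 1 sends y to w = r exp (i \<theta>) with |w - 1| =
  norm (y - x) / norm x. Since \<theta> lies in [0, pi], the displacement is the principal logarithm
  of w.\<close>

lemma norm_log_displacement_step:
  fixes x y :: "'a::real_inner"
  assumes x: "x \<noteq> 0" and le: "norm (y - x) \<le> \<epsilon> * norm x" and e: "\<epsilon> < 1"
  shows "y \<noteq> 0" "cmod (log_displacement x y) \<le> \<epsilon> / (1 - \<epsilon>)"
proof -
  have nx: "norm x > 0" using x by simp
  show y: "y \<noteq> 0"
  proof
    assume "y = 0"
    hence "norm x \<le> \<epsilon> * norm x" using le by simp
    thus False using nx e by (simp add: mult_le_cancel_right1)
  qed
  define r \<theta> where "r = norm y / norm x" and "\<theta> = vec_angle x y"
  define w where "w = rcis r \<theta>"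
  have r: "r > 0" using x y by (simp add: r_def)
  have th: "0 \<le> \<theta>" "\<theta> \<le> pi" "cos \<theta> = inner x y / (norm x * norm y)"
    unfolding \<theta>_def by (rule vec_angle_bounds)+
  have wexp: "w = exp (Complex (ln r) \<theta>)" using r by (simp add: w_def exp_eq_polar rcis_def)
  have Lnw: "Ln w = log_displacement x y"
  proof -
    have "- pi < \<theta>" using th(1) pi_gt_zero by linarith
    thus ?thesis using th(2) wexp by (simp add: Ln_exp log_displacement_def r_def \<theta>_def)
  qed
  have "(r * c - 1)\<^sup>2 + (r * s)\<^sup>2 = r\<^sup>2 * (c\<^sup>2 + s\<^sup>2) - 2 * r * c + 1" for c s
    by algebra
  from this[of "cos \<theta>" "sin \<theta>"] have "(cmod (w - 1))\<^sup>2 = r\<^sup>2 - 2 * r * cos \<theta> + 1"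
    unfolding cmod_power2 by (simp add: w_def rcis_def)
  also have "\<dots> = (norm (y - x))\<^sup>2 / (norm x)\<^sup>2"
  proof -
    have "(norm (y - x))\<^sup>2 = (norm y)\<^sup>2 - 2 * inner x y + (norm x)\<^sup>2"
      by (simp add: power2_norm_eq_inner inner_diff inner_commute[of y x])
    thus ?thesis using x y by (simp add: th r_def field_simps power2_eq_square)
  qed
  also have "\<dots> \<le> \<epsilon>\<^sup>2"
    using nx power_mono[OF le, of 2] by (simp add: divide_simps power_mult_distrib)
  finally have "(cmod (w - 1))\<^sup>2 \<le> \<epsilon>\<^sup>2" .
  moreover have "0 \<le> \<epsilon> * norm x" by (rule order_trans[OF norm_ge_zero le])
  hence "0 \<le> \<epsilon>" using nx by (simp add: zero_le_mult_iff)
  ultimately have "cmod (w - 1) \<le> \<epsilon>" by (rule power2_le_imp_le)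
  thus "cmod (log_displacement x y) \<le> \<epsilon> / (1 - \<epsilon>)"
    using norm_Ln_le_quotient[of w \<epsilon>] e by (simp add: Lnw)
qed

text \<open>The real parts add exactly and the angles are subadditive. As angles are non-negative,
  enlarging the imaginary part to the sum of the angles can only increase the modulus.\<close>

lemma norm_log_displacement_triangle:
  fixes x y z :: "'a::real_inner"
  assumes "x \<noteq> 0" "y \<noteq> 0" "z \<noteq> 0"
  shows "cmod (log_displacement x z) \<le> cmod (log_displacement x y) + cmod (log_displacement y z)"
proof -
  have "ln (norm z / norm x) = ln (norm y / norm x) + ln (norm z / norm y)"
    using assms by (simp add: ln_div)
  moreover have "0 \<le> vec_angle x z" "vec_angle x z \<le> vec_angle x y + vec_angle y z"
    using vec_angle_triangle[OF assms] vec_angle_bounds by auto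
  hence "(vec_angle x z)\<^sup>2 \<le> (vec_angle x y + vec_angle y z)\<^sup>2" by (intro power_mono)
  ultimately have "cmod (log_displacement x z) \<le> cmod (log_displacement x y + log_displacement y z)"
    by (simp add: log_displacement_def cmod_def)
  also have "\<dots> \<le> cmod (log_displacement x y) + cmod (log_displacement y z)"
    by (rule norm_triangle_ineq)
  finally show ?thesis .
qed

text \<open>Factors 1 + B i stand in for the exponentials of small increments: their product expands
  into words with strictly increasing indices, which approximate the simplex integrals.\<close>

primrec ordered_prod :: "(nat \<Rightarrow> ('a::real_normed_vector \<Rightarrow>\<^sub>L 'a)) \<Rightarrow> nat \<Rightarrow> ('a \<Rightarrow>\<^sub>L 'a)" where
  "ordered_prod B 0 = id_blinfun"
| "ordered_prod B (Suc n) = ordered_prod B n o\<^sub>L (id_blinfun + B n)"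

text \<open>The last factor acts first on a vector, so the induction passes from x to y = x + B n x
  and lets x vary. The displacements of the single steps add up by the triangle inequality.\<close>

lemma norm_log_displacement_ordered_prod:
  fixes B :: "nat \<Rightarrow> ('a::real_inner \<Rightarrow>\<^sub>L 'a)"
  assumes "\<And>i. i < n \<Longrightarrow> norm (B i) \<le> \<epsilon>" "\<epsilon> < 1" "x \<noteq> 0"
  shows "ordered_prod B n x \<noteq> 0 \<and> cmod (log_displacement x (ordered_prod B n x)) \<le> real n * (\<epsilon> / (1 - \<epsilon>))"
  using assms
proof (induction n arbitrary: x)
  case 0
  have "inner x x / (norm x * norm x) = 1" using 0 by (simp add: dot_square_norm power2_eq_square)
  thus ?case using 0 by (simp add: log_displacement_def vec_angle_def complex_eq_iff)
next
  case (Suc n)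
  define y where "y = x + B n x"
  have "norm (B n x) \<le> norm (B n) * norm x" by (rule norm_blinfun)
  also have "\<dots> \<le> \<epsilon> * norm x" using Suc.prems by (intro mult_right_mono) auto
  finally have "norm (y - x) \<le> \<epsilon> * norm x" by (simp add: y_def)
  note y = norm_log_displacement_step[OF Suc.prems(3) this Suc.prems(2)]
  have IH: "ordered_prod B n y \<noteq> 0 \<and> cmod (log_displacement y (ordered_prod B n y)) \<le> real n * (\<epsilon> / (1 - \<epsilon>))"
    using Suc y by auto
  have eq: "ordered_prod B (Suc n) x = ordered_prod B n y"
    by (simp add: y_def blinfun.add_left)
  show ?case unfolding eq
    using IH y norm_log_displacement_triangle[of x y "ordered_prod B n y"] Suc.prems
    by (auto simp: algebra_simps add_divide_distrib)
qed

text \<open>With a = ln (norm y / norm x) and b the angle, dividing the form by (norm x)^2 exp a exp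
  (p cos t) leaves the left side of \<open>exp_disc_tangent\<close> minus 2 sin t cos b. The disc
  condition gives b \<le> sqrt (p^2 - a^2) \<le> pi, a range on which the cosine decreases.\<close>

lemma quadratic_form_le_of_log_displacement:
  fixes x y :: "'a::real_inner"
  assumes "x \<noteq> 0" "y \<noteq> 0" and c: "cmod (log_displacement x y) \<le> p"
    and p: "0 < p" "p \<le> pi" and t: "0 < t" "t < pi"
  shows "sin (t + p * sin t) * (norm y)\<^sup>2 - 2 * exp (p * cos t) * sin t * inner x y
      + (exp (p * cos t))\<^sup>2 * sin (t - p * sin t) * (norm x)\<^sup>2 \<le> 0"
proof -
  define a b where "a = ln (norm y / norm x)" and "b = vec_angle x y"
  have b: "0 \<le> b" "b \<le> pi" "cos b = inner x y / (norm x * norm y)"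
    unfolding b_def by (rule vec_angle_bounds)+
  have ea: "exp a = norm y / norm x" using assms by (simp add: a_def)
  hence ny: "norm y = exp a * norm x" using assms by simp
  have "(cmod (log_displacement x y))\<^sup>2 \<le> p\<^sup>2" using c by (intro power_mono) auto
  hence ab: "a\<^sup>2 + b\<^sup>2 \<le> p\<^sup>2" by (simp add: cmod_power2 log_displacement_def a_def b_def)
  have "a\<^sup>2 \<le> p\<^sup>2" using ab zero_le_power2[of b] by linarith
  hence a: "\<bar>a\<bar> \<le> p" using p by (simp add: abs_le_square_iff[symmetric])
  have "b \<le> sqrt (p\<^sup>2 - a\<^sup>2)" using ab b by (intro real_le_rsqrt) auto
  moreover have "sqrt (p\<^sup>2 - a\<^sup>2) \<le> sqrt (p\<^sup>2)" by (intro real_sqrt_le_mono) simp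
  hence "sqrt (p\<^sup>2 - a\<^sup>2) \<le> pi" using p by simp
  ultimately have "cos (sqrt (p\<^sup>2 - a\<^sup>2)) \<le> cos b" using b by (intro cos_monotone_0_pi_le) auto
  moreover have st: "0 < sin t" using t by (simp add: sin_gt_zero)
  ultimately have "exp (a - p * cos t) * sin (t + p * sin t) + exp (p * cos t - a) * sin (t - p * sin t)
      \<le> 2 * sin t * cos b"
    using exp_disc_tangent[OF p t a] mult_left_mono[of _ _ "2 * sin t"] by (smt (verit))
  hence H: "(exp a * exp (p * cos t)) * (exp (a - p * cos t) * sin (t + p * sin t) + exp (p * cos t - a) * sin (t - p * sin t))
      \<le> (exp a * exp (p * cos t)) * (2 * sin t * cos b)"
    by (intro mult_left_mono) auto
  hence "exp a ^ 2 * sin (t + p * sin t) + exp (p * cos t) ^ 2 * sin (t - p * sin t)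
      \<le> 2 * exp a * exp (p * cos t) * sin t * cos b"
  proof -
    have "(P * Q) * (P / Q * u + Q / P * v) = P ^ 2 * u + Q ^ 2 * v" if "P > 0" "Q > 0" for P Q u v :: real
      using that by (simp add: field_simps power2_eq_square)
    from this[of "exp a" "exp (p * cos t)"] show ?thesis
      using H unfolding exp_diff by (simp only: exp_gt_zero mult_ac)
  qed
  hence "(norm x)\<^sup>2 * (exp a ^ 2 * sin (t + p * sin t) + exp (p * cos t) ^ 2 * sin (t - p * sin t))
      \<le> (norm x)\<^sup>2 * (2 * exp a * exp (p * cos t) * sin t * cos b)"
    by (intro mult_left_mono) auto
  moreover have "inner x y = (norm x)\<^sup>2 * exp a * cos b"
    using assms by (simp add: b ny power2_eq_square)
  ultimately show ?thesis by (simp add: ny power_mult_distrib algebra_simps)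
qed

text \<open>With \<open>n\<close> factors of size \<open>q / n\<close> the total displacement is at most
  \<open>n * ((q / n) / (1 - q / n)) = q / (1 - q / n)\<close>, which tends to \<open>q\<close>.\<close>

lemma quadratic_form_le_limit:
  fixes B :: "nat \<Rightarrow> nat \<Rightarrow> ('a::real_inner \<Rightarrow>\<^sub>L 'a)"
  assumes B: "\<And>n i. i < n \<Longrightarrow> norm (B n i) \<le> q / real n" and q: "0 < q" "q < pi"
    and lim: "(\<lambda>n. ordered_prod (B n) n) \<longlonglongrightarrow> A" and t: "0 < t" "t < pi"
  shows "sin (t + q * sin t) * (norm (A x))\<^sup>2 - 2 * exp (q * cos t) * sin t * inner x (A x)
      + (exp (q * cos t))\<^sup>2 * sin (t - q * sin t) * (norm x)\<^sup>2 \<le> 0"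
proof (cases "x = 0")
  case False
  define p where "p = (\<lambda>n. q / (1 - q / real n))"
  have "(\<lambda>n. q / real n) \<longlonglongrightarrow> 0" by (rule lim_const_over_n)
  hence "p \<longlonglongrightarrow> q / (1 - 0)" unfolding p_def by (intro tendsto_intros) auto
  hence p: "p \<longlonglongrightarrow> q" by simp
  have Ax: "(\<lambda>n. ordered_prod (B n) n x) \<longlonglongrightarrow> A x"
    using lim by (intro tendsto_intros)
  define Q where "Q = (\<lambda>c w. sin (t + c * sin t) * (norm w)\<^sup>2 - 2 * exp (c * cos t) * sin t * inner x w
      + (exp (c * cos t))\<^sup>2 * sin (t - c * sin t) * (norm x)\<^sup>2)"
  have conv: "(\<lambda>n. Q (p n) (ordered_prod (B n) n x)) \<longlonglongrightarrow> Q q (A x)"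
    unfolding Q_def by (intro tendsto_intros p Ax)
  have "eventually (\<lambda>n. p n < pi) sequentially" using p q(2) by (rule order_tendstoD)
  moreover have "eventually (\<lambda>n. p n > 0) sequentially" using p q(1) by (rule order_tendstoD)
  moreover have "eventually (\<lambda>n. real n > q) sequentially"
    using filterlim_real_sequentially by (auto simp: filterlim_at_top_dense)
  ultimately have "eventually (\<lambda>n. Q (p n) (ordered_prod (B n) n x) \<le> 0) sequentially"
  proof eventually_elim
    case (elim n)
    hence n0: "real n > 0" using q by simp
    have "q / real n < 1" using elim n0 by simp
    hence "ordered_prod (B n) n x \<noteq> 0 \<and> cmod (log_displacement x (ordered_prod (B n) n x))
        \<le> real n * ((q / real n) / (1 - q / real n))"
      using B False by (intro norm_log_displacement_ordered_prod)
    moreover have "real n * ((q / real n) / (1 - q / real n)) = p n" using n0 by (simp add: p_def)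
    ultimately show ?case unfolding Q_def
      using elim t False by (intro quadratic_form_le_of_log_displacement) auto
  qed
  hence "Q q (A x) \<le> 0"
    by (rule tendsto_upperbound[OF conv]) simp
  thus ?thesis by (simp add: Q_def)
qed simp

text \<open>The quadratic form is a positive multiple of the difference of the two squared norms.\<close>

lemma norm_moebius_le:
  fixes x w :: "'a::real_inner"
  assumes q: "0 < q" "q < pi" and t: "t \<in> {ell q..pi - ell q}"
    and le: "sin (t + q * sin t) * (norm w)\<^sup>2 - 2 * exp (q * cos t) * sin t * inner x w
      + (exp (q * cos t))\<^sup>2 * sin (t - q * sin t) * (norm x)\<^sup>2 \<le> 0"
  defines "y \<equiv> x + mob_par q t *\<^sub>R (w - x)"
  shows "norm ((w - x) - disc_center q t *\<^sub>R y) \<le> disc_radius q t * norm y"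
proof -
  define A B E where "A = ang_lo q t" and "B = ang_hi q t" and "E = exp (q * cos t)"
  define m S where "m = mob_den q t" and "S = sin (q * sin t)"
  note b = ang_bounds[OF q t]
  have m: "m > 0" "m = sin A + E * sin B" using b
    by (simp_all add: m_def mob_den_def A_def B_def E_def)
  have E: "E > 0" by (simp add: E_def)
  have S: "S > 0" using b by (simp add: S_def)
  have AB: "A + B = q * sin t" "A - B = t - pi / 2" using ang_add ang_diff by (auto simp: A_def B_def)
  have Seq: "S = sin A * cos B + cos A * sin B" by (simp add: S_def sin_add flip: AB(1))
  have c2A: "(cos A)\<^sup>2 - (sin A)\<^sup>2 = sin (t + q * sin t)"
  proof -
    have "(cos A)\<^sup>2 - (sin A)\<^sup>2 = cos (2 * A)" by (simp add: cos_double)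
    also have "2 * A = (t + q * sin t) - pi / 2" by (simp add: A_def ang_lo_def field_simps)
    also have "cos \<dots> = sin (t + q * sin t)" by (simp add: cos_diff)
    finally show ?thesis .
  qed
  have c2B: "(cos B)\<^sup>2 - (sin B)\<^sup>2 = sin (t - q * sin t)"
  proof -
    have "(cos B)\<^sup>2 - (sin B)\<^sup>2 = cos (2 * B)" by (simp add: cos_double)
    also have "2 * B = pi / 2 - (t - q * sin t)" by (simp add: B_def ang_hi_def field_simps)
    also have "cos \<dots> = sin (t - q * sin t)" by (simp add: cos_diff)
    finally show ?thesis .
  qed
  have st: "cos A * cos B + sin A * sin B = sin t"
  proof -
    have "cos A * cos B + sin A * sin B = cos (A - B)" by (simp add: cos_diff)
    also have "\<dots> = sin t" unfolding AB(2) by (simp add: cos_diff)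
    finally show ?thesis .
  qed
  define k where "k = m / (E * S)"
  have k: "k > 0" using m E S by (simp add: k_def)
  \<comment> \<open>\<open>V\<close> is m y, and the vector to be estimated will turn out to be
    \<open>k *\<^sub>R U\<close>. As the radius is m k, the claim becomes norm U \<le> norm
    V.\<close>
  define U V where "U = cos A *\<^sub>R w - (E * cos B) *\<^sub>R x" and "V = sin A *\<^sub>R w + (E * sin B) *\<^sub>R x"
  have s: "mob_par q t = sin A / m" by (simp add: mob_par_def A_def m_def)
  have r: "disc_radius q t = m * k"
    by (simp add: disc_radius_def m_def k_def S_def E_def power2_eq_square)
  have c: "disc_center q t = k * (E * cos B - cos A)"
    by (simp add: disc_center_def m_def k_def S_def E_def A_def B_def)
  have yV: "y = V /\<^sub>R m"
  proof -
    have "m *\<^sub>R y = m *\<^sub>R x + sin A *\<^sub>R (w - x)" using m(1) by (simp add: y_def s scaleR_add_right)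
    also have "\<dots> = V" unfolding V_def m(2) by (simp add: algebra_simps)
    finally show ?thesis using m(1) by auto
  qed
  have "(m * E * S) *\<^sub>R ((w - x) - disc_center q t *\<^sub>R y) = (m * E * S) *\<^sub>R (k *\<^sub>R U)"
  proof -
    have d: "m * E * S * disc_center q t = m * m * (E * cos B - cos A)"
      using E S by (simp add: c k_def field_simps)
    have "(m * E * S) *\<^sub>R ((w - x) - disc_center q t *\<^sub>R y)
        = (m * E * S) *\<^sub>R (w - x) - (m * (E * cos B - cos A)) *\<^sub>R V"
    proof -
      have "(m * E * S) *\<^sub>R ((w - x) - disc_center q t *\<^sub>R y)
          = (m * E * S) *\<^sub>R (w - x) - (m * m * (E * cos B - cos A)) *\<^sub>R y"
        by (simp only: scaleR_diff_right scaleR_scaleR d)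
      also have "(m * m * (E * cos B - cos A)) *\<^sub>R y = (m * (E * cos B - cos A)) *\<^sub>R V"
        using m(1) by (simp add: yV mult_ac)
      finally show ?thesis .
    qed
    also have "\<dots> = m *\<^sub>R ((E * S - (E * cos B - cos A) * sin A) *\<^sub>R w - (E * S + (E * cos B - cos A) * (E * sin B)) *\<^sub>R x)"
      unfolding V_def by (simp add: algebra_simps)
    also have "E * S - (E * cos B - cos A) * sin A = m * cos A"
      unfolding Seq m(2) by (simp add: algebra_simps)
    also have "E * S + (E * cos B - cos A) * (E * sin B) = m * (E * cos B)"
      unfolding Seq m(2) by (simp add: algebra_simps)
    also have "m *\<^sub>R ((m * cos A) *\<^sub>R w - (m * (E * cos B)) *\<^sub>R x) = (m * m) *\<^sub>R U"
      unfolding U_def by (simp add: algebra_simps)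
    also have "m * m = m * E * S * k" using E S by (simp add: k_def)
    finally show ?thesis by simp
  qed
  moreover have "m * E * S \<noteq> 0" using m(1) E S by simp
  ultimately have U: "(w - x) - disc_center q t *\<^sub>R y = k *\<^sub>R U"
    unfolding scaleR_cancel_left by blast
  have sq: "(norm (a *\<^sub>R w + b *\<^sub>R x))\<^sup>2 = a\<^sup>2 * inner w w + 2 * a * b * inner x w + b\<^sup>2 * inner x x" for a b
    unfolding power2_norm_eq_inner
    by (simp add: inner_add inner_commute[of w x] power2_eq_square algebra_simps)
  have "(norm U)\<^sup>2 - (norm V)\<^sup>2 = ((cos A)\<^sup>2 - (sin A)\<^sup>2) * inner w w
      - 2 * E * (cos A * cos B + sin A * sin B) * inner x w + E\<^sup>2 * ((cos B)\<^sup>2 - (sin B)\<^sup>2) * inner x x"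
  proof -
    have "U = cos A *\<^sub>R w + (- (E * cos B)) *\<^sub>R x" by (simp add: U_def)
    hence "(norm U)\<^sup>2 = (cos A)\<^sup>2 * inner w w + 2 * cos A * (- (E * cos B)) * inner x w + (- (E * cos B))\<^sup>2 * inner x x"
      by (simp only: sq)
    moreover have "(norm V)\<^sup>2 = (sin A)\<^sup>2 * inner w w + 2 * sin A * (E * sin B) * inner x w + (E * sin B)\<^sup>2 * inner x x"
      unfolding V_def by (rule sq)
    ultimately show ?thesis by algebra
  qed
  also have "\<dots> \<le> 0" using le unfolding c2A c2B st by (simp add: dot_square_norm E_def)
  finally have "(norm U)\<^sup>2 \<le> (norm V)\<^sup>2" by simp
  hence "norm U \<le> norm V" by (rule power2_le_imp_le) simp
  hence "norm (k *\<^sub>R U) \<le> k * norm V" using k by simp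
  also have "\<dots> = disc_radius q t * norm y" using m k by (simp add: r yV)
  finally show ?thesis by (simp add: U)
qed

subsection \<open>The variation of a vector measure\<close>

lemma vector_measure_sums:
  assumes "vector_measure M \<nu>" "\<And>n. A n \<in> sets M" "disjoint_family A"
  shows "(\<lambda>n::nat. \<nu> (A n)) sums \<nu> (\<Union>n. A n)"
  using assms unfolding vector_measure_def by (metis image_subsetI)

lemma vector_measure_empty:
  assumes "vector_measure M \<nu>"
  shows "\<nu> {} = 0"
proof -
  have "(\<lambda>n::nat. \<nu> {}) sums \<nu> (\<Union>n::nat. {})"
    by (rule vector_measure_sums[OF assms]) (auto simp: disjoint_family_on_def)
  hence "(\<lambda>n::nat. \<nu> {}) \<longlonglongrightarrow> 0" by (auto intro: summable_LIMSEQ_zero simp: sums_iff)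
  thus ?thesis by (simp add: LIMSEQ_const_iff)
qed

lemma vector_measure_Un:
  assumes \<nu>: "vector_measure M \<nu>" and "A \<in> sets M" "B \<in> sets M" "A \<inter> B = {}"
  shows "\<nu> (A \<union> B) = \<nu> A + \<nu> B"
proof -
  have "(\<lambda>n. \<nu> (binaryset A B n)) sums \<nu> (\<Union>n. binaryset A B n)"
    by (rule vector_measure_sums[OF \<nu>]) (use assms in \<open>auto simp: binaryset_def disjoint_family_on_def\<close>)
  moreover have "(\<lambda>n. \<nu> (binaryset A B n)) sums (\<nu> A + \<nu> B)"
    by (rule binaryset_sums) (rule vector_measure_empty[OF \<nu>])
  ultimately show ?thesis by (simp add: UN_binaryset_eq sums_unique2)
qed

lemma vector_measure_UN:
  assumes \<nu>: "vector_measure M \<nu>" and "finite S" "\<And>i. i \<in> S \<Longrightarrow> A i \<in> sets M" "disjoint_family_on A S"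
  shows "\<nu> (\<Union>i\<in>S. A i) = (\<Sum>i\<in>S. \<nu> (A i))"
  using assms(2-)
proof (induction S)
  case empty
  show ?case by (simp add: vector_measure_empty[OF \<nu>])
next
  case (insert a S)
  have "A a \<inter> (\<Union>i\<in>S. A i) = {}" using insert by (auto simp: disjoint_family_on_def)
  hence "\<nu> (A a \<union> (\<Union>i\<in>S. A i)) = \<nu> (A a) + \<nu> (\<Union>i\<in>S. A i)"
    using insert by (intro vector_measure_Un[OF \<nu>]) auto
  thus ?case using insert by (auto simp: disjoint_family_on_def)
qed

lemma vector_measure_Diff:
  assumes \<nu>: "vector_measure M \<nu>" and "A \<in> sets M" "B \<in> sets M" "B \<subseteq> A"
  shows "\<nu> (A - B) = \<nu> A - \<nu> B"
  using vector_measure_Un[OF \<nu>, of "A - B" B] assms by (simp add: Un_absorb2 Int_commute)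

lemma vector_measure_scaleR:
  assumes "vector_measure M \<nu>"
  shows "vector_measure M (\<lambda>E. c *\<^sub>R \<nu> E)"
  using assms unfolding vector_measure_def by (auto intro: sums_scaleR_right)

text \<open>Disjoint families inside E, rather than partitions of E, make the variation monotone at
  once.\<close>

definition subpartitions :: "'b measure \<Rightarrow> 'b set \<Rightarrow> 'b set set set" where
  "subpartitions M E = {P. finite P \<and> P \<subseteq> sets M \<and> disjoint P \<and> \<Union>P \<subseteq> E}"

definition variation_on :: "'b measure \<Rightarrow> ('b set \<Rightarrow> 'e::real_normed_vector) \<Rightarrow> 'b set \<Rightarrow> ennreal" where
  "variation_on M \<nu> E = (SUP P\<in>subpartitions M E. \<Sum>F\<in>P. ennreal (norm (\<nu> F)))"

definition variation_measure :: "'b measure \<Rightarrow> ('b set \<Rightarrow> 'e::real_normed_vector) \<Rightarrow> 'b measure" where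
  "variation_measure M \<nu> = measure_of (space M) (sets M) (variation_on M \<nu>)"

lemma subpartitions_nonempty: "subpartitions M E \<noteq> {}"
  by (auto simp: subpartitions_def intro!: exI[of _ "{}"])

lemma variation_on_empty:
  assumes "vector_measure M \<nu>"
  shows "variation_on M \<nu> {} = 0"
proof -
  have "(\<Sum>F\<in>P. ennreal (norm (\<nu> F))) \<le> 0" if "P \<in> subpartitions M {}" for P
  proof -
    have "F = {}" if "F \<in> P" for F using that \<open>P \<in> _\<close> by (auto simp: subpartitions_def)
    hence "(\<Sum>F\<in>P. ennreal (norm (\<nu> F))) = 0"
      using vector_measure_empty[OF assms] by (intro sum.neutral) auto
    thus ?thesis by simp
  qed
  hence "variation_on M \<nu> {} \<le> 0" unfolding variation_on_def by (intro SUP_least)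
  thus ?thesis by simp
qed

lemma variation_on_mono: "A \<subseteq> B \<Longrightarrow> variation_on M \<nu> A \<le> variation_on M \<nu> B"
  unfolding variation_on_def by (intro SUP_subset_mono) (auto simp: subpartitions_def)

lemma norm_le_variation_on:
  assumes "E \<in> sets M"
  shows "ennreal (norm (\<nu> E)) \<le> variation_on M \<nu> E"
proof -
  have "{E} \<in> subpartitions M E" using assms by (auto simp: subpartitions_def)
  hence "(\<Sum>F\<in>{E}. ennreal (norm (\<nu> F))) \<le> variation_on M \<nu> E"
    unfolding variation_on_def by (rule SUP_upper)
  thus ?thesis by simp
qed

lemma variation_on_superadditive:
  assumes \<nu>: "vector_measure M \<nu>" and AB: "A \<inter> B = {}"
  shows "variation_on M \<nu> A + variation_on M \<nu> B \<le> variation_on M \<nu> (A \<union> B)"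
proof -
  let ?s = "\<lambda>P. \<Sum>F\<in>P. ennreal (norm (\<nu> F))"
  have le: "?s P + ?s Q \<le> variation_on M \<nu> (A \<union> B)"
    if P: "P \<in> subpartitions M A" and Q: "Q \<in> subpartitions M B" for P Q
  proof -
    have fin: "finite P" "finite Q" using P Q by (auto simp: subpartitions_def)
    \<comment> \<open>The two families may share the empty set, whose value is 0, so passing to
      their union loses nothing.\<close>
    have "F = {}" if "F \<in> P \<inter> Q" for F
    proof -
      have "F \<subseteq> A" "F \<subseteq> B" using that P Q by (auto simp: subpartitions_def)
      thus ?thesis using AB by blast
    qed
    hence "?s (P \<inter> Q) = 0" using vector_measure_empty[OF \<nu>] by (intro sum.neutral) auto
    hence "?s P + ?s Q = ?s (P \<union> Q)" using sum.union_inter[OF fin, of "\<lambda>F. ennreal (norm (\<nu> F))"] by simp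
    moreover have "disjoint (P \<union> Q)"
    proof (rule disjoint_union)
      show "\<Union>P \<inter> \<Union>Q = {}" using P Q AB unfolding subpartitions_def by blast
    qed (use P Q in \<open>auto simp: subpartitions_def\<close>)
    hence "P \<union> Q \<in> subpartitions M (A \<union> B)" using P Q
      by (auto simp: subpartitions_def)
    hence "?s (P \<union> Q) \<le> variation_on M \<nu> (A \<union> B)" unfolding variation_on_def by (rule SUP_upper)
    ultimately show ?thesis by simp
  qed
  have "variation_on M \<nu> A + variation_on M \<nu> B
      = (SUP P\<in>subpartitions M A. SUP Q\<in>subpartitions M B. ?s P + ?s Q)"
    unfolding variation_on_def ennreal_SUP_add_left[OF subpartitions_nonempty, symmetric]
    by (subst ennreal_SUP_add_right[OF subpartitions_nonempty]) (rule refl)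
  also have "\<dots> \<le> variation_on M \<nu> (A \<union> B)" by (intro SUP_least le)
  finally show ?thesis .
qed

text \<open>Superadditivity gives one inequality. For the other, every member F of a family is cut
  along the A n: countable additivity of \<nu> bounds norm (\<nu> F) by the sum over its pieces, and
  the pieces inside A n form a family there.\<close>

lemma variation_on_countably_additive:
  assumes \<nu>: "vector_measure M \<nu>" and A: "\<And>n::nat. A n \<in> sets M" and disj: "disjoint_family A"
  shows "(\<Sum>n. variation_on M \<nu> (A n)) = variation_on M \<nu> (\<Union>n. A n)"
proof (rule antisym)
  have "(\<Sum>i<n. variation_on M \<nu> (A i)) \<le> variation_on M \<nu> (\<Union>i<n. A i)" for n
  proof (induction n)
    case (Suc n)
    have "A i \<inter> A n = {}" if "i < n" for i
      using that by (intro disjoint_family_onD[OF disj]) auto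
    hence "(\<Union>i<n. A i) \<inter> A n = {}" by blast
    hence "variation_on M \<nu> (\<Union>i<n. A i) + variation_on M \<nu> (A n) \<le> variation_on M \<nu> ((\<Union>i<n. A i) \<union> A n)"
      by (rule variation_on_superadditive[OF \<nu>])
    moreover have "(\<Union>i<n. A i) \<union> A n = (\<Union>i<Suc n. A i)" by (auto simp: less_Suc_eq)
    moreover have "(\<Sum>i<Suc n. variation_on M \<nu> (A i)) \<le> variation_on M \<nu> (\<Union>i<n. A i) + variation_on M \<nu> (A n)"
      unfolding sum.lessThan_Suc by (rule add_right_mono[OF Suc])
    ultimately show ?case by (simp only: order_trans)
  qed simp
  also have "variation_on M \<nu> (\<Union>i<n. A i) \<le> variation_on M \<nu> (\<Union>n. A n)" for n
    by (intro variation_on_mono) auto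
  finally show "(\<Sum>n. variation_on M \<nu> (A n)) \<le> variation_on M \<nu> (\<Union>n. A n)"
    by (intro suminf_le_const) auto
next
  show "variation_on M \<nu> (\<Union>n. A n) \<le> (\<Sum>n. variation_on M \<nu> (A n))"
    unfolding variation_on_def[of _ _ "\<Union>n. A n"]
  proof (rule SUP_least)
    fix P assume P: "P \<in> subpartitions M (\<Union>n. A n)"
    have fin: "finite P" using P by (simp add: subpartitions_def)
    have 1: "ennreal (norm (\<nu> F)) \<le> (\<Sum>n. ennreal (norm (\<nu> (F \<inter> A n))))" if F: "F \<in> P" for F
    proof -
      have FM: "F \<in> sets M" "F \<subseteq> (\<Union>n. A n)" using F P by (auto simp: subpartitions_def)
      have "(\<lambda>n. \<nu> (F \<inter> A n)) sums \<nu> (\<Union>n. F \<inter> A n)"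
        using FM A disjoint_family_onD[OF disj]
        by (intro vector_measure_sums[OF \<nu>]) (auto simp: disjoint_family_on_def disjoint_iff)
      moreover have "(\<Union>n. F \<inter> A n) = F" using FM by auto
      ultimately have "(\<lambda>n. norm (\<Sum>i<n. \<nu> (F \<inter> A i))) \<longlonglongrightarrow> norm (\<nu> F)"
        by (intro tendsto_norm) (simp add: sums_def)
      hence "(\<lambda>n. ennreal (norm (\<Sum>i<n. \<nu> (F \<inter> A i)))) \<longlonglongrightarrow> ennreal (norm (\<nu> F))"
        by (rule tendsto_ennrealI)
      moreover have "ennreal (norm (\<Sum>i<n. \<nu> (F \<inter> A i))) \<le> (\<Sum>n. ennreal (norm (\<nu> (F \<inter> A n))))" for n
      proof -
        have "ennreal (norm (\<Sum>i<n. \<nu> (F \<inter> A i))) \<le> ennreal (\<Sum>i<n. norm (\<nu> (F \<inter> A i)))"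
          by (intro ennreal_leI norm_sum)
        also have "\<dots> = (\<Sum>i<n. ennreal (norm (\<nu> (F \<inter> A i))))" by (simp add: sum_ennreal)
        also have "\<dots> \<le> (\<Sum>n. ennreal (norm (\<nu> (F \<inter> A n))))" by (intro sum_le_suminf) auto
        finally show ?thesis .
      qed
      ultimately show ?thesis using LIMSEQ_le_const2 by blast
    qed
    have 2: "(\<Sum>F\<in>P. ennreal (norm (\<nu> (F \<inter> A n)))) \<le> variation_on M \<nu> (A n)" for n
    proof -
      let ?Q = "(\<lambda>F. F \<inter> A n) ` P"
      have "(\<Sum>F\<in>?Q. ennreal (norm (\<nu> F))) = (\<Sum>F\<in>P. ennreal (norm (\<nu> (F \<inter> A n))))"
      \<comment> \<open>Different members may have the same trace on A n, but then both traces are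
        empty.\<close>
      proof (subst sum.reindex_nontrivial[OF fin])
        fix F G assume "F \<in> P" "G \<in> P" "F \<noteq> G" "F \<inter> A n = G \<inter> A n"
        moreover have "F \<inter> G = {}"
          using calculation P unfolding subpartitions_def by (intro disjointD[of P]) auto
        ultimately have "F \<inter> A n = {}" by blast
        thus "ennreal (norm (\<nu> (F \<inter> A n))) = 0" using vector_measure_empty[OF \<nu>] by simp
      qed (simp add: o_def)
      moreover have "disjoint ?Q"
      proof (rule disjointI)
        fix a b assume "a \<in> ?Q" "b \<in> ?Q" "a \<noteq> b"
        then obtain F G where FG: "F \<in> P" "G \<in> P" "F \<noteq> G" "a = F \<inter> A n" "b = G \<inter> A n" by blast
        moreover have "F \<inter> G = {}"
          using FG(1-3) P unfolding subpartitions_def by (intro disjointD[of P]) auto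
        ultimately show "a \<inter> b = {}" by blast
      qed
      hence "?Q \<in> subpartitions M (A n)" using P A by (auto simp: subpartitions_def)
      hence "(\<Sum>F\<in>?Q. ennreal (norm (\<nu> F))) \<le> variation_on M \<nu> (A n)"
        unfolding variation_on_def by (rule SUP_upper)
      ultimately show ?thesis by simp
    qed
    have "(\<Sum>F\<in>P. ennreal (norm (\<nu> F))) \<le> (\<Sum>F\<in>P. \<Sum>n. ennreal (norm (\<nu> (F \<inter> A n))))"
      by (intro sum_mono 1)
    also have "\<dots> = (\<Sum>n. \<Sum>F\<in>P. ennreal (norm (\<nu> (F \<inter> A n))))"
      by (intro suminf_sum[symmetric]) auto
    also have "\<dots> \<le> (\<Sum>n. variation_on M \<nu> (A n))" by (intro suminf_le 2) auto
    finally show "(\<Sum>F\<in>P. ennreal (norm (\<nu> F))) \<le> (\<Sum>n. variation_on M \<nu> (A n))" .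
  qed
qed

lemma sets_variation_measure [simp, measurable_cong]: "sets (variation_measure M \<nu>) = sets M"
  by (simp add: variation_measure_def)

lemma space_variation_measure [simp]: "space (variation_measure M \<nu>) = space M"
  by (simp add: variation_measure_def)

lemma emeasure_variation_measure:
  assumes \<nu>: "vector_measure M \<nu>" and E: "E \<in> sets M"
  shows "emeasure (variation_measure M \<nu>) E = variation_on M \<nu> E"
  unfolding variation_measure_def
proof (rule emeasure_measure_of_sigma[OF _ _ _ E])
  show "positive (sets M) (variation_on M \<nu>)"
    by (simp add: positive_def variation_on_empty[OF \<nu>])
  show "countably_additive (sets M) (variation_on M \<nu>)"
    by (auto simp: countably_additive_def intro!: variation_on_countably_additive[OF \<nu>])
qed (rule sets.sigma_algebra_axioms)

lemma emeasure_variation_measure_space_le: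
  assumes \<nu>: "vector_measure M \<nu>" and bdd: "bdd_above (variation_sums M \<nu>)"
  shows "emeasure (variation_measure M \<nu>) (space M) \<le> ennreal (total_variation M \<nu>)"
  unfolding emeasure_variation_measure[OF \<nu> sets.top] variation_on_def
proof (rule SUP_least)
  fix P assume P: "P \<in> subpartitions M (space M)"
  \<comment> \<open>The family is completed by the uncovered rest; empty sets are removed because
    \<open>partition_on\<close> excludes them.\<close>
  define R where "R = space M - \<Union>P"
  define Q where "Q = insert R P - {{}}"
  have fin: "finite P" using P by (simp add: subpartitions_def)
  have R: "R \<in> sets M" using P by (auto simp: subpartitions_def R_def intro!: sets.finite_Union)
  have PM: "P \<subseteq> sets M" "disjoint P" "\<Union>P \<subseteq> space M" using P by (simp_all add: subpartitions_def)
  have "disjoint (P \<union> {R})"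
    by (rule disjoint_union) (use PM in \<open>auto simp: R_def\<close>)
  hence "disjoint Q" unfolding Q_def disjoint_def by blast
  moreover have "\<Union>Q = space M" using PM(3) by (auto simp: Q_def R_def)
  moreover have "{} \<notin> Q" by (simp add: Q_def)
  ultimately have "partition_on (space M) Q" by (intro partition_onI) (auto simp: disjnt_def disjointD)
  hence "(\<Sum>E\<in>Q. norm (\<nu> E)) \<in> variation_sums M \<nu>"
    using P R by (auto simp: variation_sums_def subpartitions_def Q_def)
  hence le: "(\<Sum>E\<in>Q. norm (\<nu> E)) \<le> total_variation M \<nu>"
    unfolding total_variation_def using bdd by (rule cSup_upper)
  have "(\<Sum>F\<in>P. norm (\<nu> F)) \<le> (\<Sum>F\<in>insert R P. norm (\<nu> F))"
    using fin by (intro sum_mono2) auto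
  also have "\<dots> = (\<Sum>F\<in>Q. norm (\<nu> F))"
    unfolding Q_def using fin vector_measure_empty[OF \<nu>]
    by (intro sum.mono_neutral_right) auto
  finally have "(\<Sum>F\<in>P. norm (\<nu> F)) \<le> total_variation M \<nu>" using le by linarith
  thus "(\<Sum>F\<in>P. ennreal (norm (\<nu> F))) \<le> ennreal (total_variation M \<nu>)"
    by (simp add: sum_ennreal ennreal_leI)
qed

text \<open>The form in which nonatomicity enters: a point of nonzero value would be an atom. It
  makes the distribution function of the variation continuous.\<close>

lemma variation_measure_singleton:
  assumes \<nu>: "vector_measure M \<nu>" and nonatomic: "\<nexists>E. vm_atom M \<nu> E" and x: "{x} \<in> sets M"
  shows "emeasure (variation_measure M \<nu>) {x} = 0"
proof -
  have 0: "\<nu> {x} = 0"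
  proof (rule ccontr)
    assume "\<nu> {x} \<noteq> 0"
    hence "vm_atom M \<nu> {x}" using x vector_measure_empty[OF \<nu>]
      by (auto simp: vm_atom_def subset_singleton_iff)
    thus False using nonatomic by blast
  qed
  have "(\<Sum>F\<in>P. ennreal (norm (\<nu> F))) \<le> 0" if "P \<in> subpartitions M {x}" for P
  proof -
    have "F = {} \<or> F = {x}" if "F \<in> P" for F
      using that \<open>P \<in> _\<close> by (auto simp: subpartitions_def)
    hence "(\<Sum>F\<in>P. ennreal (norm (\<nu> F))) = 0" 
      using 0 vector_measure_empty[OF \<nu>] by (intro sum.neutral) fastforce
    thus ?thesis by simp
  qed
  hence "variation_on M \<nu> {x} \<le> 0" unfolding variation_on_def by (intro SUP_least)
  thus ?thesis by (simp add: emeasure_variation_measure[OF \<nu> x])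
qed

text \<open>Tannery's theorem, for an arbitrary filter because it is used along sequences, along
  finite grids of sets and for w tending to z.\<close>

lemma tendsto_suminf_dominated:
  fixes a :: "nat \<Rightarrow> 'x \<Rightarrow> 'b::banach"
  assumes lim: "\<And>n. (a n \<longlongrightarrow> b n) F"
    and le: "eventually (\<lambda>x. \<forall>n. norm (a n x) \<le> C n) F"
    and C: "summable C" and F: "F \<noteq> bot"
  shows "summable b" "((\<lambda>x. \<Sum>n. a n x) \<longlongrightarrow> (\<Sum>n. b n)) F"
proof -
  have bC: "norm (b n) \<le> C n" for n
    by (rule tendsto_upperbound[OF tendsto_norm[OF lim] _ F])
       (use le in eventually_elim, auto)
  show b: "summable b"
    using summable_comparison_test'[OF C, of 0 b] bC by simp
  show "((\<lambda>x. \<Sum>n. a n x) \<longlongrightarrow> (\<Sum>n. b n)) F"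
  proof (rule tendstoI)
    fix e :: real assume e: "e > 0"
    have "(\<lambda>N. \<Sum>n. C (n + N)) \<longlonglongrightarrow> 0" using C by (rule suminf_exist_split2)
    hence "eventually (\<lambda>N. (\<Sum>n. C (n + N)) < e / 3) sequentially"
      by (rule order_tendstoD) (use e in simp)
    then obtain N where N: "(\<Sum>n. C (n + N)) < e / 3" by (auto simp: eventually_sequentially)
    have tail: "norm (\<Sum>n. f (n + N)) < e / 3" if f: "\<And>n. norm (f n) \<le> C n" for f :: "nat \<Rightarrow> 'b"
    proof -
      have CN: "summable (\<lambda>n. C (n + N))" using C by (rule summable_ignore_initial_segment)
      have sn: "summable (\<lambda>n. norm (f (n + N)))"
        by (rule summable_comparison_test'[OF CN, of 0]) (use f in auto)
      have "norm (\<Sum>n. f (n + N)) \<le> (\<Sum>n. norm (f (n + N)))" using sn by (rule summable_norm)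
      also have "\<dots> \<le> (\<Sum>n. C (n + N))" using f sn CN by (intro suminf_le) auto
      finally show ?thesis using N by simp
    qed
    have "((\<lambda>x. \<Sum>n<N. a n x) \<longlongrightarrow> (\<Sum>n<N. b n)) F" by (intro tendsto_sum lim)
    hence "eventually (\<lambda>x. dist (\<Sum>n<N. a n x) (\<Sum>n<N. b n) < e / 3) F"
      using e by (intro tendstoD) auto
    thus "eventually (\<lambda>x. dist (\<Sum>n. a n x) (\<Sum>n. b n) < e) F"
      using le
    proof eventually_elim
      case (elim x)
      have ax: "summable (\<lambda>n. a n x)"
        using summable_comparison_test'[OF C, of 0 "\<lambda>n. a n x"] elim(2) by simp
      have "(\<Sum>n. a n x) - (\<Sum>n. b n)
          = ((\<Sum>n<N. a n x) - (\<Sum>n<N. b n)) + (\<Sum>n. a (n + N) x) - (\<Sum>n. b (n + N))"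
        using suminf_split_initial_segment[OF ax, of N] suminf_split_initial_segment[OF b, of N]
        by (simp add: algebra_simps)
      also have "norm \<dots> \<le> norm ((\<Sum>n<N. a n x) - (\<Sum>n<N. b n)) + norm (\<Sum>n. a (n + N) x) + norm (\<Sum>n. b (n + N))"
        by (rule order_trans[OF norm_triangle_ineq4]) (simp add: norm_triangle_ineq)
      also have "\<dots> < e / 3 + e / 3 + e / 3"
        using elim(1) tail[of "\<lambda>n. a n x"] tail[of b] elim(2) bC by (simp add: dist_norm)
      finally show ?case by (simp add: dist_norm)
    qed
  qed
qed

subsection \<open>Product vector measures\<close>

primrec op_prod :: "(nat \<Rightarrow> ('a::real_normed_vector \<Rightarrow>\<^sub>L 'a)) \<Rightarrow> nat \<Rightarrow> ('a \<Rightarrow>\<^sub>L 'a)" where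
  "op_prod f 0 = id_blinfun"
| "op_prod f (Suc k) = op_prod f k o\<^sub>L f k"

interpretation blinfun_compose: bounded_bilinear "(o\<^sub>L)"
  by (rule bounded_bilinear_blinfun_compose)

lemma blinfun_compose_simps [simp]:
  "id_blinfun o\<^sub>L A = A" "A o\<^sub>L id_blinfun = A" "(A o\<^sub>L B) o\<^sub>L C = A o\<^sub>L (B o\<^sub>L C)"
  by (auto intro!: blinfun_eqI)

lemma foldr_blinfun_compose: "foldr (o\<^sub>L) xs A = foldr (o\<^sub>L) xs id_blinfun o\<^sub>L A"
  by (induction xs) simp_all

lemma op_prod_eq_foldr: "op_prod f k = foldr (o\<^sub>L) (map f [0..<k]) id_blinfun"
  by (induction k) (simp_all add: foldr_blinfun_compose[of _ "f _"])

lemma op_prod_cong: "(\<And>i. i < k \<Longrightarrow> f i = g i) \<Longrightarrow> op_prod f k = op_prod g k"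
  by (induction k) auto

lemma norm_op_prod_le:
  assumes "\<And>i. i < k \<Longrightarrow> norm (f i) \<le> c i"
  shows "norm (op_prod f k) \<le> (\<Prod>i<k. c i)"
  using assms
proof (induction k)
  case (Suc k)
  have "norm (op_prod f (Suc k)) \<le> norm (op_prod f k) * norm (f k)"
    by (simp add: norm_blinfun_compose)
  also have "\<dots> \<le> (\<Prod>i<k. c i) * c k"
  proof (rule mult_mono)
    have "0 \<le> c i" if "i < k" for i
      using order_trans[OF norm_ge_zero Suc.prems[of i]] that by simp
    thus "0 \<le> (\<Prod>i<k. c i)" by (intro prod_nonneg) auto
  qed (use Suc in auto)
  finally show ?case by simp
qed (simp add: norm_blinfun_id_le)

lemma op_prod_scaleR: "op_prod (\<lambda>i. t *\<^sub>R f i) k = t ^ k *\<^sub>R op_prod f k"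
  by (induction k) (simp_all add: blinfun_compose.scaleR_left blinfun_compose.scaleR_right mult.commute)

lemma op_prod_sum:
  assumes "\<And>i. i < k \<Longrightarrow> finite (A i)"
  shows "op_prod (\<lambda>i. \<Sum>T\<in>A i. g T) k = (\<Sum>q\<in>Pi\<^sub>E {..<k} A. op_prod (\<lambda>i. g (q i)) k)"
  using assms
proof (induction k)
  case (Suc k)
  let ?h = "\<lambda>(y, q). q(k := y)"
  have inj: "inj_on ?h (A k \<times> Pi\<^sub>E {..<k} A)"
    by (rule inj_combinator) simp
  have "(\<Sum>q\<in>Pi\<^sub>E {..<Suc k} A. op_prod (\<lambda>i. g (q i)) (Suc k))
      = (\<Sum>q\<in>?h ` (A k \<times> Pi\<^sub>E {..<k} A). op_prod (\<lambda>i. g (q i)) (Suc k))"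
    by (simp add: lessThan_Suc PiE_insert_eq)
  also have "\<dots> = (\<Sum>(y, q)\<in>A k \<times> Pi\<^sub>E {..<k} A. op_prod (\<lambda>i. g (q i)) k o\<^sub>L g y)"
    unfolding sum.reindex[OF inj] o_def
  proof (intro sum.cong refl, clarify)
    fix y q
    have "op_prod (\<lambda>i. g ((q(k := y)) i)) k = op_prod (\<lambda>i. g (q i)) k" by (rule op_prod_cong) auto
    thus "op_prod (\<lambda>i. g ((q(k := y)) i)) (Suc k) = op_prod (\<lambda>i. g (q i)) k o\<^sub>L g y" by simp
  qed
  also have "\<dots> = (\<Sum>y\<in>A k. \<Sum>q\<in>Pi\<^sub>E {..<k} A. op_prod (\<lambda>i. g (q i)) k o\<^sub>L g y)"
    by (simp add: sum.cartesian_product)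
  also have "\<dots> = (\<Sum>q\<in>Pi\<^sub>E {..<k} A. \<Sum>y\<in>A k. op_prod (\<lambda>i. g (q i)) k o\<^sub>L g y)"
    by (rule sum.swap)
  also have "\<dots> = (\<Sum>q\<in>Pi\<^sub>E {..<k} A. op_prod (\<lambda>i. g (q i)) k) o\<^sub>L (\<Sum>y\<in>A k. g y)"
    unfolding blinfun_compose.sum_left unfolding blinfun_compose.sum_right ..
  also have "\<dots> = op_prod (\<lambda>i. \<Sum>T\<in>A i. g T) (Suc k)" using Suc by simp
  finally show ?case by simp
qed simp

text \<open>The cells of the Venn diagram of S, indexed by the set T of those members that contain
  the point. A cell may be empty.\<close>

definition atom_of :: "'b measure \<Rightarrow> 'b set set \<Rightarrow> 'b set set \<Rightarrow> 'b set" where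
  "atom_of M S T = {x \<in> space M. \<forall>A\<in>S. x \<in> A \<longleftrightarrow> A \<in> T}"

lemma atom_of_sets:
  assumes "finite S" "S \<subseteq> sets M"
  shows "atom_of M S T \<in> sets M"
  using assms
proof (induction S)
  case empty
  show ?case by (simp add: atom_of_def)
next
  case (insert A S)
  have "atom_of M (insert A S) T = atom_of M S T \<inter> (if A \<in> T then A else space M - A)"
    by (auto simp: atom_of_def)
  thus ?case using insert by auto
qed

lemma atom_of_disjoint:
  assumes "T \<subseteq> S" "T' \<subseteq> S" "T \<noteq> T'"
  shows "atom_of M S T \<inter> atom_of M S T' = {}"
  using assms unfolding atom_of_def by blast

lemma UN_atom_of:
  assumes "A \<in> S" "A \<subseteq> space M"
  shows "(\<Union>T\<in>{T \<in> Pow S. A \<in> T}. atom_of M S T) = A"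
proof
  show "A \<subseteq> (\<Union>T\<in>{T \<in> Pow S. A \<in> T}. atom_of M S T)"
  proof
    fix x assume "x \<in> A"
    hence "x \<in> atom_of M S {B \<in> S. x \<in> B}" "{B \<in> S. x \<in> B} \<in> {T \<in> Pow S. A \<in> T}"
      using assms by (auto simp: atom_of_def)
    thus "x \<in> (\<Union>T\<in>{T \<in> Pow S. A \<in> T}. atom_of M S T)" by blast
  qed
qed (use assms in \<open>auto simp: atom_of_def\<close>)

lemma sets_PiM_induct [consumes 2, case_names box empty compl union]:
  assumes "finite I" and E: "E \<in> sets (PiM I M)"
    and "\<And>F. (\<And>i. i \<in> I \<Longrightarrow> F i \<in> sets (M i)) \<Longrightarrow> P (Pi\<^sub>E I F)"
    and "P {}"
    and "\<And>A. A \<in> sets (PiM I M) \<Longrightarrow> P A \<Longrightarrow> P (space (PiM I M) - A)"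
    and "\<And>A. disjoint_family A \<Longrightarrow> (\<And>n. A n \<in> sets (PiM I M)) \<Longrightarrow> (\<And>n. P (A n)) \<Longrightarrow> P (\<Union>n::nat. A n)"
  shows "P E"
proof -
  have s: "sets (PiM I M) = sigma_sets (\<Pi>\<^sub>E i\<in>I. space (M i)) (prod_algebra I M)" by (rule sets_PiM)
  have "E \<in> sigma_sets (\<Pi>\<^sub>E i\<in>I. space (M i)) (prod_algebra I M)" using E s by simp
  with Int_stable_prod_algebra prod_algebra_sets_into_space show ?thesis
  proof (induction rule: sigma_sets_induct_disjoint)
    case (basic A)
    then obtain F where F: "A = Pi\<^sub>E I F" "F \<in> (\<Pi> i\<in>I. sets (M i))" by (rule prod_algebraE_all)
    thus ?case using assms(3)[of F] by auto
  next
    case (compl A)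
    thus ?case using assms(5)[of A] s by (simp add: space_PiM)
  next
    case (union A)
    thus ?case using assms(6)[of A] s by auto
  qed (rule assms(4))
qed

text \<open>Makes the definite description in \<open>simplex_integral\<close> meaningful: the values
  on boxes determine the measure.\<close>

lemma product_vm_unique:
  assumes "vector_measure (PiM I M) \<nu>" "vector_measure (PiM I M) \<nu>'" "finite I"
    and box: "\<And>F. (\<And>i. i \<in> I \<Longrightarrow> F i \<in> sets (M i)) \<Longrightarrow> \<nu> (Pi\<^sub>E I F) = \<nu>' (Pi\<^sub>E I F)"
    and E: "E \<in> sets (PiM I M)"
  shows "\<nu> E = \<nu>' E"
  using assms(3) E
proof (induction rule: sets_PiM_induct)
  case (box F)
  thus ?case by (rule assms(4))
next
  case empty
  show ?case using assms(1,2) by (simp add: vector_measure_empty)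
next
  case (compl A)
  have "\<nu> (space (PiM I M)) = \<nu>' (space (PiM I M))"
    unfolding space_PiM by (rule assms(4)) auto
  thus ?case using compl sets.sets_into_space[OF compl(1)]
    by (simp add: vector_measure_Diff[OF assms(1)] vector_measure_Diff[OF assms(2)])
next
  case (union A)
  have "(\<lambda>n. \<nu> (A n)) sums \<nu> (\<Union>n. A n)"
    by (rule vector_measure_sums[OF assms(1) union(2,1)])
  moreover have "(\<lambda>n. \<nu>' (A n)) sums \<nu>' (\<Union>n. A n)"
    by (rule vector_measure_sums[OF assms(2) union(2,1)])
  ultimately show ?case using union(3) sums_unique2 by simp
qed

lemma finite_measure_PiM:
  assumes "finite_measure \<mu>"
  shows "finite_measure (PiM {..<k::nat} (\<lambda>_. \<mu>))"
proof
  interpret finite_measure \<mu> by fact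
  interpret product_sigma_finite "\<lambda>_::nat. \<mu>" by unfold_locales
  have "emeasure (PiM {..<k} (\<lambda>_. \<mu>)) (space (PiM {..<k} (\<lambda>_. \<mu>))) = (\<Prod>i<k. emeasure \<mu> (space \<mu>))"
    unfolding space_PiM by (intro emeasure_PiM) auto
  thus "emeasure (PiM {..<k} (\<lambda>_. \<mu>)) (space (PiM {..<k} (\<lambda>_. \<mu>))) \<noteq> \<infinity>"
    by (simp add: power_eq_top_ennreal emeasure_finite)
qed

lemma measure_PiM_box:
  assumes "finite_measure \<mu>" and F: "\<And>i. i < k \<Longrightarrow> F i \<in> sets \<mu>"
  shows "measure (PiM {..<k::nat} (\<lambda>_. \<mu>)) (Pi\<^sub>E {..<k} F) = (\<Prod>i<k. measure \<mu> (F i))"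
proof -
  interpret finite_measure \<mu> by fact
  interpret product_sigma_finite "\<lambda>_::nat. \<mu>" by unfold_locales
  have "emeasure (PiM {..<k} (\<lambda>_. \<mu>)) (Pi\<^sub>E {..<k} F) = (\<Prod>i<k. emeasure \<mu> (F i))"
    by (intro emeasure_PiM) (use F in auto)
  also have "\<dots> = ennreal (\<Prod>i<k. measure \<mu> (F i))" by (simp add: emeasure_eq_measure prod_ennreal)
  finally show ?thesis by (simp add: measure_def prod_nonneg)
qed

section \<open>Construction of the product vector measure from finite grids\<close>

context
  fixes M \<mu> :: "'b measure" and \<phi> :: "'b set \<Rightarrow> ('a::banach \<Rightarrow>\<^sub>L 'a)" and k :: nat
  assumes \<phi>: "vector_measure M \<phi>" and fin: "finite_measure \<mu>" and sets_\<mu>: "sets \<mu> = sets M"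
    and le: "\<And>E. E \<in> sets M \<Longrightarrow> norm (\<phi> E) \<le> measure \<mu> E"
begin

private abbreviation "\<Pi>M \<equiv> PiM {..<k} (\<lambda>_. M)"
private abbreviation "\<Pi>\<mu> \<equiv> PiM {..<k} (\<lambda>_. \<mu>)"

lemma sets_PiM_eq: "sets \<Pi>\<mu> = sets \<Pi>M"
  by (intro sets_PiM_cong refl sets_\<mu>)

lemma box_sets: "(\<And>i. i < k \<Longrightarrow> F i \<in> sets M) \<Longrightarrow> Pi\<^sub>E {..<k} F \<in> sets \<Pi>M"
  by (intro sets_PiM_I_finite) auto

interpretation P: finite_measure \<Pi>\<mu> by (rule finite_measure_PiM[OF fin])

private definition "atom_box S q = Pi\<^sub>E {..<k} (\<lambda>i. atom_of M S (q i))"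

text \<open>\<open>approx E S\<close> spreads the product of the values on each cell of the grid generated by \<open>S\<close>
  over the cell, proportionally to the scalar product measure. It is exact on the boxes with sides in
  \<open>S\<close>, additive in \<open>E\<close> and dominated by the scalar measure, so it converges on the generated
  sigma-algebra as \<open>S\<close> grows.\<close>

private definition "approx E S =
  (\<Sum>q\<in>{..<k} \<rightarrow>\<^sub>E Pow S. (measure \<Pi>\<mu> (E \<inter> atom_box S q) / measure \<Pi>\<mu> (atom_box S q)) *\<^sub>R op_prod (\<lambda>i. \<phi> (atom_of M S (q i))) k)"

private abbreviation "\<F> \<equiv> finite_subsets_at_top (sets M)"

private lemma atom_box_in_sets: "finite S \<Longrightarrow> S \<subseteq> sets M \<Longrightarrow> atom_box S q \<in> sets \<Pi>M"
  unfolding atom_box_def by (intro box_sets atom_of_sets)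

private lemma norm_op_prod_atoms_le:
  assumes "finite S" "S \<subseteq> sets M"
  shows "norm (op_prod (\<lambda>i. \<phi> (atom_of M S (q i))) k) \<le> measure \<Pi>\<mu> (atom_box S q)"
  unfolding atom_box_def using assms
  by (subst measure_PiM_box[OF fin]) (auto simp: sets_\<mu> intro!: norm_op_prod_le le atom_of_sets)

private lemma atom_box_disjoint: "disjoint_family_on (atom_box S) ({..<k} \<rightarrow>\<^sub>E Pow S)"
proof (unfold disjoint_family_on_def, intro ballI impI)
  fix q q' assume q: "q \<in> {..<k} \<rightarrow>\<^sub>E Pow S" "q' \<in> {..<k} \<rightarrow>\<^sub>E Pow S" "q \<noteq> q'"
  then obtain i where i: "i < k" "q i \<noteq> q' i" by (metis PiE_ext lessThan_iff)
  have "atom_of M S (q i) \<inter> atom_of M S (q' i) = {}"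
    using q i by (intro atom_of_disjoint) (auto simp: PiE_iff)
  thus "atom_box S q \<inter> atom_box S q' = {}" using i unfolding atom_box_def by (auto simp: PiE_iff)
qed

private lemma norm_approx_le:
  assumes S: "finite S" "S \<subseteq> sets M" and E: "E \<in> sets \<Pi>M"
  shows "norm (approx E S) \<le> measure \<Pi>\<mu> E"
proof -
  let ?Q = "{..<k} \<rightarrow>\<^sub>E Pow S"
  have finQ: "finite ?Q" using S by (intro finite_PiE) auto
  have sets: "E \<inter> atom_box S q \<in> sets \<Pi>\<mu>" for q
    unfolding sets_PiM_eq using E atom_box_in_sets[OF S] by auto
  have "norm (approx E S) \<le> (\<Sum>q\<in>?Q. measure \<Pi>\<mu> (E \<inter> atom_box S q))"
    unfolding approx_def
  proof (rule sum_norm_le)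
    fix q
    have "measure \<Pi>\<mu> (E \<inter> atom_box S q) / measure \<Pi>\<mu> (atom_box S q) * norm (op_prod (\<lambda>i. \<phi> (atom_of M S (q i))) k)
       \<le> measure \<Pi>\<mu> (E \<inter> atom_box S q) / measure \<Pi>\<mu> (atom_box S q) * measure \<Pi>\<mu> (atom_box S q)"
      by (intro mult_left_mono norm_op_prod_atoms_le S) auto
    \<comment> \<open>For a null cell the quotient is 0 by the convention x / 0 = 0, so the cell
      contributes nothing.\<close>
    also have "\<dots> \<le> measure \<Pi>\<mu> (E \<inter> atom_box S q)" by (cases "measure \<Pi>\<mu> (atom_box S q) = 0") auto
    finally show "norm ((measure \<Pi>\<mu> (E \<inter> atom_box S q) / measure \<Pi>\<mu> (atom_box S q)) *\<^sub>R op_prod (\<lambda>i. \<phi> (atom_of M S (q i))) k)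
       \<le> measure \<Pi>\<mu> (E \<inter> atom_box S q)" by simp
  qed
  also have "\<dots> = measure \<Pi>\<mu> (\<Union>q\<in>?Q. E \<inter> atom_box S q)"
    by (rule P.finite_measure_finite_Union[symmetric])
       (use finQ sets atom_box_disjoint[of S] in \<open>auto simp: disjoint_family_on_def\<close>)
  also have "\<dots> \<le> measure \<Pi>\<mu> E"
    by (rule P.finite_measure_mono) (use E sets_PiM_eq in auto)
  finally show ?thesis .
qed

text \<open>Each cell of the grid lies in the box or is disjoint from it, because the sides belong
  to S. The cells inside recombine by the distributive law and the finite additivity of \<phi> in
  each coordinate.\<close>

private lemma approx_box:
  assumes S: "finite S" "S \<subseteq> sets M" and F: "\<And>i. i < k \<Longrightarrow> F i \<in> S"
  shows "approx (Pi\<^sub>E {..<k} F) S = op_prod (\<lambda>i. \<phi> (F i)) k"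
proof -
  let ?A = "\<lambda>i. {T \<in> Pow S. F i \<in> T}"
  let ?p = "\<lambda>q. op_prod (\<lambda>i. \<phi> (atom_of M S (q i))) k"
  have sub: "Pi\<^sub>E {..<k} ?A \<subseteq> {..<k} \<rightarrow>\<^sub>E Pow S" by (auto simp: PiE_iff)
  have "approx (Pi\<^sub>E {..<k} F) S = (\<Sum>q\<in>Pi\<^sub>E {..<k} ?A. ?p q)"
    unfolding approx_def
  proof (rule sum.mono_neutral_cong_right)
    show "finite ({..<k} \<rightarrow>\<^sub>E Pow S)" using S by (intro finite_PiE) auto
    show "Pi\<^sub>E {..<k} ?A \<subseteq> {..<k} \<rightarrow>\<^sub>E Pow S" by (rule sub)
    show "\<forall>q\<in>({..<k} \<rightarrow>\<^sub>E Pow S) - Pi\<^sub>E {..<k} ?A.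
        (measure \<Pi>\<mu> (Pi\<^sub>E {..<k} F \<inter> atom_box S q) / measure \<Pi>\<mu> (atom_box S q)) *\<^sub>R ?p q = 0"
    proof
      fix q assume q: "q \<in> ({..<k} \<rightarrow>\<^sub>E Pow S) - Pi\<^sub>E {..<k} ?A"
      then obtain i where i: "i < k" "F i \<notin> q i" by (auto simp: PiE_iff)
      have "F i \<inter> atom_of M S (q i) = {}" using i F[of i] by (auto simp: atom_of_def)
      hence "Pi\<^sub>E {..<k} F \<inter> atom_box S q = {}" using i unfolding atom_box_def by (auto simp: PiE_iff)
      thus "(measure \<Pi>\<mu> (Pi\<^sub>E {..<k} F \<inter> atom_box S q) / measure \<Pi>\<mu> (atom_box S q)) *\<^sub>R ?p q = 0" by simp
    qed
    fix q assume q: "q \<in> Pi\<^sub>E {..<k} ?A"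
    have "atom_of M S (q i) \<subseteq> F i" if "i < k" for i
      using q that F[OF that] by (auto simp: atom_of_def PiE_iff)
    hence "atom_box S q \<subseteq> Pi\<^sub>E {..<k} F" unfolding atom_box_def by (intro PiE_mono) auto
    hence "Pi\<^sub>E {..<k} F \<inter> atom_box S q = atom_box S q" by auto
    \<comment> \<open>On a null cell the quotient is 0 and not 1; this is harmless since the product
      vanishes there as well.\<close>
    moreover have "?p q = 0" if "measure \<Pi>\<mu> (atom_box S q) = 0"
      using norm_op_prod_atoms_le[OF S, of q] that by simp
    ultimately show "(measure \<Pi>\<mu> (Pi\<^sub>E {..<k} F \<inter> atom_box S q) / measure \<Pi>\<mu> (atom_box S q)) *\<^sub>R ?p q = ?p q"
      by (cases "measure \<Pi>\<mu> (atom_box S q) = 0") auto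
  qed
  also have "\<dots> = op_prod (\<lambda>i. \<Sum>T\<in>?A i. \<phi> (atom_of M S T)) k"
    using S by (intro op_prod_sum[symmetric]) auto
  also have "\<dots> = op_prod (\<lambda>i. \<phi> (F i)) k"
  proof (rule op_prod_cong)
    fix i assume i: "i < k"
    have "disjoint_family_on (atom_of M S) (?A i)"
      unfolding disjoint_family_on_def by (intro ballI impI atom_of_disjoint) auto
    hence "(\<Sum>T\<in>?A i. \<phi> (atom_of M S T)) = \<phi> (\<Union>T\<in>?A i. atom_of M S T)"
      using S by (intro vector_measure_UN[OF \<phi>, symmetric] atom_of_sets) auto
    also have "(\<Union>T\<in>?A i. atom_of M S T) = F i"
      using F[OF i] S sets.sets_into_space by (intro UN_atom_of) blast+
    finally show "(\<Sum>T\<in>?A i. \<phi> (atom_of M S T)) = \<phi> (F i)" .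
  qed
  finally show ?thesis .
qed

private lemma eventually_S: "eventually (\<lambda>S. finite S \<and> S \<subseteq> sets M) \<F>"
  by (rule eventually_finite_subsets_at_top_weakI) simp

private lemma approx_box_tendsto:
  assumes F: "\<And>i. i < k \<Longrightarrow> F i \<in> sets M"
  shows "(approx (Pi\<^sub>E {..<k} F) \<longlongrightarrow> op_prod (\<lambda>i. \<phi> (F i)) k) \<F>"
proof (rule tendsto_eventually)
  show "eventually (\<lambda>S. approx (Pi\<^sub>E {..<k} F) S = op_prod (\<lambda>i. \<phi> (F i)) k) \<F>"
    unfolding eventually_finite_subsets_at_top
    by (rule exI[of _ "F ` {..<k}"]) (use F in \<open>auto intro!: approx_box\<close>)
qed

text \<open>For a fixed grid \<open>approx\<close> is countably additive, being a finite combination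
  of scalar measures. The scalar product measure dominates uniformly in the grid, so the series and
  the limit over grids can be exchanged.\<close>

private lemma approx_union:
  assumes A: "disjoint_family A" "\<And>n::nat. A n \<in> sets \<Pi>M" and lim: "\<And>n. (approx (A n) \<longlongrightarrow> b n) \<F>"
  shows "summable b" "(approx (\<Union>n. A n) \<longlongrightarrow> (\<Sum>n. b n)) \<F>"
proof -
  have A': "A n \<in> sets \<Pi>\<mu>" for n using A by (simp add: sets_PiM_eq)
  have C: "summable (\<lambda>n. measure \<Pi>\<mu> (A n))"
    using P.finite_measure_UNION[of A] A A' by (auto simp: sums_iff)
  have ev: "eventually (\<lambda>S. \<forall>n. norm (approx (A n) S) \<le> measure \<Pi>\<mu> (A n)) \<F>"
    using eventually_S by eventually_elim (use A norm_approx_le in blast)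
  show "summable b" by (rule tendsto_suminf_dominated(1)[OF lim ev C]) simp
  have "((\<lambda>S. \<Sum>n. approx (A n) S) \<longlongrightarrow> (\<Sum>n. b n)) \<F>"
    by (rule tendsto_suminf_dominated(2)[OF lim ev C]) simp
  moreover have "eventually (\<lambda>S. (\<Sum>n. approx (A n) S) = approx (\<Union>n. A n) S) \<F>"
    using eventually_S
  proof eventually_elim
    case (elim S)
    have "(\<lambda>n. measure \<Pi>\<mu> (A n \<inter> atom_box S q)) sums measure \<Pi>\<mu> ((\<Union>n. A n) \<inter> atom_box S q)" for q
    proof -
      have "(\<lambda>n. measure \<Pi>\<mu> (A n \<inter> atom_box S q)) sums measure \<Pi>\<mu> (\<Union>n. A n \<inter> atom_box S q)"
        using A(1) A' atom_box_in_sets[of S q] elim sets_PiM_eq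
        by (intro P.finite_measure_UNION) (fastforce simp: disjoint_family_on_def)+
      thus ?thesis by simp
    qed
    hence "(\<lambda>n. approx (A n) S) sums approx (\<Union>n. A n) S"
      unfolding approx_def by (intro sums_sum sums_scaleR_left sums_divide) auto
    thus ?case by (rule sums_unique[symmetric])
  qed
  ultimately show "(approx (\<Union>n. A n) \<longlongrightarrow> (\<Sum>n. b n)) \<F>"
    by (rule Lim_transform_eventually)
qed

text \<open>On boxes the net is eventually constant, and convergence passes to complements and to
  countable disjoint unions; Dynkin induction then covers the whole sigma-algebra.\<close>

private lemma approx_convergent:
  assumes "E \<in> sets \<Pi>M"
  shows "\<exists>l. (approx E \<longlongrightarrow> l) \<F>"
  using finite_lessThan assms
proof (induction rule: sets_PiM_induct)
  case (box F)
  thus ?case using approx_box_tendsto[of F] by auto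
next
  case empty
  have "approx {} S = 0" for S by (simp add: approx_def)
  thus ?case by auto
next
  case (compl A)
  then obtain l where l: "(approx A \<longlongrightarrow> l) \<F>" by blast
  have "(approx (space \<Pi>M) \<longlongrightarrow> op_prod (\<lambda>i. \<phi> (space M)) k) \<F>"
    unfolding space_PiM by (rule approx_box_tendsto) auto
  hence "((\<lambda>S. approx (space \<Pi>M) S - approx A S) \<longlongrightarrow> op_prod (\<lambda>i. \<phi> (space M)) k - l) \<F>"
    using l by (rule tendsto_diff)
  moreover have "eventually (\<lambda>S. approx (space \<Pi>M) S - approx A S = approx (space \<Pi>M - A) S) \<F>"
    using eventually_S
  proof eventually_elim
    case (elim S)
    have "measure \<Pi>\<mu> ((space \<Pi>M - A) \<inter> atom_box S q) = measure \<Pi>\<mu> (space \<Pi>M \<inter> atom_box S q) - measure \<Pi>\<mu> (A \<inter> atom_box S q)" for q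
    proof -
      have "(space \<Pi>M - A) \<inter> atom_box S q = (space \<Pi>M \<inter> atom_box S q) - (A \<inter> atom_box S q)" by auto
      thus ?thesis
        using compl atom_box_in_sets[of S q] elim sets.sets_into_space[OF compl(1)]
        by (auto intro!: P.finite_measure_Diff simp: sets_PiM_eq)
    qed
    thus ?case unfolding approx_def
      by (simp add: sum_subtractf[symmetric] scaleR_diff_left[symmetric] diff_divide_distrib)
  qed
  ultimately show ?case using Lim_transform_eventually by blast
next
  case (union A)
  then obtain b where "\<And>n. (approx (A n) \<longlongrightarrow> b n) \<F>" by metis
  thus ?case using approx_union(2)[of A b] union by blast
qed

text \<open>The domination by the scalar product measure survives the limit. It is what later
  controls the part of the simplex near the diagonals.\<close>

lemma product_vm_exists:
  obtains \<nu> where "vector_measure \<Pi>M \<nu>"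
    "\<And>F. (\<And>i. i < k \<Longrightarrow> F i \<in> sets M) \<Longrightarrow> \<nu> (Pi\<^sub>E {..<k} F) = op_prod (\<lambda>i. \<phi> (F i)) k"
    "\<And>E. E \<in> sets \<Pi>M \<Longrightarrow> norm (\<nu> E) \<le> measure \<Pi>\<mu> E"
proof -
  define \<nu> where "\<nu> = (\<lambda>E. Lim \<F> (approx E))"
  have \<nu>eq: "\<nu> E = l" if "(approx E \<longlongrightarrow> l) \<F>" for E l
    unfolding \<nu>_def by (rule tendsto_Lim[OF _ that]) simp
  have lim: "(approx E \<longlongrightarrow> \<nu> E) \<F>" if "E \<in> sets \<Pi>M" for E
    using approx_convergent[OF that] \<nu>eq by auto
  have "vector_measure \<Pi>M \<nu>"
    unfolding vector_measure_def
  proof (intro allI impI)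
    fix A :: "nat \<Rightarrow> _" assume A: "range A \<subseteq> sets \<Pi>M \<and> disjoint_family A"
    have l: "(approx (A n) \<longlongrightarrow> \<nu> (A n)) \<F>" for n using A by (intro lim) auto
    have A': "disjoint_family A" "\<And>n. A n \<in> sets \<Pi>M" using A by auto
    from approx_union[OF A' l] show "(\<lambda>n. \<nu> (A n)) sums \<nu> (\<Union>n. A n)"
      by (simp add: \<nu>eq sums_iff)
  qed
  moreover have "\<nu> (Pi\<^sub>E {..<k} F) = op_prod (\<lambda>i. \<phi> (F i)) k" if "\<And>i. i < k \<Longrightarrow> F i \<in> sets M" for F
    by (rule \<nu>eq[OF approx_box_tendsto[OF that]])
  moreover have "norm (\<nu> E) \<le> measure \<Pi>\<mu> E" if "E \<in> sets \<Pi>M" for E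
  proof (rule tendsto_upperbound[OF tendsto_norm[OF lim[OF that]]])
    show "eventually (\<lambda>S. norm (approx E S) \<le> measure \<Pi>\<mu> E) \<F>"
      using eventually_S by eventually_elim (use that norm_approx_le in blast)
  qed simp
  ultimately show ?thesis using that by blast
qed

end

subsection \<open>Simplex integrals as limits of ordered products\<close>

text \<open>Noncommutative elementary symmetric polynomials: \<open>elem_sym B n k\<close> is the
  part of degree k of \<open>ordered_prod B n\<close>.\<close>

fun elem_sym :: "(nat \<Rightarrow> ('a::real_normed_vector \<Rightarrow>\<^sub>L 'a)) \<Rightarrow> nat \<Rightarrow> nat \<Rightarrow> ('a \<Rightarrow>\<^sub>L 'a)" where
  "elem_sym B n 0 = id_blinfun"
| "elem_sym B 0 (Suc k) = 0"
| "elem_sym B (Suc n) (Suc k) = elem_sym B n (Suc k) + (elem_sym B n k o\<^sub>L B n)"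

definition increasing_indices :: "nat \<Rightarrow> nat \<Rightarrow> (nat \<Rightarrow> nat) set" where
  "increasing_indices n k = {q \<in> {..<k} \<rightarrow>\<^sub>E {..<n}. \<forall>i j. i < j \<and> j < k \<longrightarrow> q i < q j}"

lemma finite_increasing_indices: "finite (increasing_indices n k)"
  by (rule finite_subset[OF _ finite_PiE[of "{..<k}" "\<lambda>_. {..<n}"]]) (auto simp: increasing_indices_def)

lemma increasing_indices_Suc:
  "increasing_indices (Suc n) (Suc k) = increasing_indices n (Suc k) \<union> (\<lambda>q. q(k := n)) ` increasing_indices n k"
proof (intro equalityI subsetI)
  fix q assume q: "q \<in> increasing_indices (Suc n) (Suc k)"
  have q1: "q i < Suc n" if "i < Suc k" for i using q that by (auto simp: increasing_indices_def PiE_iff)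
  have q2: "q i = undefined" if "\<not> i < Suc k" for i
    using q that by (auto simp: increasing_indices_def PiE_iff extensional_def)
  have q3: "q i < q j" if "i < j" "j < Suc k" for i j using q that by (auto simp: increasing_indices_def)
  show "q \<in> increasing_indices n (Suc k) \<union> (\<lambda>q. q(k := n)) ` increasing_indices n k"
  proof (cases "q k = n")
    case False
    have "q i < n" if "i < Suc k" for i
      using q1[of k] False q3[of i k] that by (cases "i = k") auto
    hence "q \<in> increasing_indices n (Suc k)"
      using q2 q3 by (auto simp: increasing_indices_def PiE_iff extensional_def)
    thus ?thesis by blast
  next
    case True
    define r where "r = restrict q {..<k}"
    have "r \<in> increasing_indices n k"
      using q3 True by (auto simp: increasing_indices_def PiE_iff r_def)
    moreover have "q = r(k := n)"
      using True q2 by (auto simp: r_def fun_eq_iff restrict_def)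
    ultimately show ?thesis by blast
  qed
next
  fix q assume "q \<in> increasing_indices n (Suc k) \<union> (\<lambda>q. q(k := n)) ` increasing_indices n k"
  thus "q \<in> increasing_indices (Suc n) (Suc k)"
    by (auto simp: increasing_indices_def PiE_iff extensional_def less_Suc_eq)
qed

lemma elem_sym_eq_sum:
  "elem_sym B n k = (\<Sum>q\<in>increasing_indices n k. op_prod (\<lambda>i. B (q i)) k)"
proof (induction B n k rule: elem_sym.induct)
  case (1 B n)
  have "increasing_indices n 0 = {\<lambda>_. undefined}" by (auto simp: increasing_indices_def)
  thus ?case by simp
next
  case (2 B k)
  have "increasing_indices 0 (Suc k) = {}" by (auto simp: increasing_indices_def PiE_iff)
  thus ?case by simp
next
  case (3 B n k)
  let ?f = "\<lambda>q. q(k := n)"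
  have ext: "q k = undefined" if "q \<in> increasing_indices n k" for q
    using that by (auto simp: increasing_indices_def PiE_iff extensional_def)
  have inj: "inj_on ?f (increasing_indices n k)"
  proof (rule inj_onI)
    fix q q' assume q: "q \<in> increasing_indices n k" "q' \<in> increasing_indices n k" "?f q = ?f q'"
    show "q = q'"
    proof
      fix i show "q i = q' i" using fun_cong[OF q(3), of i] ext[OF q(1)] ext[OF q(2)] by (cases "i = k") auto
    qed
  qed
  have "q k < n" if "q \<in> increasing_indices n (Suc k)" for q
    using that by (auto simp: increasing_indices_def PiE_iff)
  hence disj: "increasing_indices n (Suc k) \<inter> ?f ` increasing_indices n k = {}"
    by fastforce
  have "(\<Sum>q\<in>?f ` increasing_indices n k. op_prod (\<lambda>i. B (q i)) (Suc k))
      = (\<Sum>q\<in>increasing_indices n k. op_prod (\<lambda>i. B (q i)) k o\<^sub>L B n)"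
    unfolding sum.reindex[OF inj] o_def
  proof (intro sum.cong refl)
    fix q
    have "op_prod (\<lambda>i. B ((q(k := n)) i)) k = op_prod (\<lambda>i. B (q i)) k" by (rule op_prod_cong) auto
    thus "op_prod (\<lambda>i. B ((q(k := n)) i)) (Suc k) = op_prod (\<lambda>i. B (q i)) k o\<^sub>L B n" by simp
  qed
  thus ?case
    unfolding increasing_indices_Suc
    by (subst sum.union_disjoint) (use disj 3 in \<open>auto simp: finite_increasing_indices blinfun_compose.sum_left\<close>)
qed

lemma norm_elem_sym_le_binomial:
  assumes "\<And>i. i < n \<Longrightarrow> norm (B i) \<le> c"
  shows "norm (elem_sym B n k) \<le> real (n choose k) * c ^ k"
  using assms
proof (induction B n k rule: elem_sym.induct)
  case (1 B n)
  thus ?case by (simp add: norm_blinfun_id_le)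
next
  case (3 B n k)
  have c: "0 \<le> c" using order_trans[OF norm_ge_zero 3(3)[of n]] by simp
  have "norm (elem_sym B (Suc n) (Suc k)) \<le> norm (elem_sym B n (Suc k)) + norm (elem_sym B n k) * norm (B n)"
    using norm_triangle_ineq[of "elem_sym B n (Suc k)" "elem_sym B n k o\<^sub>L B n"]
      norm_blinfun_compose[of "elem_sym B n k" "B n"] by simp
  also have "\<dots> \<le> real (n choose Suc k) * c ^ Suc k + (real (n choose k) * c ^ k) * c"
    using 3 c by (intro add_mono mult_mono) auto
  also have "\<dots> = real (Suc n choose Suc k) * c ^ Suc k" by (simp add: algebra_simps)
  finally show ?case .
qed simp

text \<open>There are n choose k increasing words of length k, and n choose k is at most n^k / fact
  k. The bound is independent of n and so passes to the simplex integrals.\<close>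

lemma norm_elem_sym_le:
  assumes "\<And>i. i < n \<Longrightarrow> norm (B i) \<le> p / real n" and p: "0 \<le> p"
  shows "norm (elem_sym B n k) \<le> p ^ k / fact k"
proof (cases "n = 0")
  case True
  thus ?thesis using p by (cases k) (simp_all add: norm_blinfun_id_le)
next
  case False
  have "norm (elem_sym B n k) \<le> real (n choose k) * (p / real n) ^ k"
    by (rule norm_elem_sym_le_binomial) (rule assms)
  also have "\<dots> \<le> (real n ^ k / fact k) * (p / real n) ^ k"
  proof (rule mult_right_mono)
    have "real ((n choose k) * fact k) \<le> real (n ^ k)" using binomial_fact_pow[of n k] of_nat_mono by blast
    thus "real (n choose k) \<le> real n ^ k / fact k" by (simp add: field_simps)
  qed (use p in simp)
  also have "\<dots> = p ^ k / fact k" using False by (simp add: power_divide)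
  finally show ?thesis .
qed

section \<open>Consecutive pieces of equal variation\<close>

lemma (in finite_borel_measure) cdf_attains:
  assumes nonatomic: "\<And>x. measure M {x} = 0" and c: "0 < c" "c < measure M (space M)"
  obtains x where "cdf M x = c"
proof -
  have "eventually (\<lambda>x. cdf M x < c) at_bot" by (rule order_tendstoD(2)[OF cdf_lim_at_bot c(1)])
  then obtain a where a: "\<And>x. x \<le> a \<Longrightarrow> cdf M x < c" by (auto simp: eventually_at_bot_linorder)
  have "eventually (\<lambda>x. c < cdf M x) at_top" by (rule order_tendstoD(1)[OF cdf_lim_at_top c(2)])
  then obtain b where b: "\<And>x. b \<le> x \<Longrightarrow> c < cdf M x" by (auto simp: eventually_at_top_linorder)
  have "\<exists>x\<ge>min a b. x \<le> max a b \<and> cdf M x = c"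
    using a[of "min a b"] b[of "max a b"] nonatomic isCont_cdf
    by (intro IVT) auto
  thus ?thesis using that by blast
qed

text \<open>Pieces of equal mass make every increment at most the total mass divided by n, the
  uniform bound that the displacement estimate needs. Without point masses the distribution function
  is continuous and attains the quantiles.\<close>

lemma quantile_partition:
  fixes I :: "real set" and \<mu> :: "real measure"
  assumes fin: "finite_measure \<mu>" and sets_\<mu>: "sets \<mu> = sets (borel_on I)"
    and nonatomic: "\<And>x. x \<in> I \<Longrightarrow> measure \<mu> {x} = 0" and n: "0 < n"
  obtains Q where "\<And>j. Q j \<in> sets (borel_on I)" "\<And>j. j < n \<Longrightarrow> measure \<mu> (Q j) = measure \<mu> I / real n"
    "(\<Union>j<n. Q j) = I" "\<And>i j x y. i < j \<Longrightarrow> j < n \<Longrightarrow> x \<in> Q i \<Longrightarrow> y \<in> Q j \<Longrightarrow> x < y"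
proof -
  interpret finite_measure \<mu> by (rule fin)
  have sp: "space \<mu> = I" using sets_eq_imp_space_eq[OF sets_\<mu>] by (simp add: space_restrict_space)
  have meas: "(\<lambda>x. x) \<in> measurable \<mu> borel"
    unfolding measurable_cong_sets[OF sets_\<mu> refl] by (rule measurable_restrict_space1) simp
  define N where "N = distr \<mu> borel (\<lambda>x. x)"
  have mN: "measure N A = measure \<mu> (A \<inter> I)" if "A \<in> sets borel" for A
    unfolding N_def using that by (subst measure_distr[OF meas]) (auto simp: sp)
  have "emeasure N (space N) = emeasure \<mu> (space \<mu>)"
    unfolding N_def using meas by (subst emeasure_distr) auto
  hence "finite_measure N" by (intro finite_measureI) simp
  then interpret N: finite_borel_measure N
    by (simp add: finite_borel_measure_def finite_borel_measure_axioms_def N_def)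
  have spN: "space N = UNIV" by (simp add: N_def)
  define v where "v = measure \<mu> I"
  have vN: "measure N UNIV = v" using mN[of UNIV] by (simp add: v_def)
  have N0: "measure N {x} = 0" for x
  proof (cases "x \<in> I")
    case True
    hence "{x} \<inter> I = {x}" by auto
    thus ?thesis using mN[of "{x}"] nonatomic[OF True] by simp
  qed (simp add: mN)
  obtain c where c: "\<And>j. 0 < j \<Longrightarrow> j < n \<Longrightarrow> cdf N (c j) = real j * v / real n"
    and c_mono: "\<And>i j. 0 < i \<Longrightarrow> i \<le> j \<Longrightarrow> j < n \<Longrightarrow> c i \<le> c j"
  \<comment> \<open>A null measure has a constant distribution function, and any cut points will
    do.\<close>
  proof (cases "v = 0")
    case True
    have "cdf N 0 \<le> measure N UNIV" unfolding cdf_def by (intro N.finite_measure_mono) (auto simp: N_def)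
    hence "cdf N 0 = 0" using True vN N.cdf_nonneg[of 0] by simp
    thus ?thesis using that[of "\<lambda>_. 0"] True by simp
  next
    case False
    hence v: "v > 0" using measure_nonneg[of \<mu> I] by (simp add: v_def less_le)
    have "\<exists>x. 0 < j \<longrightarrow> j < n \<longrightarrow> cdf N x = real j * v / real n" for j
    proof (cases "0 < j \<and> j < n")
      case True
      show ?thesis
        by (rule N.cdf_attains[of "real j * v / real n"])
           (use N0 v True vN spN n in \<open>auto simp: field_simps\<close>)
    qed auto
    then obtain c where c: "\<And>j. 0 < j \<Longrightarrow> j < n \<Longrightarrow> cdf N (c j) = real j * v / real n" by metis
    have "c i \<le> c j" if ij: "0 < i" "i \<le> j" "j < n" for i j
    proof (rule ccontr)
      assume *: "\<not> c i \<le> c j"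
      hence "cdf N (c j) \<le> cdf N (c i)" by (intro N.cdf_nondecreasing) auto
      hence "real j * v / real n \<le> real i * v / real n" using c[of i] c[of j] ij by auto
      hence "j \<le> i" using v n by (simp add: divide_le_cancel)
      thus False using ij * by auto
    qed
    thus ?thesis using that c by blast
  qed
  \<comment> \<open>The outermost sets are {} and UNIV rather than half-lines, since the levels 0
    and v need not be attained by the distribution function.\<close>
  define D where "D = (\<lambda>j. if j = 0 then {} else if j < n then {..c j} else UNIV)"
  have D_sets: "D j \<in> sets borel" for j by (simp add: D_def)
  have D_mono: "D i \<subseteq> D j" if "i \<le> j" for i j
    using that c_mono[of i j] by (auto simp: D_def split: if_splits)
  have D_measure: "measure N (D j) = real j * v / real n" if "j \<le> n" for j
    using that c[of j] vN n by (cases "j = 0"; cases "j < n") (auto simp: D_def cdf_def)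
  define Q where "Q = (\<lambda>j. (D (Suc j) - D j) \<inter> I)"
  show ?thesis
  proof (rule that[of Q])
    show "Q j \<in> sets (borel_on I)" for j
      unfolding sets_restrict_space Q_def using D_sets by (auto intro!: image_eqI[of _ _ "D (Suc j) - D j"])
    fix j assume j: "j < n"
    have "measure \<mu> (Q j) = measure N (D (Suc j) - D j)"
      unfolding Q_def using D_sets by (intro mN[symmetric]) auto
    also have "\<dots> = measure N (D (Suc j)) - measure N (D j)"
      using D_sets D_mono[of j "Suc j"] by (intro N.finite_measure_Diff) (auto simp: N_def)
    also have "\<dots> = v / real n" using j by (simp add: D_measure field_simps)
    finally show "measure \<mu> (Q j) = measure \<mu> I / real n" by (simp add: v_def)
  next
    show "(\<Union>j<n. Q j) = I"
    proof
      show "I \<subseteq> (\<Union>j<n. Q j)"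
      proof
        fix x assume x: "x \<in> I"
        have "x \<notin> D 0" "x \<in> D n" using n by (auto simp: D_def)
        then obtain j where "j < n" "x \<notin> D j" "x \<in> D (Suc j)"
          using ex_least_nat_less[of "\<lambda>j. x \<in> D j" n] by auto
        thus "x \<in> (\<Union>j<n. Q j)" using x by (auto simp: Q_def)
      qed
    qed (auto simp: Q_def)
  next
    fix i j x y assume ij: "i < j" "j < n" "x \<in> Q i" "y \<in> Q j"
    have "x \<in> D j" using ij D_mono[of "Suc i" j] by (auto simp: Q_def)
    moreover have "y \<notin> D j" using ij by (simp add: Q_def)
    ultimately show "x < y" using ij by (auto simp: D_def split: if_splits)
  qed
qed

lemma time_simplex_sets: "time_simplex I k \<in> sets (PiM {..<k} (\<lambda>_. borel_on I))"
proof -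
  let ?M = "PiM {..<k} (\<lambda>_. borel_on I)"
  have c: "(\<lambda>t. t i) \<in> borel_measurable ?M" if "i < k" for i
  proof -
    have "(\<lambda>t. t i) \<in> measurable ?M (borel_on I)"
      using that by (intro measurable_component_singleton) auto
    moreover have "(\<lambda>x. x) \<in> measurable (borel_on I) borel" by (rule measurable_restrict_space1) simp
    ultimately have "(\<lambda>x. x) \<circ> (\<lambda>t. t i) \<in> borel_measurable ?M" by (rule measurable_comp)
    thus ?thesis by (simp add: o_def)
  qed
  have "time_simplex I k = {t \<in> space ?M. \<forall>j\<in>{..<k}. \<forall>i\<in>{..j}. t i \<le> t j}"
    by (auto simp: time_simplex_def space_PiM space_restrict_space)
  also have "\<dots> \<in> sets ?M"
    by (intro sets.sets_Collect_finite_All' finite_lessThan finite_atMost borel_measurable_le c sets.sets_Collect_finite_All) auto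
  finally show ?thesis .
qed

lemma is_product_vm_iff:
  "is_product_vm I \<phi> k \<nu> \<longleftrightarrow> vector_measure (PiM {..<k} (\<lambda>_. borel_on I)) \<nu> \<and>
     (\<forall>E. (\<forall>i<k. E i \<in> sets (borel_on I)) \<longrightarrow> \<nu> (Pi\<^sub>E {..<k} E) = op_prod (\<lambda>i. \<phi> (E i)) k)"
  unfolding is_product_vm_def op_prod_eq_foldr ..

text \<open>Scaling \<phi> by t scales its k-fold product by t^k, so one product measure evaluates
  the definite description for all t at once, as the power series in t requires.\<close>

lemma simplex_integral_scaleR:
  assumes "is_product_vm I \<phi> k \<nu>"
  shows "simplex_integral I (\<lambda>E. t *\<^sub>R \<phi> E) k = t ^ k *\<^sub>R \<nu> (time_simplex I k)"
  unfolding simplex_integral_def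
proof (rule the_equality)
  have s: "is_product_vm I (\<lambda>E. t *\<^sub>R \<phi> E) k (\<lambda>E. t ^ k *\<^sub>R \<nu> E)"
    using assms by (auto simp: is_product_vm_iff op_prod_scaleR intro!: vector_measure_scaleR)
  thus "\<exists>\<nu>'. is_product_vm I (\<lambda>E. t *\<^sub>R \<phi> E) k \<nu>' \<and> t ^ k *\<^sub>R \<nu> (time_simplex I k) = \<nu>' (time_simplex I k)"
    by blast
  fix L assume "\<exists>\<nu>'. is_product_vm I (\<lambda>E. t *\<^sub>R \<phi> E) k \<nu>' \<and> L = \<nu>' (time_simplex I k)"
  then obtain \<nu>' where \<nu>': "is_product_vm I (\<lambda>E. t *\<^sub>R \<phi> E) k \<nu>'" "L = \<nu>' (time_simplex I k)" by blast
  have "\<nu>' (time_simplex I k) = t ^ k *\<^sub>R \<nu> (time_simplex I k)"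
    by (rule product_vm_unique[OF _ _ finite_lessThan _ time_simplex_sets])
       (use s \<nu>' in \<open>auto simp: is_product_vm_iff\<close>)
  thus "L = t ^ k *\<^sub>R \<nu> (time_simplex I k)" using \<nu>' by simp
qed

text \<open>\<open>elem_sym\<close> is the exact value of \<nu> on the union \<open>U\<close> of the
  cells with strictly increasing indices. The rest of the simplex is covered by at most k^2 n boxes,
  each of mass v^k / n^2.\<close>

lemma norm_simplex_diff_elem_sym_le:
  fixes I :: "real set" and \<phi> :: "real set \<Rightarrow> ('a::banach \<Rightarrow>\<^sub>L 'a)"
  assumes fin: "finite_measure \<mu>" and sets_\<mu>: "sets \<mu> = sets (borel_on I)"
    and \<nu>: "is_product_vm I \<phi> k \<nu>"
    and \<nu>_le: "\<And>E. E \<in> sets (PiM {..<k} (\<lambda>_. borel_on I)) \<Longrightarrow> norm (\<nu> E) \<le> measure (PiM {..<k} (\<lambda>_. \<mu>)) E"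
    and n: "0 < n"
    and Q: "\<And>j. Q j \<in> sets (borel_on I)" "\<And>j. j < n \<Longrightarrow> measure \<mu> (Q j) = measure \<mu> I / real n"
      "(\<Union>j<n. Q j) = I" "\<And>i j x y. i < j \<Longrightarrow> j < n \<Longrightarrow> x \<in> Q i \<Longrightarrow> y \<in> Q j \<Longrightarrow> x < y"
  shows "norm (\<nu> (time_simplex I k) - elem_sym (\<lambda>j. \<phi> (Q j)) n k) \<le> real k * real k * measure \<mu> I ^ k / real n"
proof -
  let ?M = "PiM {..<k} (\<lambda>_. borel_on I)" and ?N = "PiM {..<k} (\<lambda>_. \<mu>)"
  define v where "v = measure \<mu> I"
  have setsN: "sets ?N = sets ?M" by (intro sets_PiM_cong refl sets_\<mu>)
  have I: "I \<in> sets (borel_on I)" using sets.top[of "borel_on I"] by (simp add: space_restrict_space)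
  have vm: "vector_measure ?M \<nu>"
    and box: "\<And>E. (\<And>i. i < k \<Longrightarrow> E i \<in> sets (borel_on I)) \<Longrightarrow> \<nu> (Pi\<^sub>E {..<k} E) = op_prod (\<lambda>i. \<phi> (E i)) k"
    using \<nu> by (auto simp: is_product_vm_iff)
  have mbox: "measure ?N (Pi\<^sub>E {..<k} F) = (\<Prod>i<k. measure \<mu> (F i))"
    if "\<And>i. i < k \<Longrightarrow> F i \<in> sets (borel_on I)" for F
    by (rule measure_PiM_box[OF fin]) (use that sets_\<mu> in auto)
  interpret N: finite_measure ?N by (rule finite_measure_PiM[OF fin])
  define cell where "cell = (\<lambda>q. Pi\<^sub>E {..<k} (\<lambda>i. Q (q i)))"
  define U where "U = (\<Union>q\<in>increasing_indices n k. cell q)"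
  have cell_sets: "cell q \<in> sets ?M" for q
    unfolding cell_def using Q(1) by (intro sets_PiM_I_finite) auto
  have QI: "Q j \<subseteq> I" for j using Q(1)[of j] by (auto simp: sets_restrict_space)
  have Q_disj: "Q i \<inter> Q j = {}" if "i < n" "j < n" "i \<noteq> j" for i j
    using Q(4)[of i j] Q(4)[of j i] that by (cases i j rule: linorder_cases) force+
  have cell_disj: "disjoint_family_on cell (increasing_indices n k)"
    unfolding disjoint_family_on_def
  proof (intro ballI impI)
    fix q q' assume q: "q \<in> increasing_indices n k" "q' \<in> increasing_indices n k" "q \<noteq> q'"
    have ext: "q \<in> {..<k} \<rightarrow>\<^sub>E {..<n}" "q' \<in> {..<k} \<rightarrow>\<^sub>E {..<n}" using q by (auto simp: increasing_indices_def)
    then obtain i where i: "i < k" "q i \<noteq> q' i" using q(3) by (metis PiE_ext lessThan_iff)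
    have "Q (q i) \<inter> Q (q' i) = {}" using ext i by (intro Q_disj) (auto simp: PiE_iff)
    thus "cell q \<inter> cell q' = {}" using i by (auto simp: cell_def PiE_iff)
  qed
  have U_sets: "U \<in> sets ?M"
    unfolding U_def using finite_increasing_indices cell_sets by (intro sets.finite_UN) auto
  have "\<nu> U = (\<Sum>q\<in>increasing_indices n k. \<nu> (cell q))"
    unfolding U_def by (rule vector_measure_UN[OF vm finite_increasing_indices cell_sets cell_disj])
  also have "\<dots> = elem_sym (\<lambda>j. \<phi> (Q j)) n k"
    unfolding elem_sym_eq_sum cell_def using Q(1) by (intro sum.cong refl box)
  finally have \<nu>U: "\<nu> U = elem_sym (\<lambda>j. \<phi> (Q j)) n k" .
  have U_sub: "U \<subseteq> time_simplex I k"
  proof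
    fix t assume "t \<in> U"
    then obtain q where q: "q \<in> increasing_indices n k" "t \<in> cell q" by (auto simp: U_def)
    have tq: "t i \<in> Q (q i)" "q i < n" if "i < k" for i
      using q that by (auto simp: cell_def PiE_iff increasing_indices_def)
    have "t i \<le> t j" if "i \<le> j" "j < k" for i j
    proof (cases "i = j")
      case False
      hence "q i < q j" using q(1) that by (auto simp: increasing_indices_def)
      hence "t i < t j" using Q(4)[of "q i" "q j" "t i" "t j"] tq[of i] tq[of j] that by auto
      thus ?thesis by simp
    qed simp
    moreover have "t \<in> Pi\<^sub>E {..<k} (\<lambda>_. I)" using q(2) QI unfolding cell_def by (auto simp: PiE_iff)
    ultimately show "t \<in> time_simplex I k" by (auto simp: time_simplex_def)
  qed
  \<comment> \<open>Outside \<open>U\<close> two coordinates fall into the same \<open>Q j\<close>.\<close>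
  define diag where "diag = (\<lambda>(a, b, j). Pi\<^sub>E {..<k} (\<lambda>i. if i \<in> {a, b} then Q j else I))"
  define T where "T = {(a, b, j). a < b \<and> b < k \<and> j < n}"
  have T_sub: "T \<subseteq> {..<k} \<times> {..<k} \<times> {..<n}" by (auto simp: T_def)
  hence finT: "finite T" by (rule finite_subset) auto
  have cover: "time_simplex I k - U \<subseteq> (\<Union>x\<in>T. diag x)"
  proof
    fix t assume t: "t \<in> time_simplex I k - U"
    have tI: "t i \<in> I" if "i < k" for i using t that by (auto simp: time_simplex_def PiE_iff)
    have "\<forall>i. \<exists>j. i < k \<longrightarrow> j < n \<and> t i \<in> Q j" using tI Q(3) by blast
    then obtain r where r: "\<And>i. i < k \<Longrightarrow> r i < n \<and> t i \<in> Q (r i)" by metis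
    have "\<exists>a b. a < b \<and> b < k \<and> \<not> r a < r b"
    proof (rule ccontr)
      assume "\<not> ?thesis"
      hence "restrict r {..<k} \<in> increasing_indices n k"
        using r by (auto simp: increasing_indices_def)
      moreover have "t \<in> cell (restrict r {..<k})"
        using r t by (auto simp: cell_def time_simplex_def PiE_iff)
      ultimately show False using t by (auto simp: U_def)
    qed
    then obtain a b where ab: "a < b" "b < k" "\<not> r a < r b" by blast
    have "\<not> r b < r a"
    proof
      assume "r b < r a"
      hence "t b < t a" using Q(4)[of "r b" "r a" "t b" "t a"] r[of a] r[of b] ab by auto
      moreover have "t a \<le> t b" using t ab by (auto simp: time_simplex_def)
      ultimately show False by simp
    qed
    hence eq: "r a = r b" using ab by simp
    have "t \<in> diag (a, b, r b)"
      using t r[of a] r[of b] ab eq by (auto simp: diag_def time_simplex_def PiE_iff)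
    moreover have "(a, b, r b) \<in> T" using ab r by (auto simp: T_def)
    ultimately show "t \<in> (\<Union>x\<in>T. diag x)" by blast
  qed
  have diag_sets: "diag x \<in> sets ?N" for x
    unfolding setsN diag_def using Q(1) I by (cases x) (auto intro!: sets_PiM_I_finite)
  have diag_measure: "measure ?N (diag x) = v ^ k / (real n)\<^sup>2" if "x \<in> T" for x
  proof -
    obtain a b j where x: "x = (a, b, j)" "a < b" "b < k" "j < n" using \<open>x \<in> T\<close> by (auto simp: T_def)
    have "measure ?N (diag x) = (\<Prod>i<k. measure \<mu> (if i \<in> {a, b} then Q j else I))"
      unfolding diag_def x(1) prod.case by (rule mbox) (use Q(1) I in auto)
    also have "\<dots> = (\<Prod>i<k. v * (if i \<in> {a, b} then 1 / real n else 1))"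
      using Q(2)[OF x(4)] by (intro prod.cong) (auto simp: v_def)
    also have "\<dots> = v ^ k * (\<Prod>i\<in>{..<k} \<inter> {a, b}. 1 / real n)"
      unfolding prod.distrib prod.inter_restrict[OF finite_lessThan] by simp
    also have "{..<k} \<inter> {a, b} = {a, b}" using x by auto
    finally show ?thesis using x by (simp add: power2_eq_square)
  qed
  have "norm (\<nu> (time_simplex I k) - elem_sym (\<lambda>j. \<phi> (Q j)) n k) = norm (\<nu> (time_simplex I k - U))"
    by (simp add: vector_measure_Diff[OF vm time_simplex_sets U_sets U_sub] \<nu>U)
  also have "\<dots> \<le> measure ?N (time_simplex I k - U)"
    using U_sets time_simplex_sets by (intro \<nu>_le) auto
  also have "\<dots> \<le> measure ?N (\<Union>x\<in>T. diag x)"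
    using cover finT diag_sets by (intro N.finite_measure_mono) auto
  also have "\<dots> \<le> (\<Sum>x\<in>T. measure ?N (diag x))"
    using finT diag_sets by (intro N.finite_measure_subadditive_finite) auto
  also have "\<dots> = real (card T) * (v ^ k / (real n)\<^sup>2)" by (simp add: diag_measure)
  also have "\<dots> \<le> real (k * k * n) * (v ^ k / (real n)\<^sup>2)"
  proof (rule mult_right_mono)
    have "card T \<le> card ({..<k} \<times> {..<k} \<times> {..<n})" using T_sub by (intro card_mono) auto
    also have "\<dots> = k * k * n" by (simp add: card_cartesian_product)
    finally show "real (card T) \<le> real (k * k * n)" by (rule of_nat_mono)
  qed (simp add: v_def)
  also have "\<dots> = real k * real k * v ^ k / real n" using n by (simp add: power2_eq_square)
  finally show ?thesis by (simp add: v_def)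
qed

theorem ordered_measure_approximation:
  fixes I :: "real set" and \<phi> :: "real set \<Rightarrow> ('a::banach \<Rightarrow>\<^sub>L 'a)"
  assumes \<phi>: "ordered_measure I \<phi>"
  defines "p \<equiv> total_variation (borel_on I) \<phi>"
  obtains e B where "\<And>t k. simplex_integral I (\<lambda>E. t *\<^sub>R \<phi> E) k = t ^ k *\<^sub>R e k"
    "\<And>n i. i < n \<Longrightarrow> norm (B n i) \<le> p / real n"
    "\<And>k. (\<lambda>n. elem_sym (B n) n k) \<longlonglongrightarrow> e k" "0 \<le> p"
proof -
  let ?M = "borel_on I"
  have vm: "vector_measure ?M \<phi>" and atomless: "\<nexists>E. vm_atom ?M \<phi> E"
    and bdd: "bdd_above (variation_sums ?M \<phi>)" using \<phi> by (auto simp: ordered_measure_def)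
  have spM: "space ?M = I" by (simp add: space_restrict_space)
  have I: "I \<in> sets ?M" using sets.top[of ?M] by (simp add: spM)
  define \<mu> where "\<mu> = variation_measure ?M \<phi>"
  have sets_\<mu>: "sets \<mu> = sets ?M" by (simp add: \<mu>_def)
  \<comment> \<open>If I is empty, the one-piece partition has to be {}, since a partition has no
    empty member.\<close>
  have "(\<Sum>E\<in>{I} - {{}}. norm (\<phi> E)) \<in> variation_sums ?M \<phi>"
    unfolding variation_sums_def spM using I
    by (intro CollectI exI[of _ "{I} - {{}}"]) (auto simp: partition_on_def disjoint_def)
  hence "(\<Sum>E\<in>{I} - {{}}. norm (\<phi> E)) \<le> p" unfolding p_def total_variation_def
    using bdd by (rule cSup_upper)
  moreover have "0 \<le> (\<Sum>E\<in>{I} - {{}}. norm (\<phi> E))" by (simp add: sum_nonneg)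
  ultimately have p: "0 \<le> p" by linarith
  have le_p: "emeasure \<mu> I \<le> ennreal p"
    using emeasure_variation_measure_space_le[OF vm bdd] by (simp add: \<mu>_def spM p_def)
  have fin: "finite_measure \<mu>"
  proof (rule finite_measureI)
    have "emeasure \<mu> (space \<mu>) \<le> ennreal p" using le_p by (simp add: \<mu>_def spM)
    thus "emeasure \<mu> (space \<mu>) \<noteq> \<infinity>" by (auto simp: top_unique)
  qed
  interpret finite_measure \<mu> by (rule fin)
  have v_le: "measure \<mu> I \<le> p" using le_p p by (simp add: emeasure_eq_measure)
  have \<phi>_le: "norm (\<phi> E) \<le> measure \<mu> E" if "E \<in> sets ?M" for E
  proof -
    have "ennreal (norm (\<phi> E)) \<le> emeasure \<mu> E"
      unfolding \<mu>_def emeasure_variation_measure[OF vm that] by (rule norm_le_variation_on[OF that])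
    thus ?thesis by (simp add: emeasure_eq_measure)
  qed
  have nonatomic: "measure \<mu> {x} = 0" if "x \<in> I" for x
  proof -
    have "{x} \<in> sets ?M" using that by (auto simp: sets_restrict_space intro!: image_eqI[of _ _ "{x}"])
    from variation_measure_singleton[OF vm atomless this] show ?thesis by (simp add: \<mu>_def measure_def)
  qed
  have "\<exists>\<nu>. is_product_vm I \<phi> k \<nu> \<and>
      (\<forall>E\<in>sets (PiM {..<k} (\<lambda>_. ?M)). norm (\<nu> E) \<le> measure (PiM {..<k} (\<lambda>_. \<mu>)) E)" for k
  proof (rule product_vm_exists[OF vm fin sets_\<mu> \<phi>_le, of k])
    fix \<nu>
    assume "vector_measure (PiM {..<k} (\<lambda>_. ?M)) \<nu>"
      "\<And>F. (\<And>i. i < k \<Longrightarrow> F i \<in> sets ?M) \<Longrightarrow> \<nu> (Pi\<^sub>E {..<k} F) = op_prod (\<lambda>i. \<phi> (F i)) k"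
      "\<And>E. E \<in> sets (PiM {..<k} (\<lambda>_. ?M)) \<Longrightarrow> norm (\<nu> E) \<le> measure (PiM {..<k} (\<lambda>_. \<mu>)) E"
    thus ?thesis unfolding is_product_vm_iff by (intro exI[of _ \<nu>]) blast
  qed
  then obtain \<nu> where \<nu>: "\<And>k. is_product_vm I \<phi> k (\<nu> k)"
    "\<And>k E. E \<in> sets (PiM {..<k} (\<lambda>_. ?M)) \<Longrightarrow> norm (\<nu> k E) \<le> measure (PiM {..<k} (\<lambda>_. \<mu>)) E"
    by metis
  define good where "good = (\<lambda>n Q. (\<forall>j. Q j \<in> sets ?M) \<and> (\<forall>j<n. measure \<mu> (Q j) = measure \<mu> I / real n) \<and>
    (\<Union>j<n. Q j) = I \<and> (\<forall>i j x y. i < j \<longrightarrow> j < n \<longrightarrow> x \<in> Q i \<longrightarrow> y \<in> Q j \<longrightarrow> x < y))"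
  have "\<exists>Q. 0 < n \<longrightarrow> good n Q" for n
  proof (cases "0 < n")
    case True
    from quantile_partition[OF fin sets_\<mu> nonatomic True] obtain Q
      where "\<And>j. Q j \<in> sets (borel_on I)" "\<And>j. j < n \<Longrightarrow> measure \<mu> (Q j) = measure \<mu> I / real n"
        "(\<Union>j<n. Q j) = I" "\<And>i j x y. i < j \<Longrightarrow> j < n \<Longrightarrow> x \<in> Q i \<Longrightarrow> y \<in> Q j \<Longrightarrow> x < y"
      by metis
    hence "good n Q" unfolding good_def by blast
    thus ?thesis by blast
  qed auto
  then obtain Q where Q: "\<And>n. 0 < n \<Longrightarrow> good n (Q n)" by metis
  define e where "e = (\<lambda>k. \<nu> k (time_simplex I k))"
  define B where "B = (\<lambda>n i. \<phi> (Q n i))"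
  show ?thesis
  proof (rule that[of e B])
    show "simplex_integral I (\<lambda>E. t *\<^sub>R \<phi> E) k = t ^ k *\<^sub>R e k" for t k
      unfolding e_def by (rule simplex_integral_scaleR[OF \<nu>(1)])
    show "norm (B n i) \<le> p / real n" if "i < n" for n i
    proof -
      have "good n (Q n)" using that by (intro Q) auto
      hence "norm (B n i) \<le> measure \<mu> I / real n" using \<phi>_le[of "Q n i"] that by (simp add: good_def B_def)
      also have "\<dots> \<le> p / real n" using v_le by (intro divide_right_mono) auto
      finally show ?thesis .
    qed
    show "(\<lambda>n. elem_sym (B n) n k) \<longlonglongrightarrow> e k" for k
    proof -
      have "(\<lambda>n. elem_sym (B n) n k - e k) \<longlonglongrightarrow> 0"
      proof (rule Lim_null_comparison)
        show "eventually (\<lambda>n. norm (elem_sym (B n) n k - e k) \<le> real k * real k * measure \<mu> I ^ k / real n) sequentially"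
          using eventually_gt_at_top[of 0]
        proof eventually_elim
          case (elim n)
          have g: "good n (Q n)" using elim by (rule Q)
          have "norm (e k - elem_sym (B n) n k) \<le> real k * real k * measure \<mu> I ^ k / real n"
            unfolding e_def B_def
            by (rule norm_simplex_diff_elem_sym_le[OF fin sets_\<mu> \<nu>(1) \<nu>(2) elim]) (use g in \<open>auto simp: good_def\<close>)
          thus ?case by (simp add: norm_minus_commute)
        qed
        show "(\<lambda>n. real k * real k * measure \<mu> I ^ k / real n) \<longlonglongrightarrow> 0" by (rule lim_const_over_n)
      qed
      thus ?thesis by (simp add: LIM_zero_iff)
    qed
  qed (rule p)
qed

subsection \<open>Resolvents and their power series\<close>

lemma blinfun_compose_distribs:
  "(A + B) o\<^sub>L C = (A o\<^sub>L C) + (B o\<^sub>L C)" "A o\<^sub>L (B + C) = (A o\<^sub>L B) + (A o\<^sub>L C)"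
  "(A - B) o\<^sub>L C = (A o\<^sub>L C) - (B o\<^sub>L C)" "A o\<^sub>L (B - C) = (A o\<^sub>L B) - (A o\<^sub>L C)"
  "(s *\<^sub>R A) o\<^sub>L B = s *\<^sub>R (A o\<^sub>L B)" "A o\<^sub>L (s *\<^sub>R B) = s *\<^sub>R (A o\<^sub>L B)"
  by (rule blinfun_compose.add_left blinfun_compose.add_right blinfun_compose.diff_left
      blinfun_compose.diff_right blinfun_compose.scaleR_left blinfun_compose.scaleR_right)+

lemma left_inverse_eq_right_inverse:
  fixes M :: "'b::real_normed_vector \<Rightarrow>\<^sub>L 'b"
  assumes "L o\<^sub>L M = id_blinfun" "M o\<^sub>L R = id_blinfun"
  shows "L = R"
proof -
  have "L o\<^sub>L (M o\<^sub>L R) = (L o\<^sub>L M) o\<^sub>L R" by simp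
  thus ?thesis unfolding assms by simp
qed

lemma op_inv_eq:
  assumes "A o\<^sub>L B = id_blinfun" "B o\<^sub>L A = id_blinfun"
  shows "op_inv A = B"
  unfolding op_inv_def
proof (rule the_equality)
  fix C assume "A o\<^sub>L C = id_blinfun \<and> C o\<^sub>L A = id_blinfun"
  thus "C = B" using left_inverse_eq_right_inverse[of C A B] assms by simp
qed (use assms in simp)

lemma left_inverse_of_injective:
  fixes M :: "'b::real_normed_vector \<Rightarrow>\<^sub>L 'b"
  assumes R: "M o\<^sub>L R = id_blinfun" and inj: "\<And>x. norm x \<le> K * norm (M x)"
  shows "R o\<^sub>L M = id_blinfun"
proof (rule blinfun_eqI)
  fix x
  have MR: "M (R y) = y" for y using arg_cong[OF R, of "\<lambda>T. T y"] by simp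
  have "norm (R (M x) - x) \<le> K * norm (M (R (M x) - x))" by (rule inj)
  also have "M (R (M x) - x) = 0" by (simp add: blinfun.diff_right MR)
  finally show "(R o\<^sub>L M) x = id_blinfun x" by simp
qed

lemma norm_inverse_le:
  fixes M :: "'b::real_normed_vector \<Rightarrow>\<^sub>L 'b"
  assumes R: "M o\<^sub>L R = id_blinfun" and inj: "\<And>x. norm x \<le> K * norm (M x)" and K: "0 \<le> K"
  shows "norm R \<le> K"
proof (rule norm_blinfun_bound[OF K])
  fix x
  have "M (R x) = x" using arg_cong[OF R, of "\<lambda>T. T x"] by simp
  thus "norm (R x) \<le> K * norm x" using inj[of "R x"] by simp
qed

text \<open>A Neumann series in fixed-point form: Z = R (1 - (M' - M) Z) implies M Z = 1 - (M' - M)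
  Z, that is M' Z = 1. Smallness makes the map a contraction.\<close>

lemma right_inverse_perturbation:
  fixes M M' :: "'b::banach \<Rightarrow>\<^sub>L 'b"
  assumes M: "M o\<^sub>L R = id_blinfun" and R: "norm R \<le> K" and small: "K * norm (M' - M) < 1"
  obtains R' where "M' o\<^sub>L R' = id_blinfun"
proof -
  let ?f = "\<lambda>Z. R o\<^sub>L (id_blinfun - ((M' - M) o\<^sub>L Z))"
  have K: "0 \<le> K" using norm_ge_zero R by (rule order_trans)
  have "\<exists>!Z. ?f Z = Z"
  proof (rule banach_fix_type[of "K * norm (M' - M)"])
    show "0 \<le> K * norm (M' - M)" using K by simp
    show "K * norm (M' - M) < 1" by (rule small)
    show "\<forall>Y Z. dist (?f Y) (?f Z) \<le> K * norm (M' - M) * dist Y Z"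
    proof (intro allI)
      fix Y Z :: "'b \<Rightarrow>\<^sub>L 'b"
      have "?f Y - ?f Z = R o\<^sub>L ((M' - M) o\<^sub>L (Z - Y))"
        by (simp add: blinfun_compose_distribs algebra_simps)
      hence "dist (?f Y) (?f Z) = norm (R o\<^sub>L ((M' - M) o\<^sub>L (Z - Y)))" by (simp add: dist_norm)
      also have "\<dots> \<le> norm R * norm ((M' - M) o\<^sub>L (Z - Y))" by (rule norm_blinfun_compose)
      also have "\<dots> \<le> K * (norm (M' - M) * norm (Z - Y))"
        using R K by (intro mult_mono norm_blinfun_compose) auto
      finally show "dist (?f Y) (?f Z) \<le> K * norm (M' - M) * dist Y Z"
        by (simp add: dist_norm norm_minus_commute mult.assoc)
    qed
  qed
  then obtain Z where Z: "?f Z = Z" by blast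
  have "M o\<^sub>L ?f Z = (M o\<^sub>L R) o\<^sub>L (id_blinfun - ((M' - M) o\<^sub>L Z))" by simp
  hence "M o\<^sub>L Z = id_blinfun - ((M' - M) o\<^sub>L Z)" unfolding M Z by simp
  hence "M' o\<^sub>L Z = id_blinfun" by (simp add: blinfun_compose_distribs algebra_simps)
  thus ?thesis by (rule that)
qed

text \<open>The method of continuity: the lower bound, uniform in s, bounds every right inverse by 1
  + C, so existence can be carried from s = 0 by steps of a fixed size. Injectivity then makes the
  right inverse two-sided.\<close>

lemma resolvent_exists:
  fixes D :: "'b::banach \<Rightarrow>\<^sub>L 'b"
  assumes le: "\<And>s x. s \<in> {0..1} \<Longrightarrow> norm (D x) \<le> C * norm (x + s *\<^sub>R D x)" and C: "0 \<le> C"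
    and s: "s \<in> {0..1::real}"
  obtains R where "(id_blinfun + s *\<^sub>R D) o\<^sub>L R = id_blinfun" "R o\<^sub>L (id_blinfun + s *\<^sub>R D) = id_blinfun"
    "norm R \<le> 1 + C"
proof -
  let ?M = "\<lambda>s. id_blinfun + s *\<^sub>R D"
  have inj: "norm x \<le> (1 + C) * norm (?M s x)" if "s \<in> {0..1}" for s x
  proof -
    let ?y = "x + s *\<^sub>R D x"
    have "norm x = norm (?y - s *\<^sub>R D x)" by simp
    also have "\<dots> \<le> norm ?y + norm (s *\<^sub>R D x)" by (rule norm_triangle_ineq4)
    also have "norm (s *\<^sub>R D x) \<le> 1 * norm (D x)" using that by (simp add: mult_left_le_one_le)
    also have "norm (D x) \<le> C * norm ?y" by (rule le[OF that])
    finally show ?thesis by (simp add: blinfun.add_left blinfun.scaleR_left algebra_simps)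
  qed
  \<comment> \<open>Each of the N steps changes the operator by at most norm D / N, which is within
    reach of the perturbation lemma.\<close>
  obtain N :: nat where N: "(1 + C) * norm D < real N" using reals_Archimedean2 by blast
  have N0: "0 < real N" using N C by (smt (verit) mult_nonneg_nonneg norm_ge_zero)
  have step: "j \<le> N \<Longrightarrow> \<exists>R. ?M (s * real j / real N) o\<^sub>L R = id_blinfun" for j
  proof (induction j)
    case 0
    show ?case by (intro exI[of _ id_blinfun]) simp
  next
    case (Suc j)
    have u: "s * real i / real N \<in> {0..1}" if "i \<le> N" for i
    proof -
      have "s * real i \<le> 1 * real N" using s that by (intro mult_mono) auto
      thus ?thesis using s N0 by (simp add: divide_le_eq)
    qed
    obtain R where R: "?M (s * real j / real N) o\<^sub>L R = id_blinfun" using Suc by auto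
    have nR: "norm R \<le> 1 + C" by (rule norm_inverse_le[OF R inj]) (use u Suc C in auto)
    have "?M (s * real (Suc j) / real N) - ?M (s * real j / real N) = (s / real N) *\<^sub>R D"
      by (simp add: scaleR_diff_left[symmetric] diff_divide_distrib[symmetric] algebra_simps)
    hence "norm (?M (s * real (Suc j) / real N) - ?M (s * real j / real N)) = s / real N * norm D"
      using s by simp
    also have "\<dots> \<le> 1 / real N * norm D" using s N0 by (intro mult_right_mono divide_right_mono) auto
    finally have "(1 + C) * norm (?M (s * real (Suc j) / real N) - ?M (s * real j / real N))
        \<le> (1 + C) * (1 / real N * norm D)" using C by (intro mult_left_mono) auto
    also have "\<dots> < 1" using N N0 by (simp add: field_simps)
    finally show ?case by (rule right_inverse_perturbation[OF R nR]) blast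
  qed
  have "s * real N / real N = s" using N0 by simp
  with step[of N] obtain R where R: "?M s o\<^sub>L R = id_blinfun" by auto
  have "R o\<^sub>L ?M s = id_blinfun" by (rule left_inverse_of_injective[OF R inj[OF s]])
  moreover have "norm R \<le> 1 + C" by (rule norm_inverse_le[OF R inj[OF s]]) (use C in auto)
  ultimately show ?thesis using R that by blast
qed

text \<open>\<open>x i n\<close> is row i of the triangle i + j < n. The rows converge and are
  dominated by a constant times norm (a i), so Tannery's theorem gives the limit of the triangular
  sums.\<close>

lemma Cauchy_product_bilinear:
  fixes a :: "nat \<Rightarrow> 'x::banach" and b :: "nat \<Rightarrow> 'y::banach" and prod :: "'x \<Rightarrow> 'y \<Rightarrow> 'z::banach"
  assumes prod: "bounded_bilinear prod"
    and a: "summable (\<lambda>k. norm (a k))" and b: "summable (\<lambda>k. norm (b k))"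
  shows "(\<lambda>k. \<Sum>i\<le>k. prod (a i) (b (k - i))) sums prod (\<Sum>k. a k) (\<Sum>k. b k)"
proof -
  interpret bounded_bilinear prod by (rule prod)
  obtain K where K: "0 < K" "\<And>x y. norm (prod x y) \<le> norm x * norm y * K" using pos_bounded by blast
  have sa: "summable a" and sb: "summable b" using a b by (auto intro: summable_norm_cancel)
  define x where "x = (\<lambda>i n. if i < n then prod (a i) (\<Sum>j<n - i. b j) else 0)"
  have lim: "((\<lambda>n. x i n) \<longlongrightarrow> prod (a i) (\<Sum>k. b k)) sequentially" for i
  proof -
    have "(\<lambda>n. \<Sum>j<n. b j) \<longlonglongrightarrow> (\<Sum>k. b k)" using sb by (rule summable_LIMSEQ)
    hence "(\<lambda>n. \<Sum>j<n - i. b j) \<longlonglongrightarrow> (\<Sum>k. b k)"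
      by (rule filterlim_compose) (rule filterlim_minus_const_nat_at_top)
    hence "(\<lambda>n. prod (a i) (\<Sum>j<n - i. b j)) \<longlonglongrightarrow> prod (a i) (\<Sum>k. b k)" by (intro tendsto tendsto_const)
    moreover have "eventually (\<lambda>n. prod (a i) (\<Sum>j<n - i. b j) = x i n) sequentially"
      using eventually_gt_at_top[of i] by eventually_elim (simp add: x_def)
    ultimately show ?thesis by (rule Lim_transform_eventually)
  qed
  have le: "norm (x i n) \<le> norm (a i) * ((\<Sum>k. norm (b k)) * K)" for i n
  proof (cases "i < n")
    case True
    have "norm (x i n) \<le> norm (a i) * norm (\<Sum>j<n - i. b j) * K" using True K by (simp add: x_def)
    also have "norm (\<Sum>j<n - i. b j) \<le> (\<Sum>j<n - i. norm (b j))" by (rule norm_sum)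
    also have "\<dots> \<le> (\<Sum>k. norm (b k))" using b by (intro sum_le_suminf) auto
    finally show ?thesis using K by (simp add: mult.assoc mult_left_mono mult_right_mono)
  next
    case False
    thus ?thesis using K suminf_nonneg[OF b] by (simp add: x_def)
  qed
  have "((\<lambda>n. \<Sum>i. x i n) \<longlongrightarrow> (\<Sum>i. prod (a i) (\<Sum>k. b k))) sequentially"
    by (rule tendsto_suminf_dominated(2)[OF lim, where C = "\<lambda>i. norm (a i) * ((\<Sum>k. norm (b k)) * K)"])
       (use le a in \<open>auto intro!: always_eventually summable_mult2\<close>)
  moreover have "(\<Sum>i. prod (a i) (\<Sum>k. b k)) = prod (\<Sum>k. a k) (\<Sum>k. b k)"
    by (rule bounded_linear.suminf[OF bounded_linear_left sa, symmetric])
  moreover have "(\<Sum>i. x i n) = (\<Sum>k<n. \<Sum>i\<le>k. prod (a i) (b (k - i)))" for n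
  proof -
    have "(\<Sum>i. x i n) = (\<Sum>i<n. x i n)" by (rule suminf_finite) (auto simp: x_def)
    also have "\<dots> = (\<Sum>i<n. \<Sum>j<n - i. prod (a i) (b j))" by (simp add: x_def sum_right)
    also have "\<dots> = (\<Sum>(i, j)\<in>Sigma {..<n} (\<lambda>i. {..<n - i}). prod (a i) (b j))" by (rule sum.Sigma) auto
    also have "Sigma {..<n} (\<lambda>i. {..<n - i}) = {(i, j). i + j < n}" by auto
    also have "(\<Sum>(i, j)\<in>{(i, j). i + j < n}. prod (a i) (b j)) = (\<Sum>k<n. \<Sum>i\<le>k. prod (a i) (b (k - i)))"
      by (rule sum.triangle_reindex)
    finally show ?thesis .
  qed
  ultimately show ?thesis by (simp add: sums_def)
qed

text \<open>The coefficient of \<open>z ^ Suc k\<close> in \<open>(A z - 1) (1 + s (A z - 1))\<^sup>-\<^sup>1\<close>, where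
  \<open>A z - 1 = (\<Sum>k. z ^ Suc k e (Suc k))\<close>.\<close>

fun log_coeff :: "(nat \<Rightarrow> ('a::real_normed_vector \<Rightarrow>\<^sub>L 'a)) \<Rightarrow> real \<Rightarrow> nat \<Rightarrow> ('a \<Rightarrow>\<^sub>L 'a)" where
  "log_coeff e s 0 = e 1"
| "log_coeff e s (Suc k) = e (Suc (Suc k)) - s *\<^sub>R (\<Sum>j\<le>k. e (Suc j) o\<^sub>L log_coeff e s (k - j))"

text \<open>Coefficient comparison in G + s D G = D. Entry k of \<open>d\<close> and of
  \<open>g\<close> belongs to degree k + 1, so the product of d j and g (k - j) has degree k + 2 and
  enters at index Suc k.\<close>

lemma resolvent_series:
  fixes d g :: "nat \<Rightarrow> ('b::banach \<Rightarrow>\<^sub>L 'b)"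
  assumes d: "summable (\<lambda>k. norm (d k))" and g: "summable (\<lambda>k. norm (g k))"
    and "g 0 = d 0" and "\<And>k. g (Suc k) = d (Suc k) - s *\<^sub>R (\<Sum>j\<le>k. d j o\<^sub>L g (k - j))"
  shows "(id_blinfun + s *\<^sub>R (\<Sum>k. d k)) o\<^sub>L (\<Sum>k. g k) = (\<Sum>k. d k)"
proof -
  let ?D = "\<Sum>k. d k" and ?G = "\<Sum>k. g k"
  have sd: "summable d" and sg: "summable g" using d g by (auto intro: summable_norm_cancel)
  have "(\<lambda>k. \<Sum>j\<le>k. d j o\<^sub>L g (k - j)) sums (?D o\<^sub>L ?G)"
    by (rule Cauchy_product_bilinear[OF bounded_bilinear_blinfun_compose d g])
  hence "(\<lambda>k. d (Suc k) - s *\<^sub>R (\<Sum>j\<le>k. d j o\<^sub>L g (k - j))) sums ((?D - d 0) - s *\<^sub>R (?D o\<^sub>L ?G))"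
    using summable_sums[OF sd] by (intro sums_diff sums_scaleR_right) (simp_all add: sums_Suc_iff)
  moreover have "(\<lambda>k. g (Suc k)) sums (?G - g 0)" using summable_sums[OF sg] by (simp add: sums_Suc_iff)
  ultimately have "?G - g 0 = (?D - d 0) - s *\<^sub>R (?D o\<^sub>L ?G)"
    using assms(4) by (simp add: sums_unique2)
  thus ?thesis using assms(3) by (simp add: blinfun_compose_distribs algebra_simps)
qed

text \<open>A crude majorant, enough for the series to converge near 0 and to be recognised as the
  Taylor series there. The sharp growth rate comes from Cauchy's estimate.\<close>

lemma norm_log_coeff_le:
  assumes e: "\<And>k. norm (e k) \<le> p ^ k" and p: "0 \<le> p" and s: "s \<in> {0..1}"
  shows "norm (log_coeff e s k) \<le> (2 * p) ^ Suc k"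
proof (induction k rule: less_induct)
  case (less k)
  show ?case
  proof (cases k)
    case 0
    thus ?thesis using e[of 1] p by simp
  next
    case (Suc m)
    have "norm (s *\<^sub>R (\<Sum>j\<le>m. e (Suc j) o\<^sub>L log_coeff e s (m - j))) \<le> 1 * norm (\<Sum>j\<le>m. e (Suc j) o\<^sub>L log_coeff e s (m - j))"
      using s by (simp add: mult_left_le_one_le)
    also have "norm (\<Sum>j\<le>m. e (Suc j) o\<^sub>L log_coeff e s (m - j)) \<le> (\<Sum>j\<le>m. p ^ Suc j * (2 * p) ^ Suc (m - j))"
    proof (rule sum_norm_le)
      fix j assume "j \<in> {..m}"
      hence "norm (log_coeff e s (m - j)) \<le> (2 * p) ^ Suc (m - j)" using Suc by (intro less) auto
      thus "norm (e (Suc j) o\<^sub>L log_coeff e s (m - j)) \<le> p ^ Suc j * (2 * p) ^ Suc (m - j)"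
        using e[of "Suc j"] p by (intro order_trans[OF norm_blinfun_compose] mult_mono) auto
    qed
    also have "\<dots> = (\<Sum>j\<le>m. p ^ Suc (Suc m) * 2 ^ Suc (m - j))"
    proof (intro sum.cong refl)
      fix j assume "j \<in> {..m}"
      hence "Suc (Suc m) = Suc j + Suc (m - j)" by simp
      hence "p ^ Suc (Suc m) = p ^ Suc j * p ^ Suc (m - j)" by (simp only: power_add)
      thus "p ^ Suc j * (2 * p) ^ Suc (m - j) = p ^ Suc (Suc m) * 2 ^ Suc (m - j)"
        by (simp only: power_mult_distrib mult_ac)
    qed
    also have "\<dots> = p ^ Suc (Suc m) * (\<Sum>j\<le>m. 2 ^ Suc (m - j))" by (simp only: sum_distrib_left)
    also have "(\<Sum>j\<le>m. 2 ^ Suc (m - j)) = (\<Sum>j\<le>m. 2 ^ Suc j :: real)"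
      by (rule sum.reindex_bij_witness[of _ "\<lambda>j. m - j" "\<lambda>j. m - j"]) auto
    also have "\<dots> = 2 ^ Suc (Suc m) - 2" by (induction m) auto
    finally have 1: "norm (s *\<^sub>R (\<Sum>j\<le>m. e (Suc j) o\<^sub>L log_coeff e s (m - j))) \<le> p ^ Suc (Suc m) * (2 ^ Suc (Suc m) - 2)"
      by simp
    have "norm (log_coeff e s k) \<le> norm (e (Suc (Suc m))) + norm (s *\<^sub>R (\<Sum>j\<le>m. e (Suc j) o\<^sub>L log_coeff e s (m - j)))"
      unfolding Suc log_coeff.simps by (rule norm_triangle_ineq4)
    also have "\<dots> \<le> p ^ Suc (Suc m) + p ^ Suc (Suc m) * (2 ^ Suc (Suc m) - 2)"
      by (intro add_mono e 1)
    also have "\<dots> \<le> (2 * p) ^ Suc k" using p unfolding Suc power_mult_distrib by (simp add: algebra_simps)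
    finally show ?thesis .
  qed
qed

subsection \<open>Complexification\<close>

text \<open>The pair (x, y) stands for x + i y, and the operator is z B extended complex-linearly;
  \<open>complexify c id_blinfun\<close> is multiplication by c. The product type carries the
  Hilbert norm, so the results on real inner product spaces apply to it.\<close>

definition complexify :: "complex \<Rightarrow> ('a::real_inner \<Rightarrow>\<^sub>L 'a) \<Rightarrow> (('a \<times> 'a) \<Rightarrow>\<^sub>L ('a \<times> 'a))" where
  "complexify z B = Blinfun (\<lambda>x. (Re z *\<^sub>R B (fst x) - Im z *\<^sub>R B (snd x), Im z *\<^sub>R B (fst x) + Re z *\<^sub>R B (snd x)))"

lemma complexify_apply:
  "complexify z B x = (Re z *\<^sub>R B (fst x) - Im z *\<^sub>R B (snd x), Im z *\<^sub>R B (fst x) + Re z *\<^sub>R B (snd x))"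
proof -
  have "bounded_linear (\<lambda>x. (Re z *\<^sub>R B (fst x) - Im z *\<^sub>R B (snd x), Im z *\<^sub>R B (fst x) + Re z *\<^sub>R B (snd x)))"
    by (intro bounded_linear_intros)
  thus ?thesis unfolding complexify_def by (simp add: bounded_linear_Blinfun_apply)
qed

lemma complexify_compose: "complexify z B o\<^sub>L complexify w C = complexify (z * w) (B o\<^sub>L C)"
  by (rule blinfun_eqI)
     (simp add: complexify_apply blinfun.add_right blinfun.diff_right blinfun.scaleR_right algebra_simps)

lemma complexify_one: "complexify 1 id_blinfun = id_blinfun"
  by (rule blinfun_eqI) (simp add: complexify_apply)

lemma norm_complexify_le: "norm (complexify z B) \<le> cmod z * norm B"
proof (rule norm_blinfun_bound)
  fix x :: "'a \<times> 'a"
  let ?u = "B (fst x)" and ?v = "B (snd x)"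
  have "(norm (complexify z B x))\<^sup>2 = (cmod z)\<^sup>2 * ((norm ?u)\<^sup>2 + (norm ?v)\<^sup>2)"
  proof -
    have "(norm (complexify z B x))\<^sup>2
        = (norm (Re z *\<^sub>R ?u - Im z *\<^sub>R ?v))\<^sup>2 + (norm (Im z *\<^sub>R ?u + Re z *\<^sub>R ?v))\<^sup>2"
      by (simp add: complexify_apply norm_Pair)
    also have "\<dots> = (cmod z)\<^sup>2 * ((norm ?u)\<^sup>2 + (norm ?v)\<^sup>2)"
      unfolding cmod_power2 unfolding power2_norm_eq_inner
      by (simp add: inner_diff inner_add inner_commute[of ?v ?u] power2_eq_square algebra_simps)
    finally show ?thesis .
  qed
  also have "\<dots> \<le> (cmod z)\<^sup>2 * ((norm B * norm (fst x))\<^sup>2 + (norm B * norm (snd x))\<^sup>2)"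
    by (intro mult_left_mono add_mono power_mono norm_blinfun) auto
  also have "\<dots> = (cmod z * norm B * norm x)\<^sup>2"
    by (simp add: norm_prod_def power_mult_distrib algebra_simps)
  finally show "norm (complexify z B x) \<le> cmod z * norm B * norm x" by (rule power2_le_imp_le) simp
qed simp

lemma bounded_bilinear_complexify: "bounded_bilinear complexify"
proof (rule bounded_bilinear.intro)
  show "\<exists>K. \<forall>z B. norm (complexify z B) \<le> norm z * norm B * K"
    by (intro exI[of _ 1]) (simp add: norm_complexify_le)
qed (rule blinfun_eqI; simp add: complexify_apply blinfun.add_left blinfun.add_right blinfun.scaleR_left algebra_simps)+

interpretation complexify: bounded_bilinear complexify by (rule bounded_bilinear_complexify)

text \<open>The complex number <T x, y> for vectors x and y of the original space. It turns
  operator-valued functions of z into scalar ones, to which Cauchy's estimate applies.\<close>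

definition complex_form :: "'a::real_inner \<Rightarrow> 'a \<Rightarrow> (('a \<times> 'a) \<Rightarrow>\<^sub>L ('a \<times> 'a)) \<Rightarrow> complex" where
  "complex_form x y T = Complex (inner (fst (T (x, 0))) y) (inner (snd (T (x, 0))) y)"

lemma norm_complex_form_le: "cmod (complex_form x y T) \<le> norm T * (norm x * norm y)"
proof -
  let ?w = "T (x, 0)"
  have i: "(inner u y)\<^sup>2 \<le> (norm u * norm y)\<^sup>2" for u
    using power_mono[OF Cauchy_Schwarz_ineq2[of u y], of 2] by simp
  have "(cmod (complex_form x y T))\<^sup>2 \<le> (norm (fst ?w) * norm y)\<^sup>2 + (norm (snd ?w) * norm y)\<^sup>2"
    unfolding cmod_power2 complex_form_def by (simp add: add_mono i)
  also have "\<dots> = (norm ?w * norm y)\<^sup>2" by (simp add: norm_prod_def power_mult_distrib algebra_simps)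
  finally have "cmod (complex_form x y T) \<le> norm ?w * norm y" by (rule power2_le_imp_le) simp
  also have "norm ?w \<le> norm T * norm x" using norm_blinfun[of T "(x, 0)"] by (simp add: norm_Pair)
  finally show ?thesis by (simp add: mult_right_mono mult.assoc)
qed

lemma bounded_linear_complex_form: "bounded_linear (complex_form x y)"
proof (rule bounded_linear_intro)
  show "norm (complex_form x y T) \<le> norm T * (norm x * norm y)" for T by (rule norm_complex_form_le)
qed (simp_all add: complex_form_def blinfun.add_left blinfun.scaleR_left inner_add complex_eq_iff)

lemma complex_form_complexify: "complex_form x y (complexify z B) = z * of_real (inner (B x) y)"
  by (simp add: complex_form_def complexify_apply complex_eq_iff)

lemma complex_form_mult: "complex_form x y (complexify c id_blinfun o\<^sub>L T) = c * complex_form x y T"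
  by (simp add: complex_form_def complexify_apply complex_eq_iff inner_diff inner_add)

lemma elem_sym_eq_0: "n < k \<Longrightarrow> elem_sym B n k = 0"
  by (induction B n k rule: elem_sym.induct) auto

text \<open>The cutoff m is free because the terms beyond n vanish; the induction needs the
  hypothesis at m and at m - 1, one for each summand in the recursion of
  \<open>elem_sym\<close>.\<close>

lemma ordered_prod_complexify:
  assumes "n \<le> m"
  shows "ordered_prod (\<lambda>i. complexify z (C i)) n = (\<Sum>k\<le>m. complexify (z ^ k) (elem_sym C n k))"
  using assms
proof (induction n arbitrary: m)
  case 0
  have "(\<Sum>k\<le>m. complexify (z ^ k) (elem_sym C 0 k)) = (\<Sum>k\<in>{0}. complexify (z ^ k) (elem_sym C 0 k))"
    by (rule sum.mono_neutral_right) (auto simp: elem_sym_eq_0 complexify.zero_right)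
  thus ?case by (simp add: complexify_one)
next
  case (Suc n)
  then obtain l where l: "m = Suc l" "n \<le> l" by (cases m) auto
  let ?c = "\<lambda>k. complexify (z ^ k) (elem_sym C n k)"
  have "(\<Sum>k\<le>m. complexify (z ^ k) (elem_sym C (Suc n) k))
      = id_blinfun + (\<Sum>k\<le>l. ?c (Suc k) + (?c k o\<^sub>L complexify z (C n)))"
    unfolding l(1) sum.atMost_Suc_shift
    by (simp add: complexify_one complexify.add_right complexify_compose mult.commute)
  also have "\<dots> = (\<Sum>k\<le>m. ?c k) + ((\<Sum>k\<le>l. ?c k) o\<^sub>L complexify z (C n))"
    unfolding l(1) sum.atMost_Suc_shift
    by (simp add: complexify_one sum.distrib blinfun_compose.sum_left)
  also have "\<dots> = ordered_prod (\<lambda>i. complexify z (C i)) (Suc n)"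
    using Suc.IH[of m] Suc.IH[of l] l by (simp add: blinfun_compose_distribs)
  finally show ?case by simp
qed

subsection \<open>Ordered exponentials with a complex parameter\<close>

text \<open>Detaches the operator theory from measures: \<open>e\<close> and \<open>B\<close> are
  what \<open>ordered_measure_approximation\<close> supplies. The bound p is positive because
  \<open>ell p\<close> and the radius pi / p occur.\<close>

locale ordered_exponential =
  fixes e :: "nat \<Rightarrow> ('a::{real_inner,banach} \<Rightarrow>\<^sub>L 'a)" and B :: "nat \<Rightarrow> nat \<Rightarrow> ('a \<Rightarrow>\<^sub>L 'a)" and p :: real
  assumes B: "\<And>n i. i < n \<Longrightarrow> norm (B n i) \<le> p / real n"
    and e_lim: "\<And>k. (\<lambda>n. elem_sym (B n) n k) \<longlonglongrightarrow> e k"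
    and p: "0 < p" "p < pi"
begin

lemma norm_e_le: "norm (e k) \<le> p ^ k / fact k"
  by (rule LIMSEQ_le_const2[OF tendsto_norm[OF e_lim]])
     (use norm_elem_sym_le[OF B] p in \<open>auto intro!: exI[of _ 0]\<close>)

lemma norm_e_le_power: "norm (e k) \<le> p ^ k"
proof -
  have "p ^ k / fact k \<le> p ^ k / 1" using p by (intro divide_left_mono) (auto simp: fact_ge_1)
  thus ?thesis using norm_e_le[of k] by simp
qed

lemma e_0: "e 0 = id_blinfun"
  using LIMSEQ_unique[OF e_lim[of 0]] by simp

text \<open>\<open>id_blinfun + D z\<close> is the ordered exponential of z \<phi> on the
  complexified space.\<close>

definition D :: "complex \<Rightarrow> (('a \<times> 'a) \<Rightarrow>\<^sub>L ('a \<times> 'a))" where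
  "D z = (\<Sum>k. complexify (z ^ Suc k) (e (Suc k)))"

lemma summable_power_fact: "summable (\<lambda>k. c ^ k / fact k :: real)"
  using summable_exp[of c] by (simp add: field_simps)

lemma norm_term_le: "norm (complexify (z ^ k) (e k)) \<le> (cmod z * p) ^ k / fact k"
proof -
  have "norm (complexify (z ^ k) (e k)) \<le> cmod (z ^ k) * norm (e k)" by (rule norm_complexify_le)
  also have "\<dots> \<le> cmod (z ^ k) * (p ^ k / fact k)" by (intro mult_left_mono norm_e_le) auto
  finally show ?thesis by (simp add: norm_power power_mult_distrib)
qed

lemma summable_terms: "summable (\<lambda>k. norm (complexify (z ^ k) (e k)))"
  by (rule summable_comparison_test'[OF summable_power_fact[of "cmod z * p"], of 0])
     (use norm_term_le in auto)

lemma summable_D: "summable (\<lambda>k. norm (complexify (z ^ Suc k) (e (Suc k))))"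
  using summable_terms[of z] summable_Suc_iff[of "\<lambda>k. norm (complexify (z ^ k) (e k))"] by simp

lemma ordered_prod_tendsto:
  "(\<lambda>n. ordered_prod (\<lambda>i. complexify z (B n i)) n) \<longlonglongrightarrow> id_blinfun + D z"
proof -
  let ?a = "\<lambda>k n. complexify (z ^ k) (elem_sym (B n) n k)"
  have "norm (?a k n) \<le> (cmod z * p) ^ k / fact k" for k n
  proof -
    have "norm (?a k n) \<le> cmod (z ^ k) * norm (elem_sym (B n) n k)" by (rule norm_complexify_le)
    also have "\<dots> \<le> cmod (z ^ k) * (p ^ k / fact k)"
      using p by (intro mult_left_mono norm_elem_sym_le B) auto
    finally show ?thesis by (simp add: norm_power power_mult_distrib)
  qed
  hence le: "eventually (\<lambda>n. \<forall>k. norm (?a k n) \<le> (cmod z * p) ^ k / fact k) sequentially" by simp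
  have "(?a k \<longlongrightarrow> complexify (z ^ k) (e k)) sequentially" for k
    by (intro complexify.tendsto tendsto_const e_lim)
  from tendsto_suminf_dominated(2)[OF this le summable_power_fact]
  have "(\<lambda>n. \<Sum>k. ?a k n) \<longlonglongrightarrow> (\<Sum>k. complexify (z ^ k) (e k))" by simp
  moreover have "(\<Sum>k. ?a k n) = ordered_prod (\<lambda>i. complexify z (B n i)) n" for n
  proof -
    have "(\<Sum>k. ?a k n) = (\<Sum>k\<le>n. ?a k n)"
      by (rule suminf_finite) (auto simp: elem_sym_eq_0 complexify.zero_right)
    thus ?thesis using ordered_prod_complexify[of n n z "B n"] by simp
  qed
  moreover have "(\<Sum>k. complexify (z ^ k) (e k)) = id_blinfun + D z"
    unfolding D_def
    using suminf_split_head[OF summable_norm_cancel[OF summable_terms[of z]]]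
    by (simp add: e_0 complexify_one)
  ultimately show ?thesis by simp
qed

lemma D_disc:
  assumes z: "cmod z * p \<le> q" and q: "0 < q" "q < pi" and t: "t \<in> {ell q..pi - ell q}"
  shows "norm (D z x - disc_center q t *\<^sub>R (x + mob_par q t *\<^sub>R D z x))
    \<le> disc_radius q t * norm (x + mob_par q t *\<^sub>R D z x)"
proof -
  have "norm (complexify z (B n i)) \<le> q / real n" if "i < n" for n i
  proof -
    have "norm (complexify z (B n i)) \<le> cmod z * (p / real n)"
      by (rule order_trans[OF norm_complexify_le mult_left_mono[OF B[OF that]]]) simp
    also have "\<dots> = (cmod z * p) / real n" by simp
    also have "\<dots> \<le> q / real n" using z by (intro divide_right_mono) auto
    finally show ?thesis .
  qed
  from quadratic_form_le_limit[OF this q ordered_prod_tendsto ang_bounds(7,8)[OF q t], of x]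
  have "sin (t + q * sin t) * (norm ((id_blinfun + D z) x))\<^sup>2 - 2 * exp (q * cos t) * sin t * inner x ((id_blinfun + D z) x)
      + (exp (q * cos t))\<^sup>2 * sin (t - q * sin t) * (norm x)\<^sup>2 \<le> 0" by simp
  from norm_moebius_le[OF q t this] show ?thesis by (simp add: blinfun.add_left)
qed

text \<open>The disc about \<open>disc_center q t\<close> lies in a disc about 0 whose radius is
  bounded in t, and \<open>mob_par q\<close> takes every value s in [0, 1].\<close>

lemma D_lower_bound:
  assumes q: "0 < q" "q < pi"
  obtains C where "0 \<le> C"
    "\<And>z s x. cmod z * p \<le> q \<Longrightarrow> s \<in> {0..1} \<Longrightarrow> norm (D z x) \<le> C * norm (x + s *\<^sub>R D z x)"
proof -
  obtain C where C: "0 < C" "\<And>t. t \<in> {ell q..pi - ell q} \<Longrightarrow> \<bar>disc_center q t\<bar> + disc_radius q t \<le> C"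
    using disc_bounded[OF q] by blast
  have "norm (D z x) \<le> C * norm (x + s *\<^sub>R D z x)" if z: "cmod z * p \<le> q" and s: "s \<in> {0..1}" for z s x
  proof -
    obtain t where t: "t \<in> {ell q..pi - ell q}" "mob_par q t = s" using mob_par_surj[OF q s] by blast
    let ?y = "x + s *\<^sub>R D z x"
    have "norm (D z x) = norm ((D z x - disc_center q t *\<^sub>R ?y) + disc_center q t *\<^sub>R ?y)" by simp
    also have "\<dots> \<le> norm (D z x - disc_center q t *\<^sub>R ?y) + norm (disc_center q t *\<^sub>R ?y)"
      by (rule norm_triangle_ineq)
    also have "\<dots> \<le> disc_radius q t * norm ?y + \<bar>disc_center q t\<bar> * norm ?y"
      using D_disc[OF z q t(1), of x] t(2) by simp
    also have "\<dots> = (\<bar>disc_center q t\<bar> + disc_radius q t) * norm ?y" by (simp add: algebra_simps)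
    also have "\<dots> \<le> C * norm ?y" using C(2)[OF t(1)] by (intro mult_right_mono) auto
    finally show ?thesis .
  qed
  thus ?thesis using that[of C] C(1) by simp
qed

section \<open>Resolvents and their holomorphic dependence on the parameter\<close>

definition res :: "real \<Rightarrow> complex \<Rightarrow> (('a \<times> 'a) \<Rightarrow>\<^sub>L ('a \<times> 'a))" where
  "res s z = op_inv (id_blinfun + s *\<^sub>R D z)"

lemma res_bounded:
  assumes q: "0 < q" "q < pi"
  obtains K where "\<And>z s. cmod z * p \<le> q \<Longrightarrow> s \<in> {0..1} \<Longrightarrow>
    (id_blinfun + s *\<^sub>R D z) o\<^sub>L res s z = id_blinfun \<and> res s z o\<^sub>L (id_blinfun + s *\<^sub>R D z) = id_blinfun \<and>
    norm (res s z) \<le> K"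
proof -
  obtain C where C: "0 \<le> C"
    "\<And>z s x. cmod z * p \<le> q \<Longrightarrow> s \<in> {0..1} \<Longrightarrow> norm (D z x) \<le> C * norm (x + s *\<^sub>R D z x)"
    using D_lower_bound[OF q] by blast
  have "(id_blinfun + s *\<^sub>R D z) o\<^sub>L res s z = id_blinfun \<and> res s z o\<^sub>L (id_blinfun + s *\<^sub>R D z) = id_blinfun \<and>
    norm (res s z) \<le> 1 + C" if z: "cmod z * p \<le> q" and s: "s \<in> {0..1}" for z s
  proof -
    obtain R where R: "(id_blinfun + s *\<^sub>R D z) o\<^sub>L R = id_blinfun" "R o\<^sub>L (id_blinfun + s *\<^sub>R D z) = id_blinfun"
      "norm R \<le> 1 + C"
      using resolvent_exists[OF C(2)[OF z] C(1) s] by blast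
    have "res s z = R" unfolding res_def by (rule op_inv_eq[OF R(1,2)])
    thus ?thesis using R by simp
  qed
  thus ?thesis by (rule that)
qed

lemma radius_between:
  assumes "cmod z * p < pi"
  obtains q where "0 < q" "q < pi" "cmod z * p < q"
proof -
  define q where "q = (cmod z * p + pi) / 2"
  have "0 \<le> cmod z * p" using p by simp
  hence "0 < q" "q < pi" "cmod z * p < q" using assms pi_gt_zero unfolding q_def by argo+
  thus ?thesis by (rule that)
qed

lemma res_inverse:
  assumes z: "cmod z * p < pi" and s: "s \<in> {0..1}"
  shows "(id_blinfun + s *\<^sub>R D z) o\<^sub>L res s z = id_blinfun" "res s z o\<^sub>L (id_blinfun + s *\<^sub>R D z) = id_blinfun"
proof -
  obtain q where q: "0 < q" "q < pi" "cmod z * p < q" using radius_between[OF z] .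
  obtain K where "\<And>z s. cmod z * p \<le> q \<Longrightarrow> s \<in> {0..1} \<Longrightarrow>
    (id_blinfun + s *\<^sub>R D z) o\<^sub>L res s z = id_blinfun \<and> res s z o\<^sub>L (id_blinfun + s *\<^sub>R D z) = id_blinfun \<and>
    norm (res s z) \<le> K" using res_bounded[OF q(1,2)] by blast
  from this[of z s] show "(id_blinfun + s *\<^sub>R D z) o\<^sub>L res s z = id_blinfun"
    "res s z o\<^sub>L (id_blinfun + s *\<^sub>R D z) = id_blinfun" using q s by auto
qed

definition mob :: "real \<Rightarrow> complex \<Rightarrow> (('a \<times> 'a) \<Rightarrow>\<^sub>L ('a \<times> 'a))" where
  "mob s z = D z o\<^sub>L res s z"

lemma norm_mob_diff_le:
  assumes z: "cmod z * p \<le> q" and q: "0 < q" "q < pi" and t: "t \<in> {ell q..pi - ell q}"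
  shows "norm (mob (mob_par q t) z - disc_center q t *\<^sub>R id_blinfun) \<le> disc_radius q t"
proof (rule norm_blinfun_bound)
  show "0 \<le> disc_radius q t" using disc_radius_pos[OF q t] by simp
  fix y
  let ?s = "mob_par q t"
  have s: "?s \<in> {0..1}" by (rule mob_par_range[OF q t])
  have "cmod z * p < pi" using z q by simp
  from arg_cong[OF res_inverse(1)[OF this s], of "\<lambda>T. T y"]
  have y: "res ?s z y + ?s *\<^sub>R D z (res ?s z y) = y" by (simp add: blinfun.add_left blinfun.scaleR_left)
  show "norm ((mob ?s z - disc_center q t *\<^sub>R id_blinfun) y) \<le> disc_radius q t * norm y"
    using D_disc[OF z q t, of "res ?s z y"] unfolding y mob_def
    by (simp add: blinfun.diff_left blinfun.scaleR_left)
qed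

lemma mob_eq_res_D:
  assumes z: "cmod z * p < pi" and s: "s \<in> {0..1}"
  shows "mob s z = res s z o\<^sub>L D z"
proof -
  note r = res_inverse[OF z s]
  have "res s z o\<^sub>L ((id_blinfun + s *\<^sub>R D z) o\<^sub>L D z) o\<^sub>L res s z = res s z o\<^sub>L (D z o\<^sub>L (id_blinfun + s *\<^sub>R D z)) o\<^sub>L res s z"
    by (simp only: blinfun_compose_distribs) simp
  moreover have "res s z o\<^sub>L ((id_blinfun + s *\<^sub>R D z) o\<^sub>L D z) o\<^sub>L res s z
      = (res s z o\<^sub>L (id_blinfun + s *\<^sub>R D z)) o\<^sub>L (D z o\<^sub>L res s z)" by simp
  moreover have "res s z o\<^sub>L (D z o\<^sub>L (id_blinfun + s *\<^sub>R D z)) o\<^sub>L res s z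
      = (res s z o\<^sub>L D z) o\<^sub>L ((id_blinfun + s *\<^sub>R D z) o\<^sub>L res s z)" by simp
  ultimately show ?thesis unfolding r mob_def by simp
qed

text \<open>Inserting (1 + s D z) (res s z) on the right of \<open>mob s w\<close> and (res s w) (1
  + s D w) on the left of \<open>mob s z\<close> makes the terms quadratic in D cancel. This form of
  the resolvent identity holds at s = 0 too.\<close>

lemma mob_diff:
  assumes "cmod z * p < pi" "cmod w * p < pi" and s: "s \<in> {0..1}"
  shows "mob s w - mob s z = res s w o\<^sub>L (D w - D z) o\<^sub>L res s z"
proof -
  note rz = res_inverse[OF assms(1) s] and rw = res_inverse[OF assms(2) s]
  have "mob s w = res s w o\<^sub>L D w o\<^sub>L ((id_blinfun + s *\<^sub>R D z) o\<^sub>L res s z)"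
    unfolding rz mob_eq_res_D[OF assms(2) s] by simp
  moreover have "mob s z = (res s w o\<^sub>L (id_blinfun + s *\<^sub>R D w)) o\<^sub>L D z o\<^sub>L res s z"
    unfolding rw mob_def by simp
  ultimately show ?thesis by (simp add: blinfun_compose_distribs)
qed

lemma res_diff:
  assumes "cmod z * p < pi" "cmod w * p < pi" and s: "s \<in> {0..1}"
  shows "res s w - res s z = - s *\<^sub>R (res s w o\<^sub>L (D w - D z) o\<^sub>L res s z)"
proof -
  note rz = res_inverse[OF assms(1) s] and rw = res_inverse[OF assms(2) s]
  have a: "res s w o\<^sub>L ((id_blinfun + s *\<^sub>R D z) o\<^sub>L res s z) = res s w" unfolding rz by simp
  have b: "(res s w o\<^sub>L (id_blinfun + s *\<^sub>R D w)) o\<^sub>L res s z = res s z" unfolding rw by simp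
  have "(res s w o\<^sub>L ((id_blinfun + s *\<^sub>R D z) o\<^sub>L res s z)) - ((res s w o\<^sub>L (id_blinfun + s *\<^sub>R D w)) o\<^sub>L res s z)
      = - s *\<^sub>R (res s w o\<^sub>L (D w - D z) o\<^sub>L res s z)"
    by (simp add: blinfun_compose_distribs scaleR_diff_right)
  thus ?thesis unfolding a b .
qed

text \<open>Complex linearity of D z, needed to pull the scalar w - z out of a difference
  quotient.\<close>

lemma D_commute: "complexify c id_blinfun o\<^sub>L D z = D z o\<^sub>L complexify c id_blinfun"
proof -
  have s: "summable (\<lambda>k. complexify (z ^ Suc k) (e (Suc k)))" by (rule summable_norm_cancel[OF summable_D])
  have "complexify c id_blinfun o\<^sub>L D z = (\<Sum>k. complexify c id_blinfun o\<^sub>L complexify (z ^ Suc k) (e (Suc k)))"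
    unfolding D_def by (rule bounded_linear.suminf[OF blinfun_compose.bounded_linear_right s])
  also have "\<dots> = (\<Sum>k. complexify (z ^ Suc k) (e (Suc k)) o\<^sub>L complexify c id_blinfun)"
    by (simp add: complexify_compose mult.commute)
  also have "\<dots> = D z o\<^sub>L complexify c id_blinfun"
    unfolding D_def by (rule bounded_linear.suminf[OF blinfun_compose.bounded_linear_left s, symmetric])
  finally show ?thesis .
qed

lemma res_commute:
  assumes z: "cmod z * p < pi" and s: "s \<in> {0..1}"
  shows "complexify c id_blinfun o\<^sub>L res s z = res s z o\<^sub>L complexify c id_blinfun"
proof -
  let ?J = "complexify c id_blinfun" and ?M = "id_blinfun + s *\<^sub>R D z"
  note r = res_inverse[OF z s]
  have M: "?J o\<^sub>L ?M = ?M o\<^sub>L ?J" by (simp add: blinfun_compose_distribs D_commute)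
  have "?J o\<^sub>L res s z = (res s z o\<^sub>L ?M) o\<^sub>L ?J o\<^sub>L res s z" unfolding r by simp
  also have "\<dots> = res s z o\<^sub>L (?M o\<^sub>L ?J) o\<^sub>L res s z" by simp
  also have "\<dots> = res s z o\<^sub>L ?J o\<^sub>L (?M o\<^sub>L res s z)" unfolding M[symmetric] by simp
  finally show ?thesis unfolding r by simp
qed

text \<open>The quotient \<open>(D w - D z) / (w - z)\<close>, continued to \<open>w = z\<close>.\<close>

definition diff_quot :: "complex \<Rightarrow> complex \<Rightarrow> (('a \<times> 'a) \<Rightarrow>\<^sub>L ('a \<times> 'a))" where
  "diff_quot z w = (\<Sum>k. complexify (\<Sum>i<Suc k. z ^ (k - i) * w ^ i) (e (Suc k)))"

lemma norm_diff_quot_term_le: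
  assumes "cmod z \<le> r" "cmod w \<le> r" "1 \<le> r"
  shows "norm (complexify (\<Sum>i<Suc k. z ^ (k - i) * w ^ i) (e (Suc k))) \<le> (2 * r * p) ^ Suc k / fact (Suc k)"
proof -
  have "cmod (\<Sum>i<Suc k. z ^ (k - i) * w ^ i) \<le> (\<Sum>i<Suc k. r ^ k)"
  proof (rule sum_norm_le)
    fix i assume i: "i \<in> {..<Suc k}"
    have "cmod (z ^ (k - i) * w ^ i) \<le> r ^ (k - i) * r ^ i"
      unfolding norm_mult norm_power using assms by (intro mult_mono power_mono) auto
    thus "cmod (z ^ (k - i) * w ^ i) \<le> r ^ k" using i by (simp flip: power_add)
  qed
  also have "\<dots> = real (Suc k) * r ^ k" by simp
  also have "\<dots> \<le> 2 ^ Suc k * r ^ Suc k"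
  proof (rule mult_mono)
    show "real (Suc k) \<le> 2 ^ Suc k" using less_exp[of "Suc k"] by (metis less_imp_le of_nat_le_iff of_nat_numeral of_nat_power)
    show "r ^ k \<le> r ^ Suc k" using assms(3) by (intro power_increasing) auto
  qed (use assms in auto)
  finally have "cmod (\<Sum>i<Suc k. z ^ (k - i) * w ^ i) * norm (e (Suc k)) \<le> 2 ^ Suc k * r ^ Suc k * (p ^ Suc k / fact (Suc k))"
    using assms by (intro mult_mono norm_e_le) auto
  thus ?thesis using norm_complexify_le[of "\<Sum>i<Suc k. z ^ (k - i) * w ^ i" "e (Suc k)"]
    unfolding power_mult_distrib by (simp only: times_divide_eq_right)
qed

lemma summable_diff_quot_bound: "summable (\<lambda>k. (c :: real) ^ Suc k / fact (Suc k))"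
  using summable_Suc_iff[of "\<lambda>k. c ^ k / fact k"] summable_power_fact by simp

lemma D_diff: "D w - D z = complexify (w - z) id_blinfun o\<^sub>L diff_quot z w"
proof -
  define r where "r = max 1 (max (cmod z) (cmod w))"
  have s: "summable (\<lambda>k. complexify (\<Sum>i<Suc k. z ^ (k - i) * w ^ i) (e (Suc k)))"
    by (rule summable_comparison_test'[OF summable_diff_quot_bound[of "2 * r * p"], of 0])
       (rule norm_diff_quot_term_le, auto simp: r_def)
  have "complexify (w - z) id_blinfun o\<^sub>L diff_quot z w
      = (\<Sum>k. complexify (w - z) id_blinfun o\<^sub>L complexify (\<Sum>i<Suc k. z ^ (k - i) * w ^ i) (e (Suc k)))"
    unfolding diff_quot_def by (rule bounded_linear.suminf[OF blinfun_compose.bounded_linear_right s])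
  also have "\<dots> = (\<Sum>k. complexify (w ^ Suc k) (e (Suc k)) - complexify (z ^ Suc k) (e (Suc k)))"
  proof (rule suminf_cong)
    fix k
    have "w ^ Suc k - z ^ Suc k = (w - z) * (\<Sum>i<Suc k. z ^ (k - i) * w ^ i)"
      using power_diff_sumr2[of w "Suc k" z] by simp
    thus "complexify (w - z) id_blinfun o\<^sub>L complexify (\<Sum>i<Suc k. z ^ (k - i) * w ^ i) (e (Suc k))
        = complexify (w ^ Suc k) (e (Suc k)) - complexify (z ^ Suc k) (e (Suc k))"
      by (simp only: complexify_compose blinfun_compose_simps complexify.diff_left[symmetric])
  qed
  also have "\<dots> = D w - D z" unfolding D_def
    by (rule suminf_diff[symmetric]) (rule summable_norm_cancel[OF summable_D])+
  finally show ?thesis by simp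
qed

lemma diff_quot_tendsto: "(diff_quot z \<longlongrightarrow> diff_quot z z) (at z)"
  unfolding diff_quot_def
proof (rule tendsto_suminf_dominated(2))
  show "((\<lambda>w. complexify (\<Sum>i<Suc k. z ^ (k - i) * w ^ i) (e (Suc k))) \<longlongrightarrow>
      complexify (\<Sum>i<Suc k. z ^ (k - i) * z ^ i) (e (Suc k))) (at z)" for k
    by (intro complexify.tendsto tendsto_intros)
  have "eventually (\<lambda>w. w \<in> ball z 1) (at z)" by (rule eventually_at_in_open') auto
  thus "eventually (\<lambda>w. \<forall>k. norm (complexify (\<Sum>i<Suc k. z ^ (k - i) * w ^ i) (e (Suc k)))
      \<le> (2 * (cmod z + 1) * p) ^ Suc k / fact (Suc k)) (at z)"
  proof eventually_elim
    case (elim w)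
    have "cmod w \<le> cmod z + cmod (w - z)" using norm_triangle_sub[of w z] by simp
    hence "cmod w \<le> cmod z + 1" using elim by (simp add: dist_norm norm_minus_commute)
    thus ?case by (intro allI norm_diff_quot_term_le) auto
  qed
qed (rule summable_diff_quot_bound, simp)

lemma D_tendsto: "(D \<longlongrightarrow> D z) (at z)"
proof -
  have "((\<lambda>w. complexify (w - z) id_blinfun o\<^sub>L diff_quot z w) \<longlongrightarrow> complexify (z - z) id_blinfun o\<^sub>L diff_quot z z) (at z)"
    by (intro blinfun_compose.tendsto complexify.tendsto tendsto_intros diff_quot_tendsto)
  hence "((\<lambda>w. D w - D z) \<longlongrightarrow> 0) (at z)"
    by (simp add: D_diff[symmetric] complexify.zero_left blinfun_compose.zero_left)
  thus ?thesis by (simp add: LIM_zero_iff)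
qed

lemma eventually_radius:
  assumes "cmod z * p < q"
  shows "eventually (\<lambda>w. cmod w * p < q) (at z)"
proof -
  have "((\<lambda>w. cmod w * p) \<longlongrightarrow> cmod z * p) (at z)" by (intro tendsto_intros)
  thus ?thesis using assms by (rule order_tendstoD)
qed

lemma res_tendsto:
  assumes z: "cmod z * p < pi" and s: "s \<in> {0..1}"
  shows "(res s \<longlongrightarrow> res s z) (at z)"
proof -
  obtain q where q: "0 < q" "q < pi" "cmod z * p < q" using radius_between[OF z] .
  obtain K where K: "\<And>w s. cmod w * p \<le> q \<Longrightarrow> s \<in> {0..1} \<Longrightarrow>
    (id_blinfun + s *\<^sub>R D w) o\<^sub>L res s w = id_blinfun \<and> res s w o\<^sub>L (id_blinfun + s *\<^sub>R D w) = id_blinfun \<and>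
    norm (res s w) \<le> K" using res_bounded[OF q(1,2)] by blast
  have "((\<lambda>w. res s w - res s z) \<longlongrightarrow> 0) (at z)"
  proof (rule Lim_null_comparison)
    show "eventually (\<lambda>w. norm (res s w - res s z) \<le> K * norm (D w - D z) * K) (at z)"
      using eventually_radius[OF q(3)]
    proof eventually_elim
      case (elim w)
      have w: "cmod w * p < pi" using elim q by simp
      have nw: "norm (res s w) \<le> K" and nz: "norm (res s z) \<le> K" using K[of w s] K[of z s] elim q s by auto
      have K0: "0 \<le> K" using norm_ge_zero nw by (rule order_trans)
      have "norm (res s w - res s z) = s * norm (res s w o\<^sub>L (D w - D z) o\<^sub>L res s z)"
        unfolding res_diff[OF z w s] using s by simp
      also have "\<dots> \<le> 1 * norm (res s w o\<^sub>L (D w - D z) o\<^sub>L res s z)" using s by (intro mult_right_mono) auto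
      also have "\<dots> \<le> norm (res s w) * (norm (D w - D z) * norm (res s z))"
        using norm_blinfun_compose[of "res s w" "(D w - D z) o\<^sub>L res s z"]
          mult_left_mono[OF norm_blinfun_compose[of "D w - D z" "res s z"] norm_ge_zero[of "res s w"]] by simp
      also have "\<dots> \<le> K * (norm (D w - D z) * K)"
        using nw nz K0 by (intro mult_mono) auto
      finally show ?case by (simp add: mult.assoc)
    qed
    have "((\<lambda>w. K * norm (D w - D z) * K) \<longlongrightarrow> K * norm (D z - D z) * K) (at z)"
      by (intro tendsto_intros D_tendsto)
    thus "((\<lambda>w. K * norm (D w - D z) * K) \<longlongrightarrow> 0) (at z)" by simp
  qed
  thus ?thesis by (simp add: LIM_zero_iff)
qed

text \<open>By \<open>mob_diff\<close> and \<open>D_diff\<close> the difference quotient is the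
  product of \<open>res s w\<close>, \<open>diff_quot z w\<close> and \<open>res s z\<close>, once
  the scalar w - z has been moved to the left through the resolvent.\<close>

lemma complex_form_mob_has_derivative:
  assumes z: "cmod z * p < pi" and s: "s \<in> {0..1}"
  shows "((\<lambda>w. complex_form x y (mob s w)) has_field_derivative
    complex_form x y (res s z o\<^sub>L diff_quot z z o\<^sub>L res s z)) (at z)"
  unfolding has_field_derivative_iff
proof (rule Lim_transform_eventually)
  show "((\<lambda>w. complex_form x y (res s w o\<^sub>L diff_quot z w o\<^sub>L res s z)) \<longlongrightarrow>
      complex_form x y (res s z o\<^sub>L diff_quot z z o\<^sub>L res s z)) (at z)"
    by (intro bounded_linear.tendsto[OF bounded_linear_complex_form] blinfun_compose.tendsto
        res_tendsto z s diff_quot_tendsto tendsto_const)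
  have "eventually (\<lambda>w. w \<noteq> z) (at z)" by (simp add: eventually_at_filter)
  thus "eventually (\<lambda>w. complex_form x y (res s w o\<^sub>L diff_quot z w o\<^sub>L res s z)
      = (complex_form x y (mob s w) - complex_form x y (mob s z)) / (w - z)) (at z)"
    using eventually_radius[OF z]
  proof eventually_elim
    case (elim w)
    have "complex_form x y (mob s w) - complex_form x y (mob s z) = complex_form x y (mob s w - mob s z)"
      by (rule linear_diff[OF bounded_linear.linear[OF bounded_linear_complex_form], symmetric])
    also have "mob s w - mob s z = res s w o\<^sub>L complexify (w - z) id_blinfun o\<^sub>L diff_quot z w o\<^sub>L res s z"
      unfolding mob_diff[OF z elim(2) s] D_diff by simp
    also have "\<dots> = complexify (w - z) id_blinfun o\<^sub>L (res s w o\<^sub>L diff_quot z w o\<^sub>L res s z)"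
      using res_commute[OF elim(2) s, of "w - z"] by (metis blinfun_compose_simps(3))
    finally show ?case using elim(1) by (simp add: complex_form_mult)
  qed
qed

end

section \<open>Taylor coefficients and Cauchy's estimate\<close>

lemma continuous_on_log_coeff: "continuous_on S (\<lambda>s. log_coeff e s k)"
proof (induction k rule: less_induct)
  case (less k)
  show ?case
  proof (cases k)
    case (Suc m)
    have "continuous_on S (\<lambda>s. log_coeff e s (m - j))" for j
      using Suc by (intro less) auto
    thus ?thesis unfolding Suc log_coeff.simps
      by (intro continuous_intros)
  qed simp
qed

context ordered_exponential
begin

lemma mob_eq_series:
  assumes z: "cmod z * p < pi" and s: "s \<in> {0..1}"
    and summ: "summable (\<lambda>k. norm (complexify (z ^ Suc k) (log_coeff e s k)))"
  shows "mob s z = (\<Sum>k. complexify (z ^ Suc k) (log_coeff e s k))"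
proof -
  let ?g = "\<lambda>k. complexify (z ^ Suc k) (log_coeff e s k)" and ?d = "\<lambda>k. complexify (z ^ Suc k) (e (Suc k))"
  have rec: "?g (Suc k) = ?d (Suc k) - s *\<^sub>R (\<Sum>j\<le>k. ?d j o\<^sub>L ?g (k - j))" for k
  proof -
    have "(\<Sum>j\<le>k. ?d j o\<^sub>L ?g (k - j)) = (\<Sum>j\<le>k. complexify (z ^ Suc (Suc k)) (e (Suc j) o\<^sub>L log_coeff e s (k - j)))"
    proof (intro sum.cong refl)
      fix j assume "j \<in> {..k}"
      hence "Suc (Suc k) = Suc j + Suc (k - j)" by simp
      hence "z ^ Suc (Suc k) = z ^ Suc j * z ^ Suc (k - j)" by (simp only: power_add)
      thus "?d j o\<^sub>L ?g (k - j) = complexify (z ^ Suc (Suc k)) (e (Suc j) o\<^sub>L log_coeff e s (k - j))"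
        by (simp only: complexify_compose)
    qed
    thus ?thesis by (simp only: log_coeff.simps complexify.diff_right complexify.scaleR_right complexify.sum_right)
  qed
  have "(id_blinfun + s *\<^sub>R D z) o\<^sub>L (\<Sum>k. ?g k) = D z"
    unfolding D_def by (rule resolvent_series[OF summable_D summ _ rec]) simp
  hence "res s z o\<^sub>L ((id_blinfun + s *\<^sub>R D z) o\<^sub>L (\<Sum>k. ?g k)) = mob s z"
    using mob_eq_res_D[OF z s] by simp
  moreover have "res s z o\<^sub>L ((id_blinfun + s *\<^sub>R D z) o\<^sub>L (\<Sum>k. ?g k))
      = (res s z o\<^sub>L (id_blinfun + s *\<^sub>R D z)) o\<^sub>L (\<Sum>k. ?g k)" by simp
  ultimately show ?thesis unfolding res_inverse[OF z s] by simp
qed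

lemma complex_form_mob_sums:
  assumes z: "2 * p * cmod z < 1" and s: "s \<in> {0..1}"
  shows "(\<lambda>k. of_real (inner (log_coeff e s k x) y) * z ^ Suc k) sums complex_form x y (mob s z)"
proof -
  have zp: "cmod z * p < pi"
  proof -
    have "2 * (cmod z * p) < 1" using z by (simp add: mult_ac)
    moreover have "0 \<le> cmod z * p" using p by simp
    ultimately show ?thesis using pi_ge_two by linarith
  qed
  have summ: "summable (\<lambda>k. norm (complexify (z ^ Suc k) (log_coeff e s k)))"
  proof (rule summable_comparison_test'[of "\<lambda>k. (2 * p * cmod z) ^ Suc k" 0])
    show "summable (\<lambda>k. (2 * p * cmod z) ^ Suc k)"
      using z p by (simp add: summable_mult summable_geometric)
    fix k :: nat
    have "norm (complexify (z ^ Suc k) (log_coeff e s k)) \<le> cmod (z ^ Suc k) * norm (log_coeff e s k)"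
      by (rule norm_complexify_le)
    also have "\<dots> \<le> cmod (z ^ Suc k) * (2 * p) ^ Suc k"
      using p s by (intro mult_left_mono norm_log_coeff_le norm_e_le_power) auto
    finally show "norm (norm (complexify (z ^ Suc k) (log_coeff e s k))) \<le> (2 * p * cmod z) ^ Suc k"
      by (simp add: norm_power power_mult_distrib norm_mult mult_ac)
  qed
  have "(\<lambda>k. complex_form x y (complexify (z ^ Suc k) (log_coeff e s k))) sums
      complex_form x y (\<Sum>k. complexify (z ^ Suc k) (log_coeff e s k))"
    by (rule bounded_linear.sums[OF bounded_linear_complex_form summable_sums[OF summable_norm_cancel[OF summ]]])
  thus ?thesis
    unfolding mob_eq_series[OF zp s summ] by (simp add: complex_form_complexify mult.commute)
qed

lemma higher_deriv_complex_form_mob: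
  assumes s: "s \<in> {0..1}"
  shows "(deriv ^^ Suc k) (\<lambda>z. complex_form x y (mob s z)) 0 / fact (Suc k)
     = of_real (inner (log_coeff e s k x) y)"
proof -
  \<comment> \<open>Index shift: the series of \<open>mob s\<close> starts in degree 1 and has
    \<open>log_coeff e s k\<close> in degree Suc k.\<close>
  define a where "a = (\<lambda>n. case n of 0 \<Rightarrow> 0 | Suc k \<Rightarrow> complex_of_real (inner (log_coeff e s k x) y))"
  have "(\<lambda>z. complex_form x y (mob s z)) has_fps_expansion Abs_fps a"
  proof (rule has_fps_expansionI)
    have "eventually (\<lambda>z. z \<in> ball 0 (1 / (2 * p))) (nhds (0::complex))"
      by (rule eventually_nhds_in_open) (use p in auto)
    thus "eventually (\<lambda>z. (\<lambda>n. fps_nth (Abs_fps a) n * z ^ n) sums complex_form x y (mob s z)) (nhds 0)"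
    proof eventually_elim
      case (elim z)
      hence "2 * p * cmod z < 1" using p by (simp add: field_simps)
      from complex_form_mob_sums[OF this s, of x y]
      have "(\<lambda>k. a (Suc k) * z ^ Suc k) sums (complex_form x y (mob s z) - a 0 * z ^ 0)"
        by (simp add: a_def)
      hence "(\<lambda>n. a n * z ^ n) sums (complex_form x y (mob s z) - a 0 * z ^ 0 + a 0 * z ^ 0)"
        by (rule sums_Suc_iff[of "\<lambda>n. a n * z ^ n", THEN iffD1])
      thus ?case by simp
    qed
  qed
  from fps_nth_fps_expansion[OF this, of "Suc k"] show ?thesis by (simp add: a_def)
qed

text \<open>Cauchy's estimate on the circle of radius \<rho>, on which |z| p = \<rho> p. The values
  stay in a disc with a fixed centre, and a constant has no derivatives, so only the radius of that
  disc appears. Choosing y as the image of x converts the bound on forms into one on the operator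
  norm.\<close>

lemma norm_log_coeff_le_disc_radius:
  assumes \<rho>: "0 < \<rho>" "\<rho> * p < pi" and t: "t \<in> {ell (\<rho> * p)..pi - ell (\<rho> * p)}"
  shows "norm (log_coeff e (mob_par (\<rho> * p) t) k) \<le> disc_radius (\<rho> * p) t / \<rho> ^ Suc k"
proof -
  define q s where "q = \<rho> * p" and "s = mob_par q t"
  have q: "0 < q" "q < pi" using \<rho> p by (auto simp: q_def)
  have t': "t \<in> {ell q..pi - ell q}" using t by (simp add: q_def)
  have s: "s \<in> {0..1}" unfolding s_def by (rule mob_par_range[OF q t'])
  have r: "0 < disc_radius q t" by (rule disc_radius_pos[OF q t'])
  let ?U = "{z::complex. cmod z * p < pi}"
  have form_le: "\<bar>inner (log_coeff e s k x) y\<bar> \<le> disc_radius q t * (norm x * norm y) / \<rho> ^ Suc k" for x y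
  proof (rule field_le_epsilon)
    fix \<epsilon> :: real assume \<epsilon>: "\<epsilon> > 0"
    let ?h = "\<lambda>z. complex_form x y (mob s z)"
    \<comment> \<open>Cauchy's estimate asks for values in an open ball, so the radius is enlarged
      by a term that contributes exactly \<epsilon> in the end.\<close>
    define b where "b = disc_radius q t * (norm x * norm y) + \<epsilon> * \<rho> ^ Suc k"
    have "open ?U" by (intro open_Collect_less continuous_intros)
    hence hol: "?h holomorphic_on ?U"
      using complex_form_mob_has_derivative[OF _ s] by (subst holomorphic_on_open) auto
    have sub: "cball 0 \<rho> \<subseteq> ?U"
    proof
      fix z :: complex assume "z \<in> cball 0 \<rho>"
      hence "cmod z * p \<le> \<rho> * p" using p by (intro mult_right_mono) auto
      thus "z \<in> ?U" using \<rho> by simp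
    qed
    have "cmod ((deriv ^^ Suc k) ?h 0) \<le> fact (Suc k) * b / \<rho> ^ Suc k"
    proof (rule Cauchy_higher_deriv_bound)
      show "?h holomorphic_on ball 0 \<rho>" 
        by (rule holomorphic_on_subset[OF hol]) (use sub ball_subset_cball in blast)
      show "continuous_on (cball 0 \<rho>) ?h"
        using holomorphic_on_imp_continuous_on[OF hol] sub by (rule continuous_on_subset)
      fix z :: complex assume "z \<in> ball 0 \<rho>"
      hence z: "cmod z * p \<le> q" unfolding q_def using p by (intro mult_right_mono) auto
      have "complex_form x y (disc_center q t *\<^sub>R id_blinfun) = of_real (disc_center q t * inner x y)"
        by (simp add: complex_form_def blinfun.scaleR_left complex_eq_iff)
      hence "?h z - of_real (disc_center q t * inner x y)
          = complex_form x y (mob s z - disc_center q t *\<^sub>R id_blinfun)"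
        by (simp add: linear_diff[OF bounded_linear.linear[OF bounded_linear_complex_form]])
      also have "cmod \<dots> \<le> norm (mob s z - disc_center q t *\<^sub>R id_blinfun) * (norm x * norm y)"
        by (rule norm_complex_form_le)
      also have "\<dots> \<le> disc_radius q t * (norm x * norm y)"
        unfolding s_def by (intro mult_right_mono norm_mob_diff_le[OF z q t']) auto
      also have "\<dots> < b" using \<epsilon> \<rho> by (simp add: b_def)
      finally show "?h z \<in> ball (of_real (disc_center q t * inner x y)) b"
        by (simp add: dist_norm norm_minus_commute)
    qed (use \<rho> in auto)
    hence "cmod ((deriv ^^ Suc k) ?h 0 / fact (Suc k)) \<le> b / \<rho> ^ Suc k"
      by (simp add: norm_divide divide_le_eq mult.commute del: fact_Suc funpow.simps power_Suc)
    hence "\<bar>inner (log_coeff e s k x) y\<bar> \<le> b / \<rho> ^ Suc k"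
      unfolding higher_deriv_complex_form_mob[OF s] by simp
    also have "\<dots> = disc_radius q t * (norm x * norm y) / \<rho> ^ Suc k + \<epsilon>"
      using \<rho> by (simp add: b_def add_divide_distrib)
    finally show "\<bar>inner (log_coeff e s k x) y\<bar> \<le> disc_radius q t * (norm x * norm y) / \<rho> ^ Suc k + \<epsilon>" .
  qed
  have "norm (log_coeff e s k) \<le> disc_radius q t / \<rho> ^ Suc k"
  proof (rule norm_blinfun_bound)
    show "0 \<le> disc_radius q t / \<rho> ^ Suc k" using r \<rho> by simp
    fix x
    let ?w = "log_coeff e s k x"
    have "norm ?w * norm ?w \<le> (disc_radius q t / \<rho> ^ Suc k * norm x) * norm ?w"
      using form_le[of x ?w] by (simp add: dot_square_norm power2_eq_square)
    show "norm ?w \<le> disc_radius q t / \<rho> ^ Suc k * norm x"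
    proof (cases "?w = 0")
      case True
      thus ?thesis using r \<rho> by simp
    next
      case False
      thus ?thesis using mult_right_le_imp_le[OF \<open>norm ?w * norm ?w \<le> _\<close>] by simp
    qed
  qed
  thus ?thesis by (simp add: s_def q_def)
qed

section \<open>The logarithm on the original space\<close>

definition D_real :: "real \<Rightarrow> ('a \<Rightarrow>\<^sub>L 'a)" where
  "D_real t = (\<Sum>k. t ^ Suc k *\<^sub>R e (Suc k))"

text \<open>The Moebius image of the ordered exponential of t \<phi>, given by its power series; its
  convergence for |t| p < pi rests on Cauchy's estimate.\<close>

definition G_real :: "real \<Rightarrow> real \<Rightarrow> ('a \<Rightarrow>\<^sub>L 'a)" where
  "G_real t s = (\<Sum>k. t ^ Suc k *\<^sub>R log_coeff e s k)"

text \<open>Index k holds the Magnus term of degree k + 1.\<close>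

definition log_term :: "nat \<Rightarrow> ('a \<Rightarrow>\<^sub>L 'a)" where
  "log_term k = integral {0..1} (\<lambda>s. log_coeff e s k)"

lemma summable_D_real: "summable (\<lambda>k. norm (t ^ Suc k *\<^sub>R e (Suc k)))"
proof (rule summable_comparison_test'[OF summable_diff_quot_bound[of "\<bar>t\<bar> * p"], of 0])
  fix k
  have "norm (t ^ Suc k *\<^sub>R e (Suc k)) \<le> \<bar>t\<bar> ^ Suc k * (p ^ Suc k / fact (Suc k))"
    using mult_left_mono[OF norm_e_le[of "Suc k"], of "\<bar>t\<bar> ^ Suc k"] by (simp add: power_abs abs_mult del: fact_Suc)
  thus "norm (norm (t ^ Suc k *\<^sub>R e (Suc k))) \<le> (\<bar>t\<bar> * p) ^ Suc k / fact (Suc k)"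
    by (simp add: power_mult_distrib mult_ac del: fact_Suc)
qed

lemma D_of_real: "D (of_real t) (x, 0) = (D_real t x, 0)"
proof -
  have "D (of_real t) (x, 0) = (\<Sum>k. complexify (of_real t ^ Suc k) (e (Suc k)) (x, 0))"
    unfolding D_def
    by (rule bounded_linear.suminf[OF blinfun.bounded_linear_left summable_norm_cancel[OF summable_D]])
  also have "\<dots> = (\<Sum>k. ((t ^ Suc k *\<^sub>R e (Suc k)) x, 0))"
    by (simp only: of_real_power[symmetric]) (simp add: complexify_apply blinfun.scaleR_left)
  also have "\<dots> = (D_real t x, 0)"
    unfolding D_real_def
    by (rule bounded_linear.suminf[of "\<lambda>T. (blinfun_apply T x, 0)", OF _ summable_norm_cancel[OF summable_D_real], symmetric])
       (intro bounded_linear_intros)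
  finally show ?thesis .
qed

lemma D_real_disc:
  assumes "\<bar>t\<bar> * p \<le> q" and q: "0 < q" "q < pi" and u: "u \<in> {ell q..pi - ell q}"
  shows "norm (D_real t x - disc_center q u *\<^sub>R (x + mob_par q u *\<^sub>R D_real t x))
    \<le> disc_radius q u * norm (x + mob_par q u *\<^sub>R D_real t x)"
  using D_disc[of "of_real t" q u "(x, 0)"] assms by (simp add: D_of_real norm_Pair)

lemma log_coeff_bounded:
  assumes \<rho>: "0 < \<rho>" "\<rho> * p < pi"
  obtains C where "\<And>k s. s \<in> {0..1} \<Longrightarrow> norm (log_coeff e s k) \<le> C / \<rho> ^ Suc k"
proof -
  have q: "0 < \<rho> * p" "\<rho> * p < pi" using \<rho> p by auto
  obtain C where C: "\<And>t. t \<in> {ell (\<rho> * p)..pi - ell (\<rho> * p)} \<Longrightarrow> \<bar>disc_center (\<rho> * p) t\<bar> + disc_radius (\<rho> * p) t \<le> C"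
    using disc_bounded[OF q] by blast
  have "norm (log_coeff e s k) \<le> C / \<rho> ^ Suc k" if s: "s \<in> {0..1}" for s k
  proof -
    obtain t where t: "t \<in> {ell (\<rho> * p)..pi - ell (\<rho> * p)}" "mob_par (\<rho> * p) t = s"
      using mob_par_surj[OF q s] by blast
    have "norm (log_coeff e s k) \<le> disc_radius (\<rho> * p) t / \<rho> ^ Suc k"
      using norm_log_coeff_le_disc_radius[OF \<rho> t(1)] t(2) by simp
    also have "\<dots> \<le> C / \<rho> ^ Suc k" using C[OF t(1)] \<rho> by (intro divide_right_mono) auto
    finally show ?thesis .
  qed
  thus ?thesis by (rule that)
qed

text \<open>A radius \<rho> strictly between |t| and pi / p turns the coefficient bound into a
  geometric majorant independent of s, which permits integration in s term by term.\<close>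

lemma G_real_terms_bounded:
  assumes t: "\<bar>t\<bar> * p < pi"
  obtains M where "summable M" "\<And>k s. s \<in> {0..1} \<Longrightarrow> norm (t ^ Suc k *\<^sub>R log_coeff e s k) \<le> M k"
proof -
  have "\<bar>t\<bar> < pi / p" using t p by (simp add: field_simps)
  then obtain \<rho> where \<rho>: "\<bar>t\<bar> < \<rho>" "\<rho> < pi / p" using dense by blast
  have \<rho>0: "0 < \<rho>" using \<rho>(1) by linarith
  have \<rho>p: "\<rho> * p < pi" using \<rho>(2) p by (simp add: field_simps)
  obtain C where C: "\<And>k s. s \<in> {0..1} \<Longrightarrow> norm (log_coeff e s k) \<le> C / \<rho> ^ Suc k"
    using log_coeff_bounded[OF \<rho>0 \<rho>p] by blast
  show ?thesis
  proof (rule that[of "\<lambda>k. C * (\<bar>t\<bar> / \<rho>) ^ Suc k"])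
    show "summable (\<lambda>k. C * (\<bar>t\<bar> / \<rho>) ^ Suc k)"
      using \<rho>(1) \<rho>0 by (intro summable_mult) (simp add: summable_mult summable_geometric)
    fix k s assume "s \<in> {0..1::real}"
    hence "\<bar>t\<bar> ^ Suc k * norm (log_coeff e s k) \<le> \<bar>t\<bar> ^ Suc k * (C / \<rho> ^ Suc k)"
      by (intro mult_left_mono C) auto
    thus "norm (t ^ Suc k *\<^sub>R log_coeff e s k) \<le> C * (\<bar>t\<bar> / \<rho>) ^ Suc k"
      by (simp add: power_abs abs_mult power_divide mult_ac)
  qed
qed

lemma G_real_uniform_limit:
  assumes t: "\<bar>t\<bar> * p < pi"
  shows "uniform_limit {0..1} (\<lambda>n s. \<Sum>k<n. t ^ Suc k *\<^sub>R log_coeff e s k) (G_real t) sequentially"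
proof -
  obtain M where M: "summable M" "\<And>k s. s \<in> {0..1} \<Longrightarrow> norm (t ^ Suc k *\<^sub>R log_coeff e s k) \<le> M k"
    using G_real_terms_bounded[OF t] by blast
  show ?thesis unfolding G_real_def[abs_def] by (rule Weierstrass_m_test[OF M(2) M(1)])
qed

lemma continuous_on_G_real:
  assumes t: "\<bar>t\<bar> * p < pi"
  shows "continuous_on {0..1} (G_real t)"
  by (rule uniform_limit_theorem[OF _ G_real_uniform_limit[OF t]])
     (auto intro!: always_eventually continuous_intros continuous_on_log_coeff)

lemma log_term_sums:
  assumes t: "\<bar>t\<bar> * p < pi"
  shows "(\<lambda>k. t ^ Suc k *\<^sub>R log_term k) sums integral {0..1} (G_real t)"
proof -
  obtain I J where IJ: "\<And>n. ((\<lambda>s. \<Sum>k<n. t ^ Suc k *\<^sub>R log_coeff e s k) has_integral I n) {0..1}"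
    "(G_real t has_integral J) {0..1}" "I \<longlonglongrightarrow> J"
    by (rule uniform_limit_integral[OF G_real_uniform_limit[OF t]])
       (auto intro!: continuous_intros continuous_on_log_coeff)
  have "I n = (\<Sum>k<n. t ^ Suc k *\<^sub>R log_term k)" for n
  proof -
    have "((\<lambda>s. \<Sum>k<n. t ^ Suc k *\<^sub>R log_coeff e s k) has_integral (\<Sum>k<n. t ^ Suc k *\<^sub>R log_term k)) {0..1}"
      unfolding log_term_def
      by (intro has_integral_sum has_integral_cmul integrable_integral integrable_continuous_real
          continuous_on_log_coeff) auto
    thus ?thesis using IJ(1) has_integral_unique by blast
  qed
  hence "I = (\<lambda>n. \<Sum>k<n. t ^ Suc k *\<^sub>R log_term k)" by (rule ext)
  thus ?thesis using IJ(3) unfolding sums_def integral_unique[OF IJ(2)] by (simp only:)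
qed

lemma G_real_eq:
  assumes t: "\<bar>t\<bar> * p < pi" and s: "s \<in> {0..1}"
  shows "(id_blinfun + s *\<^sub>R D_real t) o\<^sub>L G_real t s = D_real t"
proof -
  let ?g = "\<lambda>k. t ^ Suc k *\<^sub>R log_coeff e s k" and ?d = "\<lambda>k. t ^ Suc k *\<^sub>R e (Suc k)"
  obtain M where M: "summable M" "\<And>k s. s \<in> {0..1} \<Longrightarrow> norm (t ^ Suc k *\<^sub>R log_coeff e s k) \<le> M k"
    using G_real_terms_bounded[OF t] by blast
  have g: "summable (\<lambda>k. norm (?g k))"
    by (rule summable_comparison_test'[OF M(1), of 0]) (use M(2)[OF s] in simp)
  have rec: "?g (Suc k) = ?d (Suc k) - s *\<^sub>R (\<Sum>j\<le>k. ?d j o\<^sub>L ?g (k - j))" for k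
  proof -
    have "(\<Sum>j\<le>k. ?d j o\<^sub>L ?g (k - j)) = (\<Sum>j\<le>k. t ^ Suc (Suc k) *\<^sub>R (e (Suc j) o\<^sub>L log_coeff e s (k - j)))"
    proof (intro sum.cong refl)
      fix j assume "j \<in> {..k}"
      hence "Suc (Suc k) = Suc j + Suc (k - j)" by simp
      hence "t ^ Suc (Suc k) = t ^ Suc j * t ^ Suc (k - j)" by (simp only: power_add)
      thus "?d j o\<^sub>L ?g (k - j) = t ^ Suc (Suc k) *\<^sub>R (e (Suc j) o\<^sub>L log_coeff e s (k - j))"
        by (simp only: blinfun_compose_distribs scaleR_scaleR mult.commute)
    qed
    thus ?thesis
      by (simp only: log_coeff.simps scaleR_diff_right scaleR_sum_right[symmetric] scaleR_left_commute)
  qed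
  show ?thesis
    unfolding G_real_def D_real_def by (rule resolvent_series[OF summable_D_real g _ rec]) simp
qed

text \<open>Formally G = D (1 + s D)^(- 1), hence 1 - s G = (1 + s D)^(- 1). The series equation
  gives a right inverse; it is two-sided because 1 + s D is bounded below, a property inherited from
  the complexified space through the vectors (x, 0).\<close>

lemma G_real_inverse:
  assumes t: "\<bar>t\<bar> * p < pi" and s: "s \<in> {0..1}"
  shows "(id_blinfun + s *\<^sub>R D_real t) o\<^sub>L (id_blinfun - s *\<^sub>R G_real t s) = id_blinfun"
    "(id_blinfun - s *\<^sub>R G_real t s) o\<^sub>L (id_blinfun + s *\<^sub>R D_real t) = id_blinfun"
    "D_real t o\<^sub>L (id_blinfun - s *\<^sub>R G_real t s) = G_real t s"
proof -
  let ?M = "id_blinfun + s *\<^sub>R D_real t" and ?R = "id_blinfun - s *\<^sub>R G_real t s"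
  have "?M o\<^sub>L ?R = ?M - s *\<^sub>R (?M o\<^sub>L G_real t s)"
    unfolding blinfun_compose_distribs(4) blinfun_compose_distribs(6) by simp
  thus right: "?M o\<^sub>L ?R = id_blinfun" unfolding G_real_eq[OF t s] by simp
  have "cmod (of_real t) * p < pi" using t by simp
  then obtain q where q: "0 < q" "q < pi" "cmod (of_real t) * p < q" by (rule radius_between)
  obtain C where C: "0 \<le> C"
    "\<And>z s x. cmod z * p \<le> q \<Longrightarrow> s \<in> {0..1} \<Longrightarrow> norm (D z x) \<le> C * norm (x + s *\<^sub>R D z x)"
    using D_lower_bound[OF q(1,2)] by blast
  have "norm x \<le> (1 + C) * norm (?M x)" for x
  proof -
    let ?y = "x + s *\<^sub>R D_real t x"
    have "norm (D_real t x) \<le> C * norm ?y"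
      using C(2)[of "of_real t" s "(x, 0)"] q(3) s by (simp add: D_of_real norm_Pair)
    moreover have "norm x \<le> norm ?y + norm (s *\<^sub>R D_real t x)"
      using norm_triangle_ineq4[of ?y "s *\<^sub>R D_real t x"] by simp
    moreover have "norm (s *\<^sub>R D_real t x) \<le> 1 * norm (D_real t x)" using s by (simp add: mult_left_le_one_le)
    ultimately show ?thesis by (simp add: blinfun.add_left blinfun.scaleR_left algebra_simps)
  qed
  from left_inverse_of_injective[OF right this] show "?R o\<^sub>L ?M = id_blinfun" .
  show "D_real t o\<^sub>L ?R = G_real t s"
    using G_real_eq[OF t s] by (simp add: blinfun_compose_distribs algebra_simps)
qed

text \<open>The denominator in \<open>op_log\<close> is s + (1 - s) A = 1 + (1 - s) D, so its
  parameter runs backwards relative to that of \<open>G_real\<close>.\<close>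

lemma op_log_eq:
  assumes t: "\<bar>t\<bar> * p < pi"
  shows "op_log (id_blinfun + D_real t) = integral {0..1} (G_real t)"
proof -
  have eq: "(id_blinfun + D_real t - id_blinfun) o\<^sub>L op_inv (s *\<^sub>R id_blinfun + (1 - s) *\<^sub>R (id_blinfun + D_real t))
      = G_real t (1 - s)" if "s \<in> {0..1}" for s
  proof -
    have s: "1 - s \<in> {0..1}" using that by simp
    have M: "s *\<^sub>R id_blinfun + (1 - s) *\<^sub>R (id_blinfun + D_real t) = id_blinfun + (1 - s) *\<^sub>R D_real t"
      by (simp add: algebra_simps)
    show ?thesis unfolding M op_inv_eq[OF G_real_inverse(1,2)[OF t s]]
      using G_real_inverse(3)[OF t s] by simp
  qed
  let ?i = "integral {0..1} (G_real t)"
  have "(G_real t has_integral ?i) {0..1}"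
    by (intro integrable_integral integrable_continuous_real continuous_on_G_real t)
  hence "((\<lambda>s. G_real t (- s)) has_integral ?i) {- 1..- 0}"
    using has_integral_reflect_real[of "G_real t" ?i 1 0] by blast
  hence "((\<lambda>s. G_real t (- (s + - 1))) has_integral ?i) {- 1 - - 1..- 0 - - 1}"
    by (rule has_integral_shift_real_ivl)
  hence "integral {0..1} (\<lambda>s. G_real t (1 - s)) = ?i" by (simp add: integral_unique)
  moreover have "op_log (id_blinfun + D_real t) = integral {0..1} (\<lambda>s. G_real t (1 - s))"
    unfolding op_log_def by (rule integral_cong) (rule eq)
  ultimately show ?thesis by simp
qed

lemma norm_op_log_le: "norm (op_log (id_blinfun + D_real 1)) \<le> J p"
proof -
  have t: "\<bar>1\<bar> * p < pi" using p by simp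
  have "norm (integral {0..1} (G_real 1)) \<le> 1 * J p"
  proof (rule norm_integral_le_J[OF p continuous_on_G_real[OF t]])
    fix u assume u: "u \<in> {ell p..pi - ell p}"
    have s: "mob_par p u \<in> {0..1}" by (rule mob_par_range[OF p u])
    let ?s = "mob_par p u" and ?R = "id_blinfun - mob_par p u *\<^sub>R G_real 1 (mob_par p u)"
    have "norm (G_real 1 ?s - disc_center p u *\<^sub>R id_blinfun) \<le> disc_radius p u"
    proof (rule norm_blinfun_bound)
      show "0 \<le> disc_radius p u" using disc_radius_pos[OF p u] by simp
      fix y
      have 1: "?R y + ?s *\<^sub>R D_real 1 (?R y) = y"
        using arg_cong[OF G_real_inverse(1)[OF t s], of "\<lambda>T. T y"] by (simp add: blinfun.add_left blinfun.scaleR_left)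
      have 2: "D_real 1 (?R y) = G_real 1 ?s y"
        using arg_cong[OF G_real_inverse(3)[OF t s], of "\<lambda>T. T y"] by simp
      show "norm ((G_real 1 ?s - disc_center p u *\<^sub>R id_blinfun) y) \<le> disc_radius p u * norm y"
        using D_real_disc[OF _ p u, of 1 "?R y"] unfolding 1 unfolding 2
        by (simp add: blinfun.diff_left blinfun.scaleR_left)
    qed
    thus "norm (G_real 1 ?s - disc_center p u *\<^sub>R id_blinfun) \<le> 1 * disc_radius p u" by simp
  qed
  thus ?thesis by (simp add: op_log_eq[OF t])
qed

text \<open>Cauchy's estimate has already removed the centres, so \<open>norm_integral_le_J\<close>
  is applied with the zero vector for \<open>e\<close>.\<close>

lemma norm_log_term_le:
  assumes \<rho>: "0 < \<rho>" "\<rho> * p < pi"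
  shows "norm (log_term k) \<le> J (\<rho> * p) / \<rho> ^ Suc k"
proof -
  have q: "0 < \<rho> * p" "\<rho> * p < pi" using \<rho> p by auto
  have "norm (log_term k) \<le> 1 / \<rho> ^ Suc k * J (\<rho> * p)"
    unfolding log_term_def
  proof (rule norm_integral_le_J[OF q continuous_on_log_coeff])
    fix t assume "t \<in> {ell (\<rho> * p)..pi - ell (\<rho> * p)}"
    from norm_log_coeff_le_disc_radius[OF \<rho> this]
    show "norm (log_coeff e (mob_par (\<rho> * p) t) k - disc_center (\<rho> * p) t *\<^sub>R 0) \<le> 1 / \<rho> ^ Suc k * disc_radius (\<rho> * p) t"
      by simp
  qed
  thus ?thesis by simp
qed

end

subsection \<open>The Magnus expansion\<close>

text \<open>Pairing with an x that separates the m-th coefficients and with y = a m x - b m x gives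
  a scalar power series that vanishes near 0 but has a nonzero coefficient.\<close>

lemma power_series_coefficients_unique:
  fixes a b :: "nat \<Rightarrow> ('a::real_inner \<Rightarrow>\<^sub>L 'a)"
  assumes "\<forall>\<^sub>F t::real in nhds 0. (\<lambda>k. t ^ Suc k *\<^sub>R a k) sums f t"
    and "\<forall>\<^sub>F t::real in nhds 0. (\<lambda>k. t ^ Suc k *\<^sub>R b k) sums f t"
  shows "a = b"
proof (rule ext, rule ccontr)
  fix m assume "a m \<noteq> b m"
  then obtain x where x: "a m x \<noteq> b m x" using blinfun_eqI by blast
  define y where "y = a m x - b m x"
  define c where "c = (\<lambda>n. case n of 0 \<Rightarrow> 0 | Suc k \<Rightarrow> inner (a k x - b k x) y)"
  have "\<forall>\<^sub>F t::real in nhds 0. (\<lambda>k. t ^ Suc k *\<^sub>R a k) sums f t \<and> (\<lambda>k. t ^ Suc k *\<^sub>R b k) sums f t"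
    using assms by (rule eventually_conj)
  then obtain r where r: "0 < r" "\<And>t::real. \<bar>t\<bar> < r \<Longrightarrow>
      (\<lambda>k. t ^ Suc k *\<^sub>R a k) sums f t \<and> (\<lambda>k. t ^ Suc k *\<^sub>R b k) sums f t"
    by (auto simp: eventually_nhds_metric dist_norm)
  have "(\<lambda>n. c n * (t - 0) ^ n) sums 0" if "norm (t - 0) < r" for t :: real
  proof -
    have "(\<lambda>k. t ^ Suc k *\<^sub>R a k - t ^ Suc k *\<^sub>R b k) sums (f t - f t)"
      using r(2)[of t] that by (intro sums_diff) auto
    hence "(\<lambda>k. inner ((t ^ Suc k *\<^sub>R a k - t ^ Suc k *\<^sub>R b k) x) y) sums inner ((f t - f t) x) y"
      by (intro bounded_linear.sums[OF bounded_linear_inner_left] bounded_linear.sums[OF blinfun.bounded_linear_left])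
    hence "(\<lambda>k. c (Suc k) * t ^ Suc k) sums 0"
      by (simp add: c_def blinfun.diff_left blinfun.scaleR_left inner_diff algebra_simps)
    hence "(\<lambda>n. c n * t ^ n) sums (0 + c 0 * t ^ 0)"
      by (rule sums_Suc_iff[of "\<lambda>n. c n * t ^ n", THEN iffD1])
    thus ?thesis by (simp add: c_def)
  qed
  moreover have "c (Suc m) \<noteq> 0" using x by (simp add: c_def y_def)
  ultimately obtain s where s: "0 < s" "\<And>z::real. z \<in> cball 0 s - {0} \<Longrightarrow> (\<lambda>_. 0 :: real) z \<noteq> 0"
    using powser_0_nonzero[OF r(1), of 0 c "\<lambda>_. 0" "Suc m"] by (metis zero_less_Suc)
  from s(2)[of s] s(1) show False by simp
qed

lemma magnus_R_eq_log_term: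
  fixes \<phi> :: "real set \<Rightarrow> ('a::{real_inner,banach} \<Rightarrow>\<^sub>L 'a)"
  assumes "ordered_exponential e B p"
    and e: "\<And>t k. simplex_integral I (\<lambda>E. t *\<^sub>R \<phi> E) k = t ^ k *\<^sub>R e k"
  shows "magnus_R I \<phi> (Suc k) = ordered_exponential.log_term e k"
    and "magnus_sum_R I \<phi> = op_log (id_blinfun + ordered_exponential.D_real e 1)"
proof -
  interpret ordered_exponential e B p by fact
  have exp_R: "exp_R I (\<lambda>E. t *\<^sub>R \<phi> E) = id_blinfun + D_real t" for t
    unfolding exp_R_def D_real_def e ..
  have sums: "(\<lambda>k. t ^ Suc k *\<^sub>R log_term k) sums op_log (exp_R I (\<lambda>E. t *\<^sub>R \<phi> E))" if "\<bar>t\<bar> * p < pi" for t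
    unfolding exp_R op_log_eq[OF that] by (rule log_term_sums[OF that])
  have "eventually (\<lambda>t::real. t \<in> ball 0 (pi / p)) (nhds 0)"
    by (rule eventually_nhds_in_open) (use p in auto)
  hence ev: "\<forall>\<^sub>F t::real in nhds 0. (\<lambda>k. t ^ Suc k *\<^sub>R log_term k) sums op_log (exp_R I (\<lambda>E. t *\<^sub>R \<phi> E))"
  proof eventually_elim
    case (elim t)
    hence "\<bar>t\<bar> * p < pi" using p by (simp add: field_simps)
    thus ?case by (rule sums)
  qed
  define c where "c = (\<lambda>n. case n of 0 \<Rightarrow> 0 | Suc k \<Rightarrow> log_term k)"
  have "magnus_R I \<phi> = c"
    unfolding magnus_R_def
  proof (rule the_equality)
    show "c 0 = 0 \<and> (\<forall>\<^sub>F t::real in nhds 0. (\<lambda>k. t ^ Suc k *\<^sub>R c (Suc k)) sums op_log (exp_R I (\<lambda>E. t *\<^sub>R \<phi> E)))"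
      using ev by (simp add: c_def)
    fix c' assume c': "c' 0 = 0 \<and> (\<forall>\<^sub>F t::real in nhds 0. (\<lambda>k. t ^ Suc k *\<^sub>R c' (Suc k)) sums op_log (exp_R I (\<lambda>E. t *\<^sub>R \<phi> E)))"
    hence "(\<lambda>k. c' (Suc k)) = log_term" using ev by (intro power_series_coefficients_unique) auto
    thus "c' = c" using c' by (auto simp: c_def fun_eq_iff split: nat.splits)
  qed
  thus m: "magnus_R I \<phi> (Suc k) = log_term k" for k by (simp add: c_def)
  \<comment> \<open>p < pi places t = 1 in the range |t| p < pi of convergence.\<close>
  have "(\<lambda>k. log_term k) sums op_log (id_blinfun + D_real 1)"
    using sums[of 1] p unfolding exp_R by simp
  thus "magnus_sum_R I \<phi> = op_log (id_blinfun + D_real 1)"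
    unfolding magnus_sum_R_def m by (simp add: sums_iff)
qed

theorem theorem9p16:
  fixes I :: "real set"
    and \<phi> :: "real set \<Rightarrow> ('a::{real_inner,banach} \<Rightarrow>\<^sub>L 'a)"
  assumes "ordered_measure I \<phi>"
    and "total_variation (borel_on I) \<phi> < pi"
  shows "norm (magnus_sum_R I \<phi>) \<le> J (total_variation (borel_on I) \<phi>) \<and>
    (\<forall>k::nat. k \<ge> 1 \<longrightarrow>
       norm (magnus_R I \<phi> k)
         \<le> pi powi (- int k + 1) * (2 * sqrt (exp 1 * real k)) * total_variation (borel_on I) \<phi> ^ k)"
proof -
  define p where "p = total_variation (borel_on I) \<phi>"
  obtain e B where e: "\<And>t k. simplex_integral I (\<lambda>E. t *\<^sub>R \<phi> E) k = t ^ k *\<^sub>R e k"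
    and B: "\<And>n i. i < n \<Longrightarrow> norm (B n i) \<le> p / real n"
    and lim: "\<And>k. (\<lambda>n. elem_sym (B n) n k) \<longlonglongrightarrow> e k" and p0: "0 \<le> p"
    by (rule ordered_measure_approximation[OF assms(1), folded p_def]) (rule that)
  have powi: "pi powi (- int k + 1) = pi / pi ^ k" for k
    using power_int_diff[of pi 1 "int k"] by simp
  show ?thesis
  proof (cases "p = 0")
    case True
    have B0: "norm (B n i) \<le> 0" if "i < n" for n i
      using B[OF that] True by simp
    \<comment> \<open>All increments vanish here, while the locale asks for a positive bound below
      pi; the bound 1 serves.\<close>
    have "norm (B n i) \<le> 1 / real n" if "i < n" for n i
      by (rule order_trans[OF B0[OF that]]) simp
    then interpret ordered_exponential e B 1
      using lim pi_ge_two by unfold_locales auto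
    note m = magnus_R_eq_log_term[OF ordered_exponential_axioms e]
    have e0: "e (Suc k) = 0" for k
    proof -
      have "norm (elem_sym (B n) n (Suc k)) \<le> 0 ^ Suc k / fact (Suc k)" for n
        by (rule norm_elem_sym_le) (use B0 in auto)
      hence "elem_sym (B n) n (Suc k) = 0" for n by simp
      thus ?thesis using lim[of "Suc k"] by (simp add: LIMSEQ_const_iff)
    qed
    have "log_coeff e s k = 0" for s k
      using e0[of 0] by (cases k) (simp_all add: e0 blinfun_compose.zero_left)
    hence l0: "log_term k = 0" for k by (simp add: log_term_def)
    have "magnus_sum_R I \<phi> = 0" unfolding magnus_sum_R_def m(1) l0 by simp
    moreover have "norm (magnus_R I \<phi> k) \<le> 0" if "1 \<le> k" for k
      using that m(1)[of "k - 1"] l0 by simp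
    ultimately show ?thesis unfolding p_def[symmetric] True by (simp add: J_def)
  next
    case False
    then interpret ordered_exponential e B p
      using B lim p0 assms(2) by unfold_locales (auto simp: p_def)
    note m = magnus_R_eq_log_term[OF ordered_exponential_axioms e]
    have "norm (magnus_R I \<phi> k) \<le> pi powi (- int k + 1) * (2 * sqrt (exp 1 * real k)) * p ^ k" if k: "1 \<le> k" for k
    proof (cases "k = 1")
      case True
      \<comment> \<open>The estimate of J at pi (1 - 1 / (2 k)) starts at k = 2, where \<epsilon>
        \<le> 1 / 4; the first Magnus term is e 1, of norm at most p.\<close>
      have "log_term 0 = e 1" by (simp add: log_term_def)
      hence "norm (magnus_R I \<phi> k) \<le> p ^ 1" using True m(1)[of 0] norm_e_le_power[of 1] by simp
      also have "\<dots> \<le> 2 * sqrt (exp 1) * p"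
      proof -
        have "1 \<le> sqrt (exp (1::real))" by simp
        hence "1 \<le> 2 * sqrt (exp (1::real))" by linarith
        hence "1 * p \<le> 2 * sqrt (exp 1) * p" by (rule mult_right_mono) (use p in simp)
        thus ?thesis by simp
      qed
      finally show ?thesis using True by simp
    next
      case False
      hence k2: "2 \<le> k" using k by simp
      \<comment> \<open>\<rho> is the factor that scales the total variation p to pi (1 -
        \<epsilon>), the argument at which J is estimated.\<close>
      define \<epsilon> where "\<epsilon> = 1 / (2 * real k)"
      define \<rho> where "\<rho> = pi * (1 - \<epsilon>) / p"
      have \<epsilon>: "0 < \<epsilon>" "\<epsilon> < 1" using k2 by (auto simp: \<epsilon>_def)
      have \<rho>: "0 < \<rho>" "\<rho> * p = pi * (1 - \<epsilon>)" using \<epsilon> p by (auto simp: \<rho>_def)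
      have "\<rho> * p < pi" using \<epsilon> unfolding \<rho>(2) by simp
      have "norm (magnus_R I \<phi> k) = norm (log_term (k - 1))" using m(1)[of "k - 1"] k by simp
      also have "\<dots> \<le> J (pi * (1 - \<epsilon>)) / \<rho> ^ k"
        using norm_log_term_le[OF \<rho>(1) \<open>\<rho> * p < pi\<close>, of "k - 1"] k unfolding \<rho>(2) by simp
      also have "\<dots> \<le> (2 * pi * sqrt (exp 1 * real k) * (1 - \<epsilon>) ^ k) / \<rho> ^ k"
        using J_le_at_optimal_radius[OF k2] \<rho>(1) unfolding \<epsilon>_def by (intro divide_right_mono) auto
      also have "\<dots> = pi powi (- int k + 1) * (2 * sqrt (exp 1 * real k)) * p ^ k"
      proof -
        define X where "X = (1 - \<epsilon>) ^ k"
        have X: "X \<noteq> 0" using \<epsilon> by (simp add: X_def)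
        have "\<rho> ^ k = pi ^ k * X / p ^ k" by (simp add: \<rho>_def X_def power_divide power_mult_distrib)
        thus ?thesis using X p unfolding powi X_def[symmetric] by simp
      qed
      finally show ?thesis .
    qed
    thus ?thesis using norm_op_log_le unfolding m(2) p_def by blast
  qed
qed

end
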